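(* Let $A$ be a finite non-local commutative ring. Then the crosscap number $\overline{\gamma}(L(EG(A)))$ of the line graph of the essential graph of $A$ is $1$ if and only if $A$ is isomorphic to one of the rings: $\mathbb{Z}_2\times\mathbb{Z}_4$, $\mathbb{Z}_2\times\frac{\mathbb{Z}_2[x]}{\langle x^2\rangle}$, $\mathbb{Z}_2\times\mathbb{Z}_7$, $\mathbb{F}_4\times\mathbb{F}_4$.
   Context: All rings have unity $1\neq 0$. $\mathbb{Z}_n$ is the ring of integers modulo $n$ and $\mathbb{F}_n$ the finite field with $n$ elements. A ring is local if it has exactly one maximal ideal. An ideal $I$ of a commutative ring $A$ is essential if $I\cap J\neq 0$ for every non-zero ideal $J$ of $A$ (so $A$ itself is essential). For $s\in A$, $\mathrm{ann}_A(s)=\{r\in A : sr=0\}$. The essential graph $EG(A)$ is the simple undirected graph whose vertices are the non-zero zero-divisors of $A$, two distinct vertices $u,v$ being adjacent if and only if $\mathrm{ann}_A(uv)$ is an essential ideal of $A$. The line graph $L(G)$ of a graph $G$ has the edges of $G$ as vertices, two distinct ones being adjacent exactly when the corresponding edges share an endpoint in $G$. The crosscap number $\overline{\gamma}(G)$ of a graph $G$ is the least integer $k\ge 0$ such that $G$ can be drawn without edge crossings on $N_k$, the surface obtained from the sphere by attaching $k$ crosscaps ($N_0$ being the sphere, so planar graphs have crosscap number $0$). *)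

theory Defs
  imports
    "HOL-Analysis.Analysis"
    "HOL-Algebra.Algebra"
    "HOL-Number_Theory.Residues"
    "HOL-Library.Extended_Nat"
begin

text \<open>A simple undirected graph is a pair of a vertex set and a set of edges, the edges being
  two-element sets of vertices.\<close>

type_synonym 'v graph = "'v set \<times> 'v set set"

definition line_graph :: "'v graph \<Rightarrow> 'v set graph" where
  "line_graph G = (snd G, {{e, f} | e f. e \<in> snd G \<and> f \<in> snd G \<and> e \<noteq> f \<and> e \<inter> f \<noteq> {}})"

definition zero_divisors :: "('a, 'm) ring_scheme \<Rightarrow> 'a set" where
  "zero_divisors R =
     {x \<in> carrier R. \<exists>y \<in> carrier R. y \<noteq> \<zero>\<^bsub>R\<^esub> \<and> x \<otimes>\<^bsub>R\<^esub> y = \<zero>\<^bsub>R\<^esub>}"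

definition ann :: "('a, 'm) ring_scheme \<Rightarrow> 'a \<Rightarrow> 'a set" where
  "ann R s = {r \<in> carrier R. s \<otimes>\<^bsub>R\<^esub> r = \<zero>\<^bsub>R\<^esub>}"

definition essential_ideal :: "'a set \<Rightarrow> ('a, 'm) ring_scheme \<Rightarrow> bool" where
  "essential_ideal I R \<longleftrightarrow>
     ideal I R \<and> (\<forall>J. ideal J R \<and> J \<noteq> {\<zero>\<^bsub>R\<^esub>} \<longrightarrow> I \<inter> J \<noteq> {\<zero>\<^bsub>R\<^esub>})"

definition essential_graph :: "('a, 'm) ring_scheme \<Rightarrow> 'a graph" where
  "essential_graph R =
     (let V = zero_divisors R - {\<zero>\<^bsub>R\<^esub>}
      in (V, {{u, v} | u v. u \<in> V \<and> v \<in> V \<and> u \<noteq> v \<and> essential_ideal (ann R (u \<otimes>\<^bsub>R\<^esub> v)) R}))"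

definition local_ring :: "('a, 'm) ring_scheme \<Rightarrow> bool" where
  "local_ring R \<longleftrightarrow> (\<exists>!M. maximalideal M R)"

definition quotient_topology :: "'a topology \<Rightarrow> ('a \<times> 'a) set \<Rightarrow> 'a set topology" where
  "quotient_topology Y r =
     topology (\<lambda>U. U \<subseteq> topspace Y // r \<and> openin Y {x \<in> topspace Y. r `` {x} \<in> U})"

lemma openin_quotient_topology:
  "openin (quotient_topology Y r) U \<longleftrightarrow>
     U \<subseteq> topspace Y // r \<and> openin Y {x \<in> topspace Y. r `` {x} \<in> U}"
proof -
  have "istopology (\<lambda>U. U \<subseteq> topspace Y // r \<and> openin Y {x \<in> topspace Y. r `` {x} \<in> U})"
    unfolding istopology_def
  proof (intro conjI allI impI)
    fix S T
    assume S: "S \<subseteq> topspace Y // r \<and> openin Y {x \<in> topspace Y. r `` {x} \<in> S}"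
      and T: "T \<subseteq> topspace Y // r \<and> openin Y {x \<in> topspace Y. r `` {x} \<in> T}"
    have eq: "{x \<in> topspace Y. r `` {x} \<in> S \<inter> T} =
        {x \<in> topspace Y. r `` {x} \<in> S} \<inter> {x \<in> topspace Y. r `` {x} \<in> T}"
      by auto
    show "openin Y {x \<in> topspace Y. r `` {x} \<in> S \<inter> T}"
      unfolding eq by (rule openin_Int[OF conjunct2[OF S] conjunct2[OF T]])
    show "S \<inter> T \<subseteq> topspace Y // r" using S by auto
  next
    fix K
    assume K: "\<forall>S\<in>K. S \<subseteq> topspace Y // r \<and> openin Y {x \<in> topspace Y. r `` {x} \<in> S}"
    have eq: "{x \<in> topspace Y. r `` {x} \<in> \<Union>K} = (\<Union>S\<in>K. {x \<in> topspace Y. r `` {x} \<in> S})"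
      by auto
    show "openin Y {x \<in> topspace Y. r `` {x} \<in> \<Union>K}"
      unfolding eq using K by (intro openin_Union) auto
    show "\<Union>K \<subseteq> topspace Y // r" using K by auto
  qed
  then show ?thesis
    unfolding quotient_topology_def by (simp only: topology_inverse')
qed

lemma topspace_quotient_topology: "topspace (quotient_topology Y r) = topspace Y // r"
proof
  show "topspace (quotient_topology Y r) \<subseteq> topspace Y // r"
    using openin_topspace[of "quotient_topology Y r"] unfolding openin_quotient_topology
    by (rule conjunct1)
  have eq: "{x \<in> topspace Y. r `` {x} \<in> topspace Y // r} = topspace Y"
    by (auto intro: quotientI)
  have "openin (quotient_topology Y r) (topspace Y // r)"
    unfolding openin_quotient_topology eq by (intro conjI subset_refl openin_topspace)
  then show "topspace Y // r \<subseteq> topspace (quotient_topology Y r)"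
    by (rule openin_subset)
qed

lemma quotient_map_quotient_topology:
  "quotient_map Y (quotient_topology Y r) (\<lambda>x. r `` {x})"
  unfolding quotient_map_def topspace_quotient_topology openin_quotient_topology
proof (intro conjI allI impI)
  show "(\<lambda>x. r `` {x}) ` topspace Y = topspace Y // r" by (auto simp: quotient_def)
qed simp

text \<open>The surface \<open>N\<^sub>k\<close> is obtained from the unit sphere by removing \<open>k\<close> open discs with
  pairwise disjoint closures and identifying antipodal points of each of the \<open>k\<close> boundary circles.
  The discs are the caps of (chordal) radius \<open>1 / k\<close> around \<open>k\<close> equally spaced points of
  the equator. The antipode of \<open>x\<close> on the circle around \<open>c\<close> is its image under the half turn
  about the axis through \<open>c\<close>.\<close>

definition crosscap_centre :: "nat \<Rightarrow> nat \<Rightarrow> real ^ 3" where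
  "crosscap_centre k i = vector [cos (2 * pi * real i / real k), sin (2 * pi * real i / real k), 0]"

definition holed_sphere :: "nat \<Rightarrow> (real ^ 3) set" where
  "holed_sphere k = sphere 0 1 - (\<Union>i<k. ball (crosscap_centre k i) (1 / real k))"

definition half_turn :: "real ^ 3 \<Rightarrow> real ^ 3 \<Rightarrow> real ^ 3" where
  "half_turn c x = (2 * (x \<bullet> c)) *\<^sub>R c - x"

definition crosscap_rel :: "nat \<Rightarrow> ((real ^ 3) \<times> (real ^ 3)) set" where
  "crosscap_rel k =
     {(x, y). x \<in> holed_sphere k \<and> y \<in> holed_sphere k \<and>
        (x = y \<or>
         (\<exists>i<k. x \<in> sphere (crosscap_centre k i) (1 / real k) \<and>
                y = half_turn (crosscap_centre k i) x))}"

definition nonorientable_surface :: "nat \<Rightarrow> (real ^ 3) set topology" where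
  "nonorientable_surface k = quotient_topology (top_of_set (holed_sphere k)) (crosscap_rel k)"

lemma norm_crosscap_centre: "norm (crosscap_centre k i) = 1"
  by (simp add: norm_eq_sqrt_inner inner_vec_def sum_3 crosscap_centre_def
      power2_eq_square[symmetric])

lemma dist_half_turn:
  assumes "norm c = 1"
  shows "norm (half_turn c x) = norm x" and "dist c (half_turn c x) = dist c x"
    and "half_turn c (half_turn c x) = x"
proof -
  have cc: "c \<bullet> c = 1" using assms by (simp add: dot_square_norm)
  have "half_turn c x \<bullet> half_turn c x = x \<bullet> x"
    by (simp add: half_turn_def inner_diff_left inner_diff_right cc inner_commute)
  then show "norm (half_turn c x) = norm x" by (simp add: norm_eq_sqrt_inner)
  have "(c - half_turn c x) \<bullet> (c - half_turn c x) = (c - x) \<bullet> (c - x)"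
    by (simp add: half_turn_def inner_diff_left inner_diff_right cc inner_commute)
  then show "dist c (half_turn c x) = dist c x" by (simp add: dist_norm norm_eq_sqrt_inner)
  show "half_turn c (half_turn c x) = x"
    by (simp add: half_turn_def inner_diff_left cc)
qed

lemma crosscaps_disjoint:
  assumes "i < k" and "j < k" and "i \<noteq> j"
  shows "cball (crosscap_centre k i) (1 / real k) \<inter> cball (crosscap_centre k j) (1 / real k) = {}"
proof -
  define a where "a = pi * real i / real k"
  define b where "b = pi * real j / real k"
  define d where "d = \<bar>int i - int j\<bar>"
  define t where "t = pi * real_of_int d / real k"
  have k: "real k \<ge> 2" using assms by linarith
  have d: "1 \<le> d" "d \<le> int k - 1" using assms by (auto simp: d_def)
  have bound: "1 / real k < sin (pi / real k)"
  proof -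
    define s where "s = pi / (2 * real k)"
    have s: "0 < s" "s \<le> pi / 4" using k by (auto simp: s_def field_simps)
    obtain z where z: "0 < z" "z < s" "sin s - sin 0 = (s - 0) * cos z"
      using MVT2[of 0 s sin cos] s DERIV_sin by blast
    have "cos s \<le> cos z" using z s by (intro cos_monotone_0_pi_le) auto
    then have "s * cos s \<le> sin s" using z s by simp
    moreover have cs: "sqrt 2 / 2 \<le> cos s"
      using cos_monotone_0_pi_le[of s "pi / 4"] s by (simp add: cos_45)
    then have "cos s \<ge> 0" by (meson order_trans divide_nonneg_nonneg real_sqrt_ge_zero zero_le_numeral)
    ultimately have "s * cos s * cos s \<le> sin s * cos s"
      by (intro mult_right_mono)
    moreover have "1 / 2 \<le> cos s * cos s"
      using mult_mono[OF cs cs \<open>cos s \<ge> 0\<close>] by simp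
    then have "s * (1 / 2) \<le> s * (cos s * cos s)"
      using s by (intro mult_left_mono) auto
    ultimately have "s \<le> 2 * sin s * cos s" by simp
    also have "\<dots> = sin (pi / real k)" using sin_double[of s] by (simp add: s_def)
    finally have "s \<le> sin (pi / real k)" .
    moreover have "1 / real k < s" using k pi_gt3 by (simp add: s_def field_simps)
    ultimately show ?thesis by simp
  qed
  have "sin (pi / real k) \<le> sin t"
  proof (cases "t \<le> pi / 2")
    case True
    have "pi / real k \<le> t" using d k by (simp add: t_def divide_right_mono)
    moreover have "pi / real k \<ge> 0" using k by simp
    moreover have "- (pi / 2) \<le> pi / real k" using calculation pi_gt_zero by linarith
    ultimately show ?thesis using True by (intro sin_monotone_2pi_le) auto
  next
    case False
    have "pi - t = pi * (real k - real_of_int d) / real k" using k by (simp add: t_def field_simps)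
    moreover have "pi * 1 \<le> pi * (real k - real_of_int d)"
      using d by (intro mult_left_mono) (linarith, simp)
    ultimately have "pi / real k \<le> pi - t" using k by (simp add: divide_right_mono)
    moreover have "pi / real k \<ge> 0" using k by simp
    moreover have "- (pi / 2) \<le> pi / real k" using calculation pi_gt_zero by linarith
    ultimately have "sin (pi / real k) \<le> sin (pi - t)"
      using False by (intro sin_monotone_2pi_le) auto
    then show ?thesis by simp
  qed
  with bound have t1: "1 / real k < sin t" by simp
  have "t = \<bar>a - b\<bar>"
  proof -
    have "a - b = (pi / real k) * (real i - real j)"
      by (simp add: a_def b_def diff_divide_distrib right_diff_distrib)
    then have "\<bar>a - b\<bar> = (pi / real k) * \<bar>real i - real j\<bar>" using k by (simp add: abs_mult)
    then show ?thesis by (simp add: t_def d_def)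
  qed
  then have sq: "(sin t)\<^sup>2 = (sin (a - b))\<^sup>2"
    using sin_minus[of "a - b"] by (cases "a - b < 0") (simp_all add: abs_if)
  have ab: "crosscap_centre k i = vector [cos (2 * a), sin (2 * a), 0]"
    "crosscap_centre k j = vector [cos (2 * b), sin (2 * b), 0]"
    by (simp_all add: crosscap_centre_def a_def b_def mult.assoc)
  have "(dist (crosscap_centre k i) (crosscap_centre k j))\<^sup>2
      = (cos (2 * a) - cos (2 * b))\<^sup>2 + (sin (2 * a) - sin (2 * b))\<^sup>2"
    unfolding ab by (simp add: dist_norm norm_eq_sqrt_inner inner_vec_def sum_3 power2_eq_square)
  also have "\<dots> = ((sin (2 * a))\<^sup>2 + (cos (2 * a))\<^sup>2) + ((sin (2 * b))\<^sup>2 + (cos (2 * b))\<^sup>2)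
      - 2 * (cos (2 * a) * cos (2 * b) + sin (2 * a) * sin (2 * b))"
    by (simp add: power2_diff algebra_simps)
  also have "\<dots> = 2 - 2 * cos (2 * (a - b))"
    by (simp add: cos_diff right_diff_distrib)
  also have "\<dots> = (2 * sin (a - b))\<^sup>2"
    unfolding cos_double_sin by (simp add: power_mult_distrib)
  also have "\<dots> = (2 * sin t)\<^sup>2" using sq by (simp add: power_mult_distrib)
  finally have "(dist (crosscap_centre k i) (crosscap_centre k j))\<^sup>2 = \<bar>2 * sin t\<bar>\<^sup>2"
    by (simp only: power2_abs)
  then have "dist (crosscap_centre k i) (crosscap_centre k j) = \<bar>2 * sin t\<bar>"
    by (rule power2_eq_imp_eq) (rule zero_le_dist, rule abs_ge_zero)
  with t1 have far: "2 / real k < dist (crosscap_centre k i) (crosscap_centre k j)" by simp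
  show ?thesis
  proof (rule ccontr)
    assume "\<not> ?thesis"
    then obtain x where "dist (crosscap_centre k i) x \<le> 1 / real k"
      "dist (crosscap_centre k j) x \<le> 1 / real k" by auto
    then have "dist (crosscap_centre k i) (crosscap_centre k j) \<le> 1 / real k + 1 / real k"
      by (meson add_mono dist_triangle2 order_trans)
    with far show False by simp
  qed
qed

lemma equiv_crosscap_rel: "equiv (holed_sphere k) (crosscap_rel k)"
proof (rule equivI)
  note ht = dist_half_turn[OF norm_crosscap_centre]
  show "crosscap_rel k \<subseteq> holed_sphere k \<times> holed_sphere k" by (auto simp: crosscap_rel_def)
  show "refl_on (holed_sphere k) (crosscap_rel k)"
    by (auto simp: refl_on_def crosscap_rel_def)
  show "sym (crosscap_rel k)"
  proof (rule symI)
    fix x y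
    assume xy: "(x, y) \<in> crosscap_rel k"
    show "(y, x) \<in> crosscap_rel k"
    proof (cases "x = y")
      case False
      with xy obtain i where i: "i < k" "x \<in> sphere (crosscap_centre k i) (1 / real k)"
        "y = half_turn (crosscap_centre k i) x" by (auto simp: crosscap_rel_def)
      then have "y \<in> sphere (crosscap_centre k i) (1 / real k)"
        "x = half_turn (crosscap_centre k i) y" using ht by simp_all
      then show ?thesis using xy i(1) by (auto simp: crosscap_rel_def)
    qed (use xy in simp)
  qed
  show "trans (crosscap_rel k)"
  proof (rule transI)
    fix x y z
    assume xy: "(x, y) \<in> crosscap_rel k" and yz: "(y, z) \<in> crosscap_rel k"
    show "(x, z) \<in> crosscap_rel k"
    proof (cases "x = y \<or> y = z")
      case True
      then show ?thesis using xy yz by auto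
    next
      case False
      with xy obtain i where i: "i < k" "x \<in> sphere (crosscap_centre k i) (1 / real k)"
        "y = half_turn (crosscap_centre k i) x" by (auto simp: crosscap_rel_def)
      from False yz obtain j where j: "j < k" "y \<in> sphere (crosscap_centre k j) (1 / real k)"
        "z = half_turn (crosscap_centre k j) y" by (auto simp: crosscap_rel_def)
      have "y \<in> cball (crosscap_centre k i) (1 / real k) \<inter> cball (crosscap_centre k j) (1 / real k)"
        using i j ht by simp
      then have "i = j" using crosscaps_disjoint[OF i(1) j(1)] by blast
      then have "z = x" using i j ht by simp
      then show ?thesis using xy by (auto simp: crosscap_rel_def)
    qed
  qed
qed

text \<open>A drawing without crossings: vertices are distinct points, every edge is a simple arc joining
  its two endpoints, and the interior of an arc meets neither a vertex nor the interior of another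
  arc.\<close>

definition embeds_in :: "'v graph \<Rightarrow> 'b topology \<Rightarrow> bool" where
  "embeds_in G Y \<longleftrightarrow>
     (\<exists>(p :: 'v \<Rightarrow> 'b) (\<gamma> :: 'v set \<Rightarrow> real \<Rightarrow> 'b).
        inj_on p (fst G) \<and> p ` fst G \<subseteq> topspace Y \<and>
        (\<forall>e \<in> snd G. pathin Y (\<gamma> e) \<and> inj_on (\<gamma> e) {0..1} \<and> {\<gamma> e 0, \<gamma> e 1} = p ` e \<and>
           \<gamma> e ` {0<..<1} \<inter> p ` fst G = {}) \<and>
        (\<forall>e \<in> snd G. \<forall>f \<in> snd G. e \<noteq> f \<longrightarrow> \<gamma> e ` {0<..<1} \<inter> \<gamma> f ` {0<..<1} = {}))"

text \<open>The value is \<open>\<infinity>\<close> if there is no embedding into any \<open>N\<^sub>k\<close>; this does not happen for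
  finite graphs.\<close>

definition crosscap_number :: "'v graph \<Rightarrow> enat" where
  "crosscap_number G = (INF k \<in> {k. embeds_in G (nonorientable_surface k)}. enat k)"

end

theory Submission
  imports Defs
begin

text \<open>In a finite commutative ring every element has an idempotent power. It follows that
  the annihilator of \<open>x\<close> is essential if and only if \<open>x\<close> is nilpotent
  (\<open>essential_ann_iff\<close>), so that two vertices \<open>u\<close>, \<open>v\<close> of
  the essential graph are adjacent if and only if \<open>u v\<close> is nilpotent. A finite ring
  with no idempotents except 0 and 1 consists of units and nilpotents and is local; hence a
  non-local ring is a product \<open>S \<times> T\<close>, and its essential graph contains the
  complete bipartite graph between \<open>S \<times> nil T - 0\<close> and \<open>nil S \<times>
  units T\<close>.

  The crosscap number is 1 if and only if the graph embeds in \<open>N\<^sub>1\<close>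
  and not in the sphere. The surface \<open>N\<^sub>1\<close> is homeomorphic to the projective
  plane, which the sphere covers twice. An embedding of \<open>G\<close> in the projective plane
  therefore lifts to an embedding in the sphere of a double cover of \<open>G\<close>, given by a
  sign on each edge (\<open>projective_lifts_to_double_cover\<close>), and every obstruction
  becomes a statement about the sphere. There the Jordan curve theorem excludes two
  configurations, in which a connected set of vertices touches all three paths of a theta graph,
  or all four vertices of a \<open>K\<^sub>4\<close>; these are the minors
  \<open>K\<^sub>3\<^sub>,\<^sub>3\<close> and \<open>K\<^sub>5\<close>. The lift of a clique to
  the double cover is connected if some triangle in it has odd sign, and otherwise consists of two
  copies of the clique. Comparing both cases shows that a projective graph contains no 7-clique,
  no 4-clique beside a 5-clique and no two 4-cliques joined by a matching. Applied to line graphs,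
  this excludes from \<open>G\<close> a vertex of degree 7, two adjacent vertices of degree 5, and
  \<open>K\<^sub>2\<^sub>,\<^sub>4\<close>.

  Embeddings come from straight-line drawings in homogeneous coordinates: vertices are
  integer vectors, edges are segments, and two edges do not cross because a plane through the
  origin separates the cones over them. Validity of such a drawing is a finite computation with
  integers.

  The ring theory is now a count of units and nilpotents. With three factors, either all
  of them have two elements and the line graph is planar, or two adjacent vertices of degree 5
  appear. With two indecomposable factors, a nonzero nilpotent in \<open>T\<close> forces
  \<open>|S| = 2\<close>, \<open>|T| = 4\<close> to avoid
  \<open>K\<^sub>2\<^sub>,\<^sub>4\<close>; the essential graph is then the wheel with four
  spokes, and \<open>T\<close> is one of the two local rings of order 4 that are not fields. If
  both factors are fields, the graph is complete bipartite, with classes of sizes \<open>|S| -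
  1\<close> and \<open>|T| - 1\<close>. Stars with at most four edges and
  \<open>K\<^sub>2\<^sub>,\<^sub>3\<close> have planar line graphs, there is no field of order 6,
  and the cases that remain are the star with six edges and
  \<open>K\<^sub>3\<^sub>,\<^sub>3\<close>.\<close>

section \<open>Jordan curves on the sphere\<close>

abbreviation unit_sphere :: "(real ^ 3) set" where
  "unit_sphere \<equiv> sphere 0 1"

definition arc_joins :: "'a::topological_space set \<Rightarrow> 'a \<Rightarrow> 'a \<Rightarrow> bool" where
  "arc_joins A a b \<longleftrightarrow>
     (\<exists>g. arc g \<and> path_image g = A \<and> pathstart g = a \<and> pathfinish g = b)"

definition Jordan_curve_set :: "'a::topological_space set \<Rightarrow> bool" where
  "Jordan_curve_set J \<longleftrightarrow>
     (\<exists>g. simple_path g \<and> pathfinish g = pathstart g \<and> path_image g = J)"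

abbreviation same_side :: "(real ^ 3) set \<Rightarrow> real ^ 3 \<Rightarrow> real ^ 3 \<Rightarrow> bool" where
  "same_side J \<equiv> connected_component (unit_sphere - J)"

lemma arc_joins_sym: "arc_joins A a b \<Longrightarrow> arc_joins A b a"
  unfolding arc_joins_def by (metis arc_reversepath path_image_reversepath
      pathfinish_reversepath pathstart_reversepath)

lemma arc_joins_ends: "arc_joins A a b \<Longrightarrow> a \<in> A \<and> b \<in> A \<and> a \<noteq> b"
  unfolding arc_joins_def by (metis arc_distinct_ends pathfinish_in_path_image pathstart_in_path_image)

lemma arc_joins_compact: "arc_joins (A::'a::t2_space set) a b \<Longrightarrow> compact A"
  unfolding arc_joins_def using compact_arc_image by blast

lemma arc_joins_trans:
  assumes "arc_joins A a b" and "arc_joins B b c" and "A \<inter> B = {b}"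
  shows "arc_joins (A \<union> B) a c"
proof -
  obtain g where g: "arc g" "path_image g = A" "pathstart g = a" "pathfinish g = b"
    using assms(1) by (auto simp: arc_joins_def)
  obtain h where h: "arc h" "path_image h = B" "pathstart h = b" "pathfinish h = c"
    using assms(2) by (auto simp: arc_joins_def)
  have "arc (g +++ h)" using g h assms(3) by (intro arc_join) auto
  moreover have "path_image (g +++ h) = A \<union> B" using g h by (simp add: path_image_join)
  ultimately show ?thesis using g h unfolding arc_joins_def by (intro exI[of _ "g +++ h"]) auto
qed

lemma arc_joins_image:
  assumes "arc_joins A a b" and "continuous_on A h" and "inj_on h A"
  shows "arc_joins (h ` A) (h a) (h b)"
proof -
  obtain g where g: "arc g" "path_image g = A" "pathstart g = a" "pathfinish g = b"
    using assms(1) by (auto simp: arc_joins_def)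
  have "arc (h \<circ> g)"
    using g assms unfolding arc_def
    by (auto intro!: path_continuous_image comp_inj_on simp: path_image_def)
  then show ?thesis using g unfolding arc_joins_def
    by (intro exI[of _ "h \<circ> g"]) (auto simp: path_image_compose pathstart_compose pathfinish_compose)
qed

lemma arc_joins_interior:
  assumes "arc_joins A a b"
  shows "connected (A - {a, b})" and "A - {a, b} \<noteq> {}" and "A \<subseteq> closure (A - {a, b})"
proof -
  obtain g where g: "arc g" "path_image g = A" "pathstart g = a" "pathfinish g = b"
    using assms(1) by (auto simp: arc_joins_def)
  have sp: "simple_path g" using g arc_imp_simple_path by blast
  show "connected (A - {a, b})" using connected_simple_path_endless[OF sp] g by simp
  show "A - {a, b} \<noteq> {}" using nonempty_simple_path_endless[OF sp] g by simp
  have A: "A - {a, b} = g ` {0<..<1}" using simple_path_endless[OF sp] g by simp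
  have "g ` closure {0<..<1} \<subseteq> closure (g ` {0<..<1})"
  proof (rule image_closure_subset)
    show "continuous_on (closure {0<..<1}) g" using g(1) by (simp add: arc_def path_def)
    show "closed (closure (g ` {0<..<1}))" by simp
    show "g ` {0<..<1} \<subseteq> closure (g ` {0<..<1})" by (rule closure_subset)
  qed
  then show "A \<subseteq> closure (A - {a, b})" using A g by (auto simp: path_image_def)
qed

lemma Jordan_curve_set_join:
  assumes "arc_joins A a b" and "arc_joins B a b" and "A \<inter> B = {a, b}"
  shows "Jordan_curve_set (A \<union> B)"
proof -
  obtain g where g: "arc g" "path_image g = A" "pathstart g = a" "pathfinish g = b"
    using assms(1) by (auto simp: arc_joins_def)
  obtain h where h: "arc h" "path_image h = B" "pathstart h = b" "pathfinish h = a"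
    using arc_joins_sym[OF assms(2)] by (auto simp: arc_joins_def)
  have "simple_path (g +++ h)" using g h assms(3) by (intro simple_path_join_loop) auto
  moreover have "path_image (g +++ h) = A \<union> B" using g h by (simp add: path_image_join)
  ultimately show ?thesis using g h unfolding Jordan_curve_set_def
    by (intro exI[of _ "g +++ h"]) auto
qed

lemma Jordan_curve_set_image:
  assumes "Jordan_curve_set J" and "continuous_on J h" and "inj_on h J"
  shows "Jordan_curve_set (h ` J)"
proof -
  obtain g where g: "simple_path g" "pathfinish g = pathstart g" "path_image g = J"
    using assms(1) by (auto simp: Jordan_curve_set_def)
  have "simple_path (h \<circ> g)"
    using g assms by (intro simple_path_continuous_image) auto
  then show ?thesis using g unfolding Jordan_curve_set_def
    by (intro exI[of _ "h \<circ> g"]) (auto simp: path_image_compose pathstart_compose pathfinish_compose)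
qed

lemma Jordan_curve_set_compact: "Jordan_curve_set (J::'a::t2_space set) \<Longrightarrow> compact J"
  unfolding Jordan_curve_set_def using compact_simple_path_image by blast

lemma punctured_sphere_plane:
  assumes "v \<in> unit_sphere"
  obtains h k where "homeomorphism (unit_sphere - {v}) (UNIV :: complex set) h k"
proof -
  have "unit_sphere - {v} homeomorphic {x::real^3. axis 1 1 \<bullet> x = 0}"
    by (rule homeomorphic_punctured_sphere_hyperplane) (use assms in \<open>auto simp: axis_eq_0_iff\<close>)
  also have "{x::real^3. axis 1 1 \<bullet> x = 0} homeomorphic (UNIV :: complex set)"
  proof (rule homeomorphic_subspaces)
    show "dim {x::real^3. axis 1 1 \<bullet> x = 0} = dim (UNIV :: complex set)"
      by (subst dim_hyperplane) (auto simp: axis_eq_0_iff)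
  qed (auto simp: subspace_hyperplane)
  finally show ?thesis using that by (auto simp: homeomorphic_def)
qed

text \<open>Removing a point \<open>v\<close> off the curve turns the sphere into a plane. The
  side of the curve that contains \<open>v\<close> becomes the exterior domain and the other side
  the interior domain, which transfers the Jordan curve theorem to the sphere.\<close>
context
  fixes v :: "real ^ 3" and h :: "real ^ 3 \<Rightarrow> complex" and k J
  assumes v: "v \<in> unit_sphere" and hk: "homeomorphism (unit_sphere - {v}) UNIV h k"
    and J: "Jordan_curve_set J" and JS: "J \<subseteq> unit_sphere - {v}"
begin

lemma Jordan_image: "Jordan_curve_set (h ` J)"
proof (rule Jordan_curve_set_image[OF J])
  show "continuous_on J h" using hk JS by (meson continuous_on_subset homeomorphism_def)
  show "inj_on h J"
    using hk JS unfolding homeomorphism_def by (intro inj_on_inverseI[of J k]) blast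
qed

lemma inside_outside_image:
  "inside (h ` J) \<noteq> {}" "connected (inside (h ` J))" "connected (outside (h ` J))"
  "\<not> bounded (outside (h ` J))" "inside (h ` J) \<union> outside (h ` J) = - h ` J"
  "closure (inside (h ` J)) \<subseteq> inside (h ` J) \<union> h ` J" "bounded (inside (h ` J))"
proof -
  obtain g where g: "simple_path g" "pathfinish g = pathstart g" "path_image g = h ` J"
    using Jordan_image by (auto simp: Jordan_curve_set_def)
  note * = Jordan_inside_outside[OF g(1,2), unfolded g(3)]
  show "inside (h ` J) \<noteq> {}" "connected (inside (h ` J))" "connected (outside (h ` J))"
    "\<not> bounded (outside (h ` J))" "inside (h ` J) \<union> outside (h ` J) = - h ` J"
    "bounded (inside (h ` J))"
    using * by auto
  have "closure (inside (h ` J)) \<subseteq> inside (h ` J) \<union> frontier (inside (h ` J))"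
    by (auto simp: frontier_def interior_open *)
  then show "closure (inside (h ` J)) \<subseteq> inside (h ` J) \<union> h ` J" using * by auto
qed

lemma inverse_image_connected:
  assumes "connected T" shows "connected (k ` T)"
  using assms hk by (meson connected_continuous_image continuous_on_subset homeomorphism_def subset_UNIV)

lemma inverse_image_avoids:
  assumes "T \<inter> h ` J = {}" shows "k ` T \<subseteq> unit_sphere - J - {v}"
proof
  fix x assume "x \<in> k ` T"
  then obtain t where t: "t \<in> T" "x = k t" by blast
  have "k t \<in> unit_sphere - {v}" using hk unfolding homeomorphism_def by blast
  moreover have "h (k t) = t" using hk by (simp add: homeomorphism_def)
  ultimately show "x \<in> unit_sphere - J - {v}" using t assms by (metis DiffD1 DiffD2 DiffI IntI empty_iff image_eqI)
qed

text \<open>The exterior domain is unbounded, so its preimage has the puncture \<open>v\<close> in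
  its closure. Hence the preimage together with \<open>v\<close> is connected, and all of it lies
  on the side of \<open>v\<close>.\<close>
lemma far_side_inside:
  assumes x: "x \<in> unit_sphere - J" and far: "\<not> same_side J v x"
  shows "h x \<in> inside (h ` J)"
proof (rule ccontr)
  assume no: "h x \<notin> inside (h ` J)"
  have vJ: "v \<notin> J" using JS by blast
  have xv: "x \<noteq> v" using far v vJ by (metis DiffI connected_component_refl)
  have kh: "k (h y) = y" if "y \<in> unit_sphere - {v}" for y
    using hk that by (simp add: homeomorphism_def)
  have hxJ: "h x \<notin> h ` J"
  proof
    assume "h x \<in> h ` J"
    then obtain j where "j \<in> J" "h x = h j" by blast
    moreover have "k (h j) = j" using \<open>j \<in> J\<close> JS by (intro kh) blast
    moreover have "k (h x) = x" using x xv by (intro kh) blast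
    ultimately show False using x by auto
  qed
  define T where "T = k ` outside (h ` J)"
  have xT: "x \<in> T"
  proof -
    have "h x \<in> outside (h ` J)" using no hxJ inside_outside_image(5) by blast
    moreover have "x = k (h x)" using kh[of x] x xv by simp
    ultimately show ?thesis unfolding T_def by blast
  qed
  have conT: "connected T" unfolding T_def by (intro inverse_image_connected inside_outside_image)
  have TS: "T \<subseteq> unit_sphere - J - {v}"
    unfolding T_def by (rule inverse_image_avoids) (simp add: outside_no_overlap)
  have "v \<in> closure T"
  proof (rule ccontr)
    assume "v \<notin> closure T"
    then have "closure T \<inter> unit_sphere \<subseteq> unit_sphere - {v}" by auto
    moreover have "compact (closure T \<inter> unit_sphere)" by (simp add: closed_Int_compact)
    ultimately have "compact (h ` (closure T \<inter> unit_sphere))"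
      using hk by (meson compact_continuous_image continuous_on_subset homeomorphism_def)
    moreover have "outside (h ` J) \<subseteq> h ` (closure T \<inter> unit_sphere)"
    proof
      fix y assume y: "y \<in> outside (h ` J)"
      have "k y \<in> closure T \<inter> unit_sphere" using y TS closure_subset[of T] by (auto simp: T_def)
      moreover have "y = h (k y)" using hk by (simp add: homeomorphism_def)
      ultimately show "y \<in> h ` (closure T \<inter> unit_sphere)" by blast
    qed
    ultimately show False using inside_outside_image(4) by (meson bounded_subset compact_imp_bounded)
  qed
  then have "connected (insert v T)"
    by (intro connected_intermediate_closure[OF conT]) (auto simp: closure_subset[THEN subsetD])
  moreover have "insert v T \<subseteq> unit_sphere - J" using TS v vJ by auto
  ultimately have "same_side J v x" using xT by (meson connected_componentI insertCI)
  then show False using far by blast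
qed

text \<open>The preimage of the interior domain is open, and its closure adds only points of the
  curve. A connected set that avoids the curve and leads from \<open>v\<close> into the interior
  would be split by it.\<close>
lemma inside_is_far:
  obtains w where "w \<in> unit_sphere - J" "\<not> same_side J v w"
proof -
  define T where "T = k ` inside (h ` J)"
  have TS: "T \<subseteq> unit_sphere - J - {v}"
    unfolding T_def by (rule inverse_image_avoids) (simp add: inside_no_overlap)
  obtain w where w: "w \<in> T" using inside_outside_image(1) by (auto simp: T_def)
  have "\<not> same_side J v w"
  proof
    assume "same_side J v w"
    then obtain C where C: "connected C" "C \<subseteq> unit_sphere - J" "v \<in> C" "w \<in> C"
      by (auto simp: connected_component_def)
    define D where "D = k ` closure (inside (h ` J))"
    have "compact D"
    proof -
      have "compact (closure (inside (h ` J)))" using inside_outside_image(7) by (simp add: compact_closure)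
      moreover have "continuous_on (closure (inside (h ` J))) k"
        using hk by (meson continuous_on_subset homeomorphism_def subset_UNIV)
      ultimately show ?thesis unfolding D_def by (rule compact_continuous_image[rotated])
    qed
    then have cl: "closedin (top_of_set C) (C \<inter> D)" by (intro closedin_closed_Int compact_imp_closed)
    have "D \<subseteq> T \<union> J"
    proof
      fix y assume "y \<in> D"
      then obtain z where z: "y = k z" "z \<in> inside (h ` J) \<or> z \<in> h ` J"
        using inside_outside_image(6) by (auto simp: D_def)
      then show "y \<in> T \<union> J"
      proof (elim disjE)
        assume "z \<in> h ` J"
        then obtain j where "j \<in> J" "z = h j" by blast
        then show ?thesis using z hk JS by (metis UnCI homeomorphism_apply1 subsetD)
      qed (auto simp: T_def z)
    qed
    moreover have "T \<subseteq> D" using closure_subset by (auto simp: T_def D_def)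
    ultimately have CD: "C \<inter> D = C \<inter> T" using C(2) by blast
    have T_eq: "T = {x \<in> unit_sphere - {v}. h x \<in> inside (h ` J)}"
    proof (intro equalityI subsetI)
      fix y assume "y \<in> T"
      then obtain t where t: "t \<in> inside (h ` J)" "y = k t" by (auto simp: T_def)
      moreover have "k t \<in> unit_sphere - {v}" "h (k t) = t" using hk unfolding homeomorphism_def by blast+
      ultimately show "y \<in> {x \<in> unit_sphere - {v}. h x \<in> inside (h ` J)}" by simp
    next
      fix y assume y: "y \<in> {x \<in> unit_sphere - {v}. h x \<in> inside (h ` J)}"
      then have "k (h y) = y" using hk unfolding homeomorphism_def by blast
      then show "y \<in> T" using y unfolding T_def by (metis (no_types, lifting) image_eqI mem_Collect_eq)
    qed
    have "open (inside (h ` J))"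
      using Jordan_image compact_imp_closed Jordan_curve_set_compact open_inside by blast
    then have "openin (top_of_set (unit_sphere - {v})) T"
      unfolding T_eq using hk continuous_openin_preimage_gen[of "unit_sphere - {v}" h "inside (h ` J)"]
      by (simp add: homeomorphism_def vimage_def Int_def)
    then obtain U where U: "open U" "T = (unit_sphere - {v}) \<inter> U" by (auto simp: openin_open)
    then have "C \<inter> T = C \<inter> (U - {v})" using C(2) TS by auto
    then have op: "openin (top_of_set C) (C \<inter> T)" using U(1) by (simp add: open_delete openin_open_Int)
    have "C \<inter> T = {} \<or> C \<inter> T = C"
      using C(1) op cl CD connected_clopen by metis
    then show False using C w TS by blast
  qed
  then show ?thesis using that w TS by blast
qed

lemma two_sides_from_puncture:
  assumes "x \<in> unit_sphere - J" "\<not> same_side J v x" "y \<in> unit_sphere - J" "\<not> same_side J v y"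
  shows "same_side J x y"
proof -
  have vJ: "v \<notin> J" using JS by blast
  have ne: "x \<noteq> v" "y \<noteq> v" using assms v vJ by (metis DiffI connected_component_refl)+
  have "k (h x) = x" "k (h y) = y" using hk assms ne by (auto simp: homeomorphism_def)
  moreover have "connected (k ` inside (h ` J))" by (intro inverse_image_connected inside_outside_image)
  moreover have "k ` inside (h ` J) \<subseteq> unit_sphere - J"
    using inverse_image_avoids[of "inside (h ` J)"] inside_no_overlap[of "h ` J"] by blast
  ultimately show ?thesis
    using far_side_inside assms by (metis connected_componentI image_eqI)
qed

end

lemma Jordan_sphere_separates:
  assumes "Jordan_curve_set J" and "J \<subseteq> unit_sphere" and "v \<in> unit_sphere - J"
  obtains w where "w \<in> unit_sphere - J" "\<not> same_side J v w"
proof -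
  obtain h k where "homeomorphism (unit_sphere - {v}) (UNIV :: complex set) h k"
    using punctured_sphere_plane assms(3) by blast
  then show ?thesis using inside_is_far[of v h k J] assms that by blast
qed

text \<open>Puncture the sphere at \<open>x\<close>: if neither of the other points is on the side
  of \<open>x\<close>, both lie in the interior domain, which is connected.\<close>
lemma Jordan_sphere_two_sides:
  assumes "Jordan_curve_set J" and "J \<subseteq> unit_sphere"
    and "x \<in> unit_sphere - J" "y \<in> unit_sphere - J" "z \<in> unit_sphere - J"
  shows "same_side J x y \<or> same_side J x z \<or> same_side J y z"
proof -
  obtain h k where "homeomorphism (unit_sphere - {x}) (UNIV :: complex set) h k"
    using punctured_sphere_plane assms(3) by blast
  then show ?thesis using two_sides_from_puncture[of x h k J y z] assms by blast
qed

lemma closure_image_point: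
  fixes P S :: "'a::first_countable_topology set" and T :: "'b::first_countable_topology set"
  assumes "homeomorphism S T h k" and "y \<in> closure P" and "P \<subseteq> S" and "y \<in> S"
  shows "h y \<in> closure (h ` P)"
proof -
  obtain f where f: "\<And>n. f n \<in> P" "f \<longlonglongrightarrow> y" using assms(2) closure_sequential[of y P] by blast
  have "continuous_on S h" using assms(1) by (simp add: homeomorphism_def)
  then have "(\<lambda>n. h (f n)) \<longlonglongrightarrow> h y"
    using f assms(3,4) by (intro continuous_on_tendsto_compose[of S h]) (auto intro!: always_eventually)
  then show ?thesis unfolding closure_sequential using f(1) by (intro exI[of _ "\<lambda>n. h (f n)"]) blast
qed

section \<open>Two obstructions on the sphere\<close>

text \<open>The chord \<open>C\<close> cuts the interior of \<open>A \<union> B\<close> into the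
  interiors of \<open>A \<union> C\<close> and \<open>B \<union> C\<close>. The connected set
  \<open>P\<close> lies in one of the two, so its closure misses the arc that bounds only the
  other.\<close>
lemma chord_separates_from_puncture:
  assumes A: "arc_joins A a b" and B: "arc_joins B a b" and C: "arc_joins C a b"
    and int: "A \<inter> B = {a, b}" "A \<inter> C = {a, b}" "B \<inter> C = {a, b}"
    and sub: "A \<union> B \<union> C \<subseteq> unit_sphere"
    and P: "connected P" "P \<subseteq> unit_sphere - (A \<union> B \<union> C)"
    and touch: "closure P \<inter> (A - {a, b}) \<noteq> {}" "closure P \<inter> (B - {a, b}) \<noteq> {}"
    and z: "z \<in> C - {a, b}" "\<not> same_side (A \<union> B) v z"
    and x: "x \<in> P" "\<not> same_side (A \<union> B) v x" and v: "v \<in> unit_sphere - (A \<union> B)"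
  shows False
proof -
  let ?J = "A \<union> B"
  obtain h k where hk: "homeomorphism (unit_sphere - {v}) (UNIV :: complex set) h k"
    using punctured_sphere_plane v by blast
  have J: "Jordan_curve_set ?J" by (rule Jordan_curve_set_join) fact+
  have JS: "?J \<subseteq> unit_sphere - {v}" using sub v by auto
  have vS: "v \<in> unit_sphere" using v by blast
  note far = far_side_inside[OF vS hk J JS]
  have farP: "\<not> same_side ?J v p" if "p \<in> P" for p
  proof -
    have "same_side ?J x p" using P x that by (meson connected_componentI Diff_mono Un_upper1 order.trans order_refl)
    then show ?thesis using x(2) by (meson connected_component_sym connected_component_trans)
  qed
  have farC: "\<not> same_side ?J v p" if "p \<in> C - {a, b}" for p
  proof -
    have "same_side ?J z p"
      using arc_joins_interior(1)[OF C] z(1) that int sub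
      by (intro connected_componentI[of "C - {a, b}"]) auto
    then show ?thesis using z(2) by (meson connected_component_sym connected_component_trans)
  qed
  have vv: "same_side ?J v v" using v by (rule connected_component_refl)
  have CS: "C \<subseteq> unit_sphere - {v}"
  proof -
    have "v \<notin> C - {a, b}" using farC[of v] vv by blast
    moreover have "v \<noteq> a" "v \<noteq> b" using v int by blast+
    ultimately show ?thesis using sub by blast
  qed
  have vP: "v \<notin> P" using farP[of v] vv by blast
  have inP: "h ` P \<subseteq> inside (h ` ?J)"
  proof
    fix y assume "y \<in> h ` P"
    then obtain p where p: "p \<in> P" "y = h p" by blast
    then have "p \<in> unit_sphere - ?J" using P(2) by blast
    then show "y \<in> inside (h ` ?J)" using far farP p by blast
  qed
  have inC: "h ` (C - {a, b}) \<subseteq> inside (h ` ?J)"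
  proof
    fix y assume "y \<in> h ` (C - {a, b})"
    then obtain p where p: "p \<in> C - {a, b}" "y = h p" by blast
    then have "p \<in> unit_sphere - ?J" using int sub by blast
    then show "y \<in> inside (h ` ?J)" using far farC p by blast
  qed
  have inj: "inj_on h (unit_sphere - {v})"
    using hk unfolding homeomorphism_def by (intro inj_on_inverseI[of _ k]) blast
  have cont: "continuous_on (unit_sphere - {v}) h" using hk by (simp add: homeomorphism_def)
  have img: "arc_joins (h ` S) (h a) (h b)" if "arc_joins S a b" "S \<subseteq> unit_sphere - {v}" for S
  proof (rule arc_joins_image[OF that(1)])
    show "continuous_on S h" using cont that(2) by (rule continuous_on_subset)
    show "inj_on h S" using inj that(2) by (rule inj_on_subset)
  qed
  have hAB: "A \<subseteq> unit_sphere - {v}" "B \<subseteq> unit_sphere - {v}" using JS by auto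
  obtain c1 where c1: "arc c1" "path_image c1 = h ` A" "pathstart c1 = h a" "pathfinish c1 = h b"
    using img[OF A hAB(1)] by (auto simp: arc_joins_def)
  obtain c2 where c2: "arc c2" "path_image c2 = h ` B" "pathstart c2 = h a" "pathfinish c2 = h b"
    using img[OF B hAB(2)] by (auto simp: arc_joins_def)
  obtain c where c: "arc c" "path_image c = h ` C" "pathstart c = h a" "pathfinish c = h b"
    using img[OF C CS] by (auto simp: arc_joins_def)
  have hint: "h ` K \<inter> h ` L = {h a, h b}" if "K \<inter> L = {a, b}" "K \<subseteq> unit_sphere - {v}" "L \<subseteq> unit_sphere - {v}" for K L
    using inj_on_image_Int[OF inj that(2,3)] that(1) by auto
  have ab: "h a \<noteq> h b" using arc_distinct_ends[OF c(1)] c by simp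
  have split: "inside (h ` A \<union> h ` C) \<inter> inside (h ` B \<union> h ` C) = {}"
    "inside (h ` A \<union> h ` C) \<union> inside (h ` B \<union> h ` C) \<union> (h ` C - {h a, h b}) = inside (h ` A \<union> h ` B)"
  proof -
    have "h ` C \<inter> inside (h ` A \<union> h ` B) \<noteq> {}"
      using inC z(1) by (auto simp: image_Un)
    then show "inside (h ` A \<union> h ` C) \<inter> inside (h ` B \<union> h ` C) = {}"
    "inside (h ` A \<union> h ` C) \<union> inside (h ` B \<union> h ` C) \<union> (h ` C - {h a, h b}) = inside (h ` A \<union> h ` B)"
      using split_inside_simple_closed_curve[of c1 "h a" "h b" c2 c] c1 c2 c ab
        hint[OF int(1) hAB] hint[OF int(2) hAB(1) CS] hint[OF int(3) hAB(2) CS]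
      by (metis arc_imp_simple_path)+
  qed
  have PS: "P \<subseteq> unit_sphere - {v}" using P vP by auto
  have hPC: "h ` P \<inter> h ` C = {}"
    using inj_on_image_Int[OF inj PS CS] P(2) by blast
  have cover: "h ` P \<subseteq> inside (h ` A \<union> h ` C) \<union> inside (h ` B \<union> h ` C)"
    using inP hPC split(2) unfolding image_Un by blast
  have conP: "connected (h ` P)" using P(1) cont PS by (meson connected_continuous_image continuous_on_subset)
  have compact: "compact (h ` K)" if "arc_joins K a b" "K \<subseteq> unit_sphere - {v}" for K
    using that img arc_joins_compact by blast
  have avoid: False
    if K: "arc_joins K a b" "K \<subseteq> unit_sphere - {v}" "h ` P \<subseteq> inside (h ` K \<union> h ` C)"
      "inside (h ` K \<union> h ` C) \<subseteq> inside (h ` A \<union> h ` B)"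
      and L: "L \<subseteq> A \<union> B" "closure P \<inter> (L - {a, b}) \<noteq> {}" "K \<inter> L = {a, b}" "L \<inter> C = {a, b}" for K L
  proof -
    obtain y where y: "y \<in> closure P" "y \<in> L - {a, b}" using L by blast
    have yS: "y \<in> unit_sphere - {v}" using y(2) L(1) JS by blast
    have "h y \<in> closure (h ` P)" by (rule closure_image_point[OF hk y(1) PS yS])
    moreover have "closed (h ` K \<union> h ` C)"
      using compact[OF K(1,2)] compact[OF C CS] by (intro closed_Un compact_imp_closed)
    then have "closure (inside (h ` K \<union> h ` C)) \<subseteq> inside (h ` K \<union> h ` C) \<union> (h ` K \<union> h ` C)"
      using closure_inside_subset[of "h ` K \<union> h ` C"] by blast
    ultimately have "h y \<in> inside (h ` K \<union> h ` C) \<or> h y \<in> h ` (K \<union> C)"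
      using K(3) closure_mono by blast
    moreover have "h y \<notin> h ` (K \<union> C)"
    proof
      assume "h y \<in> h ` (K \<union> C)"
      then obtain u where u: "u \<in> K \<union> C" "h y = h u" by blast
      then have "u \<in> unit_sphere - {v}" using K(2) CS by blast
      then have "y = u" by (rule inj_onD[OF inj u(2) yS])
      then show False using u(1) y(2) L(3,4) by blast
    qed
    moreover have "h y \<notin> inside (h ` A \<union> h ` B)"
      using y(2) L(1) inside_no_overlap[of "h ` A \<union> h ` B"] by blast
    ultimately show False using K(4) by blast
  qed
  have "open (inside (h ` A \<union> h ` C))" "open (inside (h ` B \<union> h ` C))"
    using compact[OF A hAB(1)] compact[OF B hAB(2)] compact[OF C CS]
    by (intro open_inside closed_Un compact_imp_closed; simp)+
  then have "h ` P \<subseteq> inside (h ` A \<union> h ` C) \<or> h ` P \<subseteq> inside (h ` B \<union> h ` C)"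
    using connectedD[OF conP _ _ _ cover] split(1) cover by blast
  then show False
    using avoid[OF A hAB(1), of B] avoid[OF B hAB(2), of A] split(2) int touch by (auto simp: Int_commute)
qed

text \<open>A puncture on the side of the curve opposite to the chord puts the chord, and any
  \<open>P\<close> on the same side, into the interior domain.\<close>
lemma bridge_opposite_chord:
  assumes A: "arc_joins A a b" and B: "arc_joins B a b" and C: "arc_joins C a b"
    and int: "A \<inter> B = {a, b}" "A \<inter> C = {a, b}" "B \<inter> C = {a, b}"
    and sub: "A \<union> B \<union> C \<subseteq> unit_sphere"
    and P: "connected P" "P \<subseteq> unit_sphere - (A \<union> B \<union> C)"
    and touch: "closure P \<inter> (A - {a, b}) \<noteq> {}" "closure P \<inter> (B - {a, b}) \<noteq> {}"
    and z: "z \<in> C - {a, b}" and x: "x \<in> P"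
  shows "\<not> same_side (A \<union> B) z x"
proof
  assume zx: "same_side (A \<union> B) z x"
  have zJ: "z \<in> unit_sphere - (A \<union> B)" using z int sub by blast
  obtain v where v: "v \<in> unit_sphere - (A \<union> B)" "\<not> same_side (A \<union> B) z v"
    using Jordan_sphere_separates[OF Jordan_curve_set_join[OF A B int(1)] _ zJ] sub by blast
  have vz: "\<not> same_side (A \<union> B) v z" "\<not> same_side (A \<union> B) v x"
    using v(2) zx by (meson connected_component_sym connected_component_trans)+
  show False by (rule chord_separates_from_puncture[OF assms(1-11) z vz(1) x vz(2) v(1)])
qed

text \<open>As \<open>P\<close> touches \<open>C\<close>, it lies on the same side of \<open>A
  \<union> B\<close> as \<open>C\<close>. As it touches both \<open>A\<close> and
  \<open>B\<close>, it must lie opposite to \<open>C\<close>. With \<open>P\<close> contracted to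
  a point this is the non-planarity of \<open>K\<^sub>3\<^sub>,\<^sub>3\<close>.\<close>
lemma theta_no_apex:
  assumes A: "arc_joins A a b" and B: "arc_joins B a b" and C: "arc_joins C a b"
    and int: "A \<inter> B = {a, b}" "A \<inter> C = {a, b}" "B \<inter> C = {a, b}"
    and sub: "A \<union> B \<union> C \<subseteq> unit_sphere"
    and P: "connected P" "P \<subseteq> unit_sphere - (A \<union> B \<union> C)"
    and touch: "closure P \<inter> (A - {a, b}) \<noteq> {}" "closure P \<inter> (B - {a, b}) \<noteq> {}"
      "closure P \<inter> (C - {a, b}) \<noteq> {}"
  shows False
proof -
  obtain z where z: "z \<in> closure P" "z \<in> C - {a, b}" using touch(3) by blast
  obtain x where x: "x \<in> P" using z(1) by fastforce
  have "connected (insert z P)"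
  proof (rule connected_intermediate_closure[OF P(1)])
    show "insert z P \<subseteq> closure P" using z(1) closure_subset[of P] by blast
  qed blast
  moreover have "insert z P \<subseteq> unit_sphere - (A \<union> B)" using z(2) int(2,3) sub P(2) by blast
  ultimately have "same_side (A \<union> B) z x" using x by (meson connected_componentI insertI1 insertI2)
  then show False using bridge_opposite_chord[OF assms(1-11) z(2) x] by blast
qed

text \<open>Relative to the Jordan curve through \<open>a\<close>, \<open>c\<close>,
  \<open>b\<close>, \<open>d\<close>, any two of the arc \<open>AB\<close>, the arc
  \<open>CD\<close> and the set \<open>P\<close> are on opposite sides, but there are only two
  sides. With \<open>P\<close> contracted to a point this is the non-planarity of
  \<open>K\<^sub>5\<close>.\<close>
lemma K4_no_apex:
  assumes arcs: "arc_joins AB a b" "arc_joins AC a c" "arc_joins AD a d"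
      "arc_joins BC b c" "arc_joins BD b d" "arc_joins CD c d"
    and dist: "distinct [a, b, c, d]"
    and int: "AB \<inter> AC = {a}" "AB \<inter> AD = {a}" "AC \<inter> AD = {a}" "AB \<inter> BC = {b}" "AB \<inter> BD = {b}"
      "BC \<inter> BD = {b}" "AC \<inter> BC = {c}" "AC \<inter> CD = {c}" "BC \<inter> CD = {c}" "AD \<inter> BD = {d}"
      "AD \<inter> CD = {d}" "BD \<inter> CD = {d}" "AB \<inter> CD = {}" "AC \<inter> BD = {}" "AD \<inter> BC = {}"
    and sub: "AB \<union> AC \<union> AD \<union> BC \<union> BD \<union> CD \<subseteq> unit_sphere"
    and P: "connected P" "P \<subseteq> unit_sphere - (AB \<union> AC \<union> AD \<union> BC \<union> BD \<union> CD)"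
    and touch: "{a, b, c, d} \<subseteq> closure P"
  shows False
proof -
  define J where "J = AC \<union> BC \<union> (AD \<union> BD)"
  \<comment> \<open>The same curve as the union of two arcs from c to d, so that CD is a chord of
    it.\<close>
  have J2: "J = AC \<union> AD \<union> (BC \<union> BD)" by (auto simp: J_def)
  have ends: "a \<in> AB" "b \<in> AB" "a \<in> AC" "c \<in> AC" "a \<in> AD" "d \<in> AD" "b \<in> BC" "c \<in> BC"
    "b \<in> BD" "d \<in> BD" "c \<in> CD" "d \<in> CD"
    using arcs arc_joins_ends by blast+
  have ACB: "arc_joins (AC \<union> BC) a b" by (rule arc_joins_trans[OF arcs(2) arc_joins_sym[OF arcs(4)]]) fact
  have ADB: "arc_joins (AD \<union> BD) a b" by (rule arc_joins_trans[OF arcs(3) arc_joins_sym[OF arcs(5)]]) fact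
  have CAD: "arc_joins (AC \<union> AD) c d" by (rule arc_joins_trans[OF arc_joins_sym[OF arcs(2)] arcs(3)]) fact
  have CBD: "arc_joins (BC \<union> BD) c d" by (rule arc_joins_trans[OF arc_joins_sym[OF arcs(4)] arcs(5)]) fact
  obtain z where z: "z \<in> AB - {a, b}" using arc_joins_interior(2)[OF arcs(1)] by blast
  obtain w where w: "w \<in> CD - {c, d}" using arc_joins_interior(2)[OF arcs(6)] by blast
  obtain x where x: "x \<in> P" using touch by fastforce
  have ints: "(AC \<union> BC) \<inter> (AD \<union> BD) = {a, b}" "(AC \<union> BC) \<inter> AB = {a, b}"
    "(AD \<union> BD) \<inter> AB = {a, b}" "(AC \<union> AD) \<inter> (BC \<union> BD) = {c, d}"
    "(AC \<union> AD) \<inter> CD = {c, d}" "(BC \<union> BD) \<inter> CD = {c, d}"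
    unfolding Int_Un_distrib Int_Un_distrib2 int[THEN trans[OF Int_commute]] int by auto
  have subs: "AC \<union> BC \<union> (AD \<union> BD) \<union> AB \<subseteq> unit_sphere" "AC \<union> AD \<union> (BC \<union> BD) \<union> CD \<subseteq> unit_sphere"
    using sub by blast+
  have ne: "a \<noteq> b" "a \<noteq> c" "a \<noteq> d" "b \<noteq> c" "b \<noteq> d" "c \<noteq> d" using dist by auto
  have touching: "closure Q \<inter> (AC \<union> BC - {a, b}) \<noteq> {}" "closure Q \<inter> (AD \<union> BD - {a, b}) \<noteq> {}"
    if "{c, d} \<subseteq> closure Q" for Q
    using that ends ne by blast+
  have touching': "closure Q \<inter> (AC \<union> AD - {c, d}) \<noteq> {}" "closure Q \<inter> (BC \<union> BD - {c, d}) \<noteq> {}"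
    if "{a, b} \<subseteq> closure Q" for Q
    using that ends ne by blast+
  have tP: "{c, d} \<subseteq> closure P" "{a, b} \<subseteq> closure P" using touch by auto
  have PS: "P \<subseteq> unit_sphere - (AC \<union> BC \<union> (AD \<union> BD) \<union> AB)"
    "P \<subseteq> unit_sphere - (AC \<union> AD \<union> (BC \<union> BD) \<union> CD)"
    using P(2) by blast+
  have CD: "CD - {c, d} \<subseteq> unit_sphere - (AC \<union> BC \<union> (AD \<union> BD) \<union> AB)"
    "{c, d} \<subseteq> closure (CD - {c, d})"
  proof -
    have "CD \<inter> (AC \<union> AD \<union> (BC \<union> BD) \<union> AB) \<subseteq> {c, d}" using int by auto
    moreover have "CD \<subseteq> unit_sphere" using sub by auto
    ultimately show "CD - {c, d} \<subseteq> unit_sphere - (AC \<union> BC \<union> (AD \<union> BD) \<union> AB)" by blast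
    show "{c, d} \<subseteq> closure (CD - {c, d})"
      using arc_joins_interior(3)[OF arcs(6)] ends(11,12) by blast
  qed
  have "\<not> same_side J z x" unfolding J_def
    by (rule bridge_opposite_chord[OF ACB ADB arcs(1) ints(1-3) subs(1) P(1) PS(1) touching[OF tP(1)] z x])
  moreover have "\<not> same_side J z w" unfolding J_def
    by (rule bridge_opposite_chord[OF ACB ADB arcs(1) ints(1-3) subs(1)
          arc_joins_interior(1)[OF arcs(6)] CD(1) touching[OF CD(2)] z w])
  moreover have "\<not> same_side J w x" unfolding J2
    by (rule bridge_opposite_chord[OF CAD CBD arcs(6) ints(4-6) subs(2) P(1) PS(2) touching'[OF tP(2)] w x])
  moreover have "Jordan_curve_set J" unfolding J_def
    by (rule Jordan_curve_set_join[OF ACB ADB ints(1)])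
  moreover have "J \<subseteq> unit_sphere" unfolding J_def using subs(1) by blast
  moreover have "x \<in> unit_sphere - J" unfolding J_def using x PS(1) by blast
  moreover have "w \<in> unit_sphere - J" unfolding J_def using w CD(1) by blast
  moreover have "z \<in> unit_sphere - J" unfolding J_def using z ints(2,3) sub by blast
  ultimately show False using Jordan_sphere_two_sides[of J z w x] by blast
qed

section \<open>A model of the projective plane\<close>

lemma embeds_in_continuous_injection:
  assumes "embeds_in G U" and cont: "continuous_map U V f" and inj: "inj_on f (topspace U)"
  shows "embeds_in G V"
proof -
  obtain p \<gamma> where p: "inj_on p (fst G)" "p ` fst G \<subseteq> topspace U"
    and \<gamma>': "\<forall>e \<in> snd G. pathin U (\<gamma> e) \<and> inj_on (\<gamma> e) {0..1} \<and> {\<gamma> e 0, \<gamma> e 1} = p ` e \<and>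
           \<gamma> e ` {0<..<1} \<inter> p ` fst G = {}"
    and dj': "\<forall>e \<in> snd G. \<forall>f \<in> snd G. e \<noteq> f \<longrightarrow> \<gamma> e ` {0<..<1} \<inter> \<gamma> f ` {0<..<1} = {}"
    using assms(1) unfolding embeds_in_def by (elim exE conjE) (rule that)
  note \<gamma> = bspec[OF \<gamma>'] and dj = dj'[rule_format]
  have img: "\<gamma> e ` {0..1} \<subseteq> topspace U" if "e \<in> snd G" for e
    using \<gamma>[OF that] by (auto simp: pathin_def continuous_map_def)
  have inner: "\<gamma> e ` {0<..<1} \<subseteq> topspace U" if "e \<in> snd G" for e
    using img[OF that] by force
  show ?thesis
    unfolding embeds_in_def
  proof (intro exI[of _ "f \<circ> p"] exI[of _ "\<lambda>e. f \<circ> \<gamma> e"] conjI ballI impI)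
    show "inj_on (f \<circ> p) (fst G)" using p inj by (meson comp_inj_on inj_on_subset)
    show "(f \<circ> p) ` fst G \<subseteq> topspace V" using p cont by (auto simp: continuous_map_def)
    fix e assume e: "e \<in> snd G"
    show "pathin V (f \<circ> \<gamma> e)" using \<gamma>[OF e] cont by (blast intro: pathin_compose)
    show "inj_on (f \<circ> \<gamma> e) {0..1}" using \<gamma>[OF e] img[OF e] inj by (meson comp_inj_on inj_on_subset)
    show "{(f \<circ> \<gamma> e) 0, (f \<circ> \<gamma> e) 1} = (f \<circ> p) ` e"
      using \<gamma>[OF e] by (metis comp_apply image_comp image_insert image_empty)
    have "f ` (\<gamma> e ` {0<..<1} \<inter> p ` fst G) = f ` (\<gamma> e ` {0<..<1}) \<inter> f ` (p ` fst G)"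
      by (rule inj_on_image_Int[OF inj inner[OF e] p(2)])
    then show "(f \<circ> \<gamma> e) ` {0<..<1} \<inter> (f \<circ> p) ` fst G = {}"
      using \<gamma>[OF e] by (simp add: image_comp)
    fix e' assume e': "e' \<in> snd G" "e \<noteq> e'"
    have "f ` (\<gamma> e ` {0<..<1} \<inter> \<gamma> e' ` {0<..<1}) = f ` (\<gamma> e ` {0<..<1}) \<inter> f ` (\<gamma> e' ` {0<..<1})"
      by (rule inj_on_image_Int[OF inj inner[OF e] inner[OF e'(1)]])
    then show "(f \<circ> \<gamma> e) ` {0<..<1} \<inter> (f \<circ> \<gamma> e') ` {0<..<1} = {}"
      using dj[OF e e'] by (simp add: image_comp)
  qed
qed

lemma embeds_in_homeomorphic:
  assumes "homeomorphic_map U V f"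
  shows "embeds_in G U \<longleftrightarrow> embeds_in G V"
proof -
  have "\<exists>g. continuous_map V U g \<and> inj_on g (topspace V)"
    using assms by (metis homeomorphic_map_maps homeomorphic_maps_map homeomorphic_imp_continuous_map homeomorphic_imp_injective_map)
  then show ?thesis
    using assms embeds_in_continuous_injection
    by (metis homeomorphic_imp_continuous_map homeomorphic_imp_injective_map)
qed

text \<open>The matrix of the orthogonal projection onto the line of \<open>x\<close>. Lines
  through the origin thus become points of a normed space, and the lines together form the real
  projective plane.\<close>
definition proj :: "real ^ 3 \<Rightarrow> real ^ 3 ^ 3" where
  "proj x = (\<chi> i j. x $ i * x $ j / (x \<bullet> x))"

definition projective_plane :: "(real ^ 3 ^ 3) set" where
  "projective_plane = proj ` unit_sphere"

lemma proj_mult_vec: "proj x *v z = ((x \<bullet> z) / (x \<bullet> x)) *\<^sub>R x"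
  by (simp add: proj_def vec_eq_iff matrix_vector_mult_def inner_vec_def sum_distrib_left sum_distrib_right
      sum_divide_distrib algebra_simps flip: sum_divide_distrib)

lemma proj_scaleR: "c \<noteq> 0 \<Longrightarrow> proj (c *\<^sub>R x) = proj x"
  by (simp add: proj_def vec_eq_iff)

lemma proj_minus: "proj (- x) = proj x"
  using proj_scaleR[of "-1" x] by simp

lemma proj_eqD:
  assumes "proj x = proj y" and "y \<noteq> 0"
  obtains c where "c \<noteq> 0" "y = c *\<^sub>R x"
proof -
  have "y = proj y *v y" using assms(2) by (simp add: proj_mult_vec)
  also have "\<dots> = ((x \<bullet> y) / (x \<bullet> x)) *\<^sub>R x" using assms(1) by (metis proj_mult_vec)
  finally show ?thesis using that assms(2) by (metis scaleR_zero_left)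
qed

lemma proj_eq_unit:
  assumes "x \<in> unit_sphere" and "y \<in> unit_sphere"
  shows "proj x = proj y \<longleftrightarrow> y = x \<or> y = - x"
proof
  assume "proj x = proj y"
  moreover have "y \<noteq> 0" using assms by auto
  ultimately obtain c where c: "y = c *\<^sub>R x" by (rule proj_eqD)
  then have "\<bar>c\<bar> = 1" using assms by auto
  then show "y = x \<or> y = - x" using c by (cases "c \<ge> 0") auto
qed (use proj_minus in auto)

lemma continuous_on_proj: "continuous_on (- {0}) proj"
  unfolding proj_def by (intro continuous_intros) auto

lemma proj_unit_in_projective_plane: "x \<in> unit_sphere \<Longrightarrow> proj x \<in> projective_plane"
  by (simp add: projective_plane_def)

lemma proj_in_projective_plane: "x \<noteq> 0 \<Longrightarrow> proj x \<in> projective_plane"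
  unfolding projective_plane_def
  using proj_scaleR[of "inverse (norm x)" x] by (intro image_eqI[of _ _ "inverse (norm x) *\<^sub>R x"]) auto

text \<open>The lines not orthogonal to \<open>x\<close> form an evenly covered neighbourhood of
  the line of \<open>x\<close>: each meets the sphere once in the open hemisphere around
  \<open>x\<close> and once in the opposite one, and the point is recovered from the projection
  \<open>M\<close> by normalising \<open>M x\<close>.\<close>
lemma covering_projective_plane: "covering_space unit_sphere proj projective_plane"
proof -
  have cont: "continuous_on unit_sphere proj"
    by (rule continuous_on_subset[OF continuous_on_proj]) auto
  have "\<exists>T. y \<in> T \<and> openin (top_of_set projective_plane) T \<and>
        (\<exists>v. \<Union>v = unit_sphere \<inter> proj -` T \<and> (\<forall>u\<in>v. openin (top_of_set unit_sphere) u) \<and>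
             pairwise disjnt v \<and> (\<forall>u\<in>v. \<exists>q. homeomorphism u T proj q))"
    if "y \<in> projective_plane" for y
  proof -
    obtain x where x: "x \<in> unit_sphere" "y = proj x" using \<open>y \<in> projective_plane\<close> unfolding projective_plane_def by blast
    define T where "T = {M \<in> projective_plane. x \<bullet> (M *v x) > 0}"
    define U where "U = (\<lambda>s::real. {z \<in> unit_sphere. s * (x \<bullet> z) > 0})"
    have xM: "x \<bullet> (proj z *v x) = (x \<bullet> z)\<^sup>2" if "z \<in> unit_sphere" for z
      using that by (simp add: proj_mult_vec dot_square_norm power2_eq_square inner_commute)
    have xx: "x \<bullet> x = 1" using x by (simp add: dot_square_norm)
    have yT: "y \<in> T" using x xM[OF x(1)] proj_unit_in_projective_plane[of x] xx by (force simp: T_def)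
    have "openin (top_of_set projective_plane) T"
    proof -
      have "T = projective_plane \<inter> (\<lambda>M. x \<bullet> (M *v x)) -` {0<..}" by (auto simp: T_def)
      moreover have "continuous_on projective_plane (\<lambda>M. x \<bullet> (M *v x))"
        unfolding matrix_vector_mult_def by (intro continuous_intros)
      ultimately show ?thesis by (simp add: continuous_openin_preimage_gen)
    qed
    moreover have "\<Union>{U 1, U (-1)} = unit_sphere \<inter> proj -` T"
    proof -
      have "z \<in> U 1 \<union> U (-1) \<longleftrightarrow> z \<in> unit_sphere \<inter> proj -` T" for z
        using xM[of z] proj_unit_in_projective_plane[of z] by (auto simp: U_def T_def)
      then have "U 1 \<union> U (-1) = unit_sphere \<inter> proj -` T" by blast
      then show ?thesis by simp
    qed
    moreover have "openin (top_of_set unit_sphere) (U s)" for s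
    proof -
      have "U s = unit_sphere \<inter> (\<lambda>z. s * (x \<bullet> z)) -` {0<..}" by (auto simp: U_def)
      moreover have "continuous_on unit_sphere (\<lambda>z. s * (x \<bullet> z))" by (intro continuous_intros)
      ultimately show ?thesis by (simp add: continuous_openin_preimage_gen)
    qed
    moreover have "pairwise disjnt {U 1, U (-1)}"
    proof -
      have "disjnt (U 1) (U (-1))" by (auto simp: disjnt_def U_def)
      then show ?thesis by (simp add: pairwise_insert disjnt_sym)
    qed
    moreover have "\<exists>q. homeomorphism (U s) T proj q" if s: "s = 1 \<or> s = -1" for s
    proof (intro exI homeomorphismI)
      let ?q = "\<lambda>M. (s / sqrt (x \<bullet> (M *v x))) *\<^sub>R (M *v x)"
      show "continuous_on (U s) proj" by (rule continuous_on_subset[OF cont]) (auto simp: U_def)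
      show "continuous_on T ?q"
        unfolding matrix_vector_mult_def
        by (intro continuous_intros) (auto simp: T_def matrix_vector_mult_def)
      have qp: "?q (proj z) = z" if "z \<in> U s" for z
      proof -
        have z: "z \<in> unit_sphere" "s * (x \<bullet> z) > 0" using that by (auto simp: U_def)
        have "sqrt (x \<bullet> (proj z *v x)) = s * (x \<bullet> z)"
          using xM[OF z(1)] z(2) s by auto
        moreover have "proj z *v x = (x \<bullet> z) *\<^sub>R z"
          using z(1) by (simp add: proj_mult_vec dot_square_norm inner_commute)
        ultimately show ?thesis using z(2) s by auto
      qed
      have pU: "proj z \<in> T" if "z \<in> U s" for z
        using that xM[of z] proj_unit_in_projective_plane[of z] s by (auto simp: U_def T_def)
      show "proj ` U s \<subseteq> T" using pU by auto
      have TU: "T \<subseteq> proj ` U s"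
      proof
        fix M assume M: "M \<in> T"
        then obtain z where z: "z \<in> unit_sphere" "M = proj z" by (auto simp: T_def projective_plane_def)
        then have "x \<bullet> z \<noteq> 0" using M xM[OF z(1)] by (auto simp: T_def)
        then consider "s * (x \<bullet> z) > 0" | "s * (x \<bullet> (- z)) > 0" using s by fastforce
        then show "M \<in> proj ` U s"
        proof cases
          case 1 then show ?thesis using z by (auto simp: U_def)
        next
          case 2 then show ?thesis using z proj_minus[of z]
            by (intro image_eqI[of _ _ "- z"]) (auto simp: U_def)
        qed
      qed
      show "?q ` T \<subseteq> U s" using TU qp by auto
      show "\<And>z. z \<in> U s \<Longrightarrow> ?q (proj z) = z" by (rule qp)
      show "\<And>M. M \<in> T \<Longrightarrow> proj (?q M) = M" using TU qp by auto
    qed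
    ultimately show ?thesis using yT by (intro exI[of _ T] conjI exI[of _ "{U 1, U (-1)}"]) auto
  qed
  then show ?thesis unfolding covering_space_def using cont by (auto simp: projective_plane_def)
qed

lemma homeomorphic_N0: "\<exists>f. homeomorphic_map (top_of_set unit_sphere) (nonorientable_surface 0) f"
proof -
  have hs: "holed_sphere 0 = unit_sphere" by (simp add: holed_sphere_def)
  have "inj_on (\<lambda>x. crosscap_rel 0 `` {x}) unit_sphere"
  proof (rule inj_onI)
    fix x y assume "x \<in> unit_sphere" "y \<in> unit_sphere" "crosscap_rel 0 `` {x} = crosscap_rel 0 `` {y}"
    then have "(x, y) \<in> crosscap_rel 0" using eq_equiv_class_iff[OF equiv_crosscap_rel[of 0]] hs by blast
    then show "x = y" by (simp add: crosscap_rel_def)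
  qed
  then have "homeomorphic_map (top_of_set unit_sphere) (nonorientable_surface 0) (\<lambda>x. crosscap_rel 0 `` {x})"
    using quotient_map_quotient_topology[of "top_of_set (holed_sphere 0)" "crosscap_rel 0"]
    unfolding nonorientable_surface_def hs homeomorphic_map_def by simp
  then show ?thesis by blast
qed

lemma embeds_in_N0: "embeds_in G (nonorientable_surface 0) \<longleftrightarrow> embeds_in G (top_of_set unit_sphere)"
  using homeomorphic_N0 embeds_in_homeomorphic by blast

text \<open>The squared distance of a unit vector \<open>x\<close> from the centre \<open>(1, 0,
  0)\<close> of the crosscap is \<open>2 - 2 x\<^sub>1\<close>.\<close>
lemma holed_sphere_1: "holed_sphere 1 = {x \<in> unit_sphere. x $ 1 \<le> 1 / 2}"
  and crosscap_sphere_1: "x \<in> unit_sphere \<Longrightarrow> x \<in> sphere (crosscap_centre 1 0) 1 \<longleftrightarrow> x $ 1 = 1 / 2"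
  and half_turn_1: "half_turn (crosscap_centre 1 0) x = vector [x $ 1, - x $ 2, - x $ 3]"
proof -
  have c: "crosscap_centre 1 0 = axis 1 1"
    by (simp add: crosscap_centre_def vec_eq_iff forall_3 axis_def)
  have d: "(dist (crosscap_centre 1 0) x)\<^sup>2 = 2 - 2 * x $ 1" if "x \<in> unit_sphere" for x
  proof -
    have "x \<bullet> x = 1" using that by (simp add: dot_square_norm)
    then show ?thesis
      unfolding c dist_norm dot_square_norm[symmetric]
      by (simp add: inner_diff_left inner_diff_right inner_axis' inner_axis)
  qed
  have le: "dist (crosscap_centre 1 0) x < 1 \<longleftrightarrow> (dist (crosscap_centre 1 0) x)\<^sup>2 < 1" for x
    using abs_square_less_1[of "dist (crosscap_centre 1 0) x"] by simp
  show "holed_sphere 1 = {x \<in> unit_sphere. x $ 1 \<le> 1 / 2}"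
    using d le by (auto simp: holed_sphere_def)
  show "x \<in> unit_sphere \<Longrightarrow> x \<in> sphere (crosscap_centre 1 0) 1 \<longleftrightarrow> x $ 1 = 1 / 2"
  proof -
    assume x: "x \<in> unit_sphere"
    have "dist (crosscap_centre 1 0) x = 1 \<longleftrightarrow> (dist (crosscap_centre 1 0) x)\<^sup>2 = 1"
      by (smt (verit) power2_eq_1_iff zero_le_dist)
    then show ?thesis using d[OF x] by auto
  qed
  show "half_turn (crosscap_centre 1 0) x = vector [x $ 1, - x $ 2, - x $ 3]"
    unfolding half_turn_def c by (simp add: vec_eq_iff forall_3 inner_axis) (simp add: axis_def)
qed

text \<open>Coordinates relative to the centre \<open>(1/2, 0, 0)\<close> of the boundary circle
  of the hole. In these coordinates the half turn acts on that circle as \<open>x \<mapsto> -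
  x\<close>, so passing to the line of \<open>central x\<close> makes exactly the identifications
  of \<open>N\<^sub>1\<close>.\<close>
definition central :: "real ^ 3 \<Rightarrow> real ^ 3" where
  "central x = x - axis 1 (1 / 2)"

lemma central_nonzero: "x \<in> unit_sphere \<Longrightarrow> central x \<noteq> 0"
proof
  assume x: "x \<in> unit_sphere" "central x = 0"
  then have "norm x = norm (axis 1 (1/2) :: real ^ 3)" by (simp add: central_def)
  moreover have "norm (axis 1 (1/2) :: real ^ 3) = 1/2"
    by (simp add: norm_eq_sqrt_inner inner_axis_axis real_sqrt_divide)
  ultimately show False using x by simp
qed

text \<open>A ray from a point inside the sphere meets the sphere only once: one root of the
  quadratic equation for \<open>c\<close> is 1 and the other is negative.\<close>
lemma central_same_direction:
  assumes x: "x \<in> unit_sphere" and y: "y \<in> unit_sphere" and c: "c > 0" "central y = c *\<^sub>R central x"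
  shows "y = x"
proof -
  define a :: "real ^ 3" where "a = axis 1 (1/2)"
  define u where "u = central x"
  have aa: "a \<bullet> a = 1/4" by (simp add: a_def inner_axis_axis)
  have xu: "x = a + u" "y = a + c *\<^sub>R u" using c(2) by (simp_all add: central_def a_def u_def algebra_simps)
  have 1: "a \<bullet> a + 2 * (a \<bullet> u) + u \<bullet> u = 1"
    using x unfolding xu by (simp add: norm_eq_sqrt_inner inner_add_left inner_add_right inner_commute)
  have 2: "a \<bullet> a + 2 * c * (a \<bullet> u) + c\<^sup>2 * (u \<bullet> u) = 1"
    using y unfolding xu by (simp add: norm_eq_sqrt_inner inner_add_left inner_add_right inner_commute power2_eq_square algebra_simps)
  have "(c - 1) * (c * (u \<bullet> u) + 3/4) = 0"
  proof -
    have au: "2 * (a \<bullet> u) = 3/4 - u \<bullet> u" using 1 aa by simp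
    have "1/4 + c * (3/4 - u \<bullet> u) + c\<^sup>2 * (u \<bullet> u) = 1" using 2 aa unfolding au[symmetric] by (simp add: algebra_simps)
    then have "c\<^sup>2 * (u \<bullet> u) - c * (u \<bullet> u) + 3/4 * c - 3/4 = 0" by (simp add: algebra_simps)
    moreover have "(c - 1) * (c * (u \<bullet> u) + 3/4) = c\<^sup>2 * (u \<bullet> u) - c * (u \<bullet> u) + 3/4 * c - 3/4"
      by (simp add: power2_eq_square field_simps)
    ultimately show ?thesis by simp
  qed
  moreover have "c * (u \<bullet> u) + 3/4 > 0" using c(1) by (simp add: add_nonneg_pos)
  ultimately have "c = 1" by simp
  then show ?thesis using xu by simp
qed

text \<open>On the holed sphere the first coordinate of \<open>central x\<close> is at most 0. Two
  points in opposite central directions therefore have it equal to 0, so they lie on the boundary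
  circle.\<close>
lemma crosscap_rel_1: "(x, y) \<in> crosscap_rel 1 \<longleftrightarrow>
    x \<in> holed_sphere 1 \<and> y \<in> holed_sphere 1 \<and> proj (central x) = proj (central y)"
proof -
  have *: "proj (central x) = proj (central y) \<longleftrightarrow>
      x = y \<or> (x $ 1 = 1/2 \<and> y = vector [x $ 1, - x $ 2, - x $ 3])"
    if x: "x \<in> holed_sphere 1" and y: "y \<in> holed_sphere 1"
  proof
    assume "proj (central x) = proj (central y)"
    then obtain c where c: "c \<noteq> 0" "central y = c *\<^sub>R central x"
      using proj_eqD[of "central x" "central y"] central_nonzero y holed_sphere_1 by blast
    have xy1: "x $ 1 \<le> 1/2" "y $ 1 \<le> 1/2" and S: "x \<in> unit_sphere" "y \<in> unit_sphere"
      using x y holed_sphere_1 by auto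
    show "x = y \<or> (x $ 1 = 1/2 \<and> y = vector [x $ 1, - x $ 2, - x $ 3])"
    proof (cases "c > 0")
      case True
      then show ?thesis using central_same_direction[OF S _ c(2)] by simp
    next
      case False
      have "y $ 1 - 1/2 = c * (x $ 1 - 1/2)"
        using arg_cong[OF c(2), of "\<lambda>v. v $ 1"] by (simp add: central_def axis_def)
      moreover have "c * (x $ 1 - 1/2) \<ge> 0" using False xy1 by (simp add: mult_nonpos_nonpos)
      ultimately have eq: "y $ 1 = 1/2" "c * (x $ 1 - 1/2) = 0" using xy1 by linarith+
      then have x1: "x $ 1 = 1/2" using c(1) by simp
      define z :: "real ^ 3" where "z = vector [x $ 1, - x $ 2, - x $ 3]"
      have z: "z \<in> unit_sphere"
        using S(1) by (simp add: z_def norm_eq_sqrt_inner inner_vec_def sum_3)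
      have "central z = - central x"
        using x1 by (simp add: z_def central_def vec_eq_iff forall_3 axis_def)
      then have "central y = (- c) *\<^sub>R central z" using c(2) by simp
      then have "y = z" using central_same_direction[OF z S(2), of "- c"] False c(1) by simp
      then show ?thesis using x1 unfolding z_def by blast
    qed
  next
    assume "x = y \<or> (x $ 1 = 1/2 \<and> y = vector [x $ 1, - x $ 2, - x $ 3])"
    then show "proj (central x) = proj (central y)"
    proof
      assume *: "x $ 1 = 1/2 \<and> y = vector [x $ 1, - x $ 2, - x $ 3]"
      then have "central y = - central x"
        by (simp add: central_def vec_eq_iff forall_3 axis_def)
      then show ?thesis by (simp add: proj_minus)
    qed simp
  qed
  show ?thesis
    using * holed_sphere_1 crosscap_sphere_1 half_turn_1
    by (auto simp: crosscap_rel_def)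
qed

text \<open>Of the two directions of a line, take one that does not point towards the hole.\<close>
lemma central_onto:
  assumes "y \<in> unit_sphere"
  obtains x where "x \<in> holed_sphere 1" "proj (central x) = proj y"
proof -
  obtain z where z: "z \<in> unit_sphere" "z $ 1 \<le> 0" "proj z = proj y"
  proof (cases "y $ 1 \<le> 0")
    case False then show ?thesis using that[of "- y"] assms proj_minus by auto
  qed (use that assms in auto)
  \<comment> \<open>The positive root of the equation expressing that x is a unit vector.\<close>
  define t where "t = (sqrt ((z $ 1)\<^sup>2 + 3) - z $ 1) / 2"
  define x where "x = axis 1 (1/2) + t *\<^sub>R z"
  have "sqrt ((z $ 1)\<^sup>2 + 3) > 0" by (simp add: add_nonneg_pos)
  then have t: "t > 0" using z(2) unfolding t_def by (simp add: add_nonneg_pos less_le_trans[of _ 0] del: real_sqrt_gt_0_iff)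
  have sq: "(sqrt ((z $ 1)\<^sup>2 + 3))\<^sup>2 = (z $ 1)\<^sup>2 + 3" by simp
  have "(2 * t + z $ 1)\<^sup>2 = (z $ 1)\<^sup>2 + 3"
  proof -
    have "2 * t + z $ 1 = sqrt ((z $ 1)\<^sup>2 + 3)" by (simp add: t_def field_simps)
    then show ?thesis using sq by simp
  qed
  then have t2: "t * t + t * z $ 1 = 3/4" by (simp add: power2_eq_square algebra_simps)
  have zz: "z \<bullet> z = 1" using z by (simp add: dot_square_norm)
  have "x \<bullet> x = 1"
    using t2 zz by (simp add: x_def inner_add_left inner_add_right inner_axis inner_axis' inner_axis_axis algebra_simps)
  then have "x \<in> unit_sphere" by (simp add: norm_eq_sqrt_inner)
  moreover have "x $ 1 \<le> 1/2" using t z(2) by (simp add: x_def axis_def mult_nonneg_nonpos)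
  moreover have "proj (central x) = proj y" using t z(3) proj_scaleR[of t z] by (simp add: x_def central_def)
  ultimately show ?thesis using that holed_sphere_1 by auto
qed

text \<open>The map \<open>x \<mapsto> proj (central x)\<close> induces a continuous bijection
  from the quotient, which is compact, to a Hausdorff space.\<close>
lemma homeomorphic_N1: "\<exists>f. homeomorphic_map (nonorientable_surface 1) (top_of_set projective_plane) f"
proof -
  let ?H = "top_of_set (holed_sphere 1)"
  let ?g = "\<lambda>x. proj (central x)"
  have q: "quotient_map ?H (nonorientable_surface 1) (\<lambda>x. crosscap_rel 1 `` {x})"
    unfolding nonorientable_surface_def by (rule quotient_map_quotient_topology)
  have top: "topspace (nonorientable_surface 1) = (\<lambda>x. crosscap_rel 1 `` {x}) ` holed_sphere 1"
    using quotient_imp_surjective_map[OF q] by simp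
  have "continuous_on (holed_sphere 1) ?g"
    by (intro continuous_on_compose2[OF continuous_on_proj])
      (use central_nonzero holed_sphere_1 in \<open>auto simp: central_def intro!: continuous_intros\<close>)
  moreover have "?g ` holed_sphere 1 \<subseteq> projective_plane"
    using proj_in_projective_plane central_nonzero holed_sphere_1 by auto
  ultimately have g: "continuous_map ?H (top_of_set projective_plane) ?g" by auto
  have cls: "crosscap_rel 1 `` {x} = crosscap_rel 1 `` {y} \<longleftrightarrow> ?g x = ?g y"
    if "x \<in> holed_sphere 1" "y \<in> holed_sphere 1" for x y
  proof -
    have "crosscap_rel 1 `` {x} = crosscap_rel 1 `` {y} \<longleftrightarrow> (x, y) \<in> crosscap_rel 1"
      using eq_equiv_class_iff[OF equiv_crosscap_rel that] .
    then show ?thesis using crosscap_rel_1 that by simp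
  qed
  obtain f where f: "continuous_map (nonorientable_surface 1) (top_of_set projective_plane) f"
    "f ` topspace (nonorientable_surface 1) = ?g ` topspace ?H"
    "\<And>x. x \<in> topspace ?H \<Longrightarrow> f (crosscap_rel 1 `` {x}) = ?g x"
    by (rule quotient_map_lift_exists[OF q g]) (use cls in auto)
  have "homeomorphic_map (nonorientable_surface 1) (top_of_set projective_plane) f"
  proof (rule continuous_imp_homeomorphic_map[OF f(1)])
    have "compact (holed_sphere 1)"
      unfolding holed_sphere_1
    proof -
      have "{x \<in> unit_sphere. x $ 1 \<le> 1 / 2} = unit_sphere \<inter> {x. x $ 1 \<le> 1 / 2}" by blast
      moreover have "closed {x :: real ^ 3. x $ 1 \<le> 1 / 2}"
        by (intro closed_Collect_le continuous_intros)
      ultimately show "compact {x \<in> unit_sphere. x $ 1 \<le> 1 / 2}" by (simp add: compact_Int_closed)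
    qed
    then have "compact_space ?H" by (simp add: compact_space_subtopology)
    then show "compact_space (nonorientable_surface 1)"
      using q quotient_imp_continuous_map quotient_imp_surjective_map
      by (metis compact_space_def image_compactin)
    show "Hausdorff_space (top_of_set projective_plane)"
      by (simp add: Hausdorff_space_subtopology)
    show "f ` topspace (nonorientable_surface 1) = topspace (top_of_set projective_plane)"
      unfolding f(2)
    proof (intro equalityI subsetI)
      fix M assume "M \<in> topspace (top_of_set projective_plane)"
      then obtain y where "y \<in> unit_sphere" "M = proj y" by (auto simp: projective_plane_def)
      then show "M \<in> ?g ` topspace ?H" using central_onto[of y] by (metis image_eqI topspace_euclidean_subtopology)
    qed (use \<open>?g ` holed_sphere 1 \<subseteq> projective_plane\<close> in auto)
    show "inj_on f (topspace (nonorientable_surface 1))"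
      unfolding top using f(3) cls by (auto simp: inj_on_def)
  qed
  then show ?thesis by blast
qed

lemma embeds_in_N1: "embeds_in G (nonorientable_surface 1) \<longleftrightarrow> embeds_in G (top_of_set projective_plane)"
  using homeomorphic_N1 embeds_in_homeomorphic by blast

section \<open>Lifting to a double cover\<close>

definition simple_graph :: "'v graph \<Rightarrow> bool" where
  "simple_graph G \<longleftrightarrow> (\<forall>e \<in> snd G. e \<subseteq> fst G \<and> card e = 2)"

text \<open>The two-sheeted covering graph of a graph with signs \<open>\<sigma>\<close>:
  following an edge changes the sheet if and only if its sign is \<open>True\<close>.\<close>
definition double_cover :: "'v graph \<Rightarrow> ('v set \<Rightarrow> bool) \<Rightarrow> ('v \<times> bool) graph" where
  "double_cover G \<sigma> =
     (fst G \<times> UNIV, {{(u, b), (w, b \<noteq> \<sigma> {u, w})} | u w b. {u, w} \<in> snd G})"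

lemma simple_graph_double_cover:
  assumes "simple_graph G" shows "simple_graph (double_cover G \<sigma>)"
proof -
  have "u \<noteq> w" if "{u, w} \<in> snd G" for u w
    using assms that by (force simp: simple_graph_def)
  then show ?thesis
    using assms by (fastforce simp: simple_graph_def double_cover_def card_insert_if)
qed

text \<open>Choose a unit vector \<open>q v\<close> on each vertex line and lift every edge to an
  arc of the sphere that starts at \<open>q u\<close>. It ends at \<open>q w\<close> or at
  \<open>- q w\<close>, and the sign records which. These arcs and their antipodes draw the double
  cover; they do not cross, because their images do not.\<close>
lemma projective_lifts_to_double_cover:
  assumes emb: "embeds_in G (top_of_set projective_plane)" and G: "simple_graph G"
  obtains \<sigma> where "embeds_in (double_cover G \<sigma>) (top_of_set unit_sphere)"
proof -
  obtain p \<gamma> where p: "inj_on p (fst G)" "p ` fst G \<subseteq> topspace (top_of_set projective_plane)"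
    and \<gamma>': "\<forall>e \<in> snd G. pathin (top_of_set projective_plane) (\<gamma> e) \<and> inj_on (\<gamma> e) {0..1} \<and> {\<gamma> e 0, \<gamma> e 1} = p ` e \<and>
           \<gamma> e ` {0<..<1} \<inter> p ` fst G = {}"
    and dj': "\<forall>e \<in> snd G. \<forall>f \<in> snd G. e \<noteq> f \<longrightarrow> \<gamma> e ` {0<..<1} \<inter> \<gamma> f ` {0<..<1} = {}"
    using emb unfolding embeds_in_def by (elim exE conjE) (rule that)
  note \<gamma> = bspec[OF \<gamma>'] and dj = dj'[rule_format]
  define q where "q v = (SOME x. x \<in> unit_sphere \<and> proj x = p v)" for v
  have q: "q v \<in> unit_sphere \<and> proj (q v) = p v" if "v \<in> fst G" for v
    unfolding q_def
  proof (rule someI_ex)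
    have "p v \<in> projective_plane" using that p(2) by auto
    then show "\<exists>x. x \<in> unit_sphere \<and> proj x = p v" unfolding projective_plane_def by (metis imageE)
  qed
  have ends: "\<exists>u w. e = {u, w} \<and> u \<noteq> w \<and> u \<in> fst G \<and> w \<in> fst G \<and> \<gamma> e 0 = p u \<and> \<gamma> e 1 = p w"
    if "e \<in> snd G" for e
  proof -
    obtain u w where uw: "e = {u, w}" "u \<noteq> w" "u \<in> fst G" "w \<in> fst G"
      using G \<open>e \<in> snd G\<close> unfolding simple_graph_def by (metis card_2_iff insert_subset)
    have "{\<gamma> e 0, \<gamma> e 1} = {p u, p w}" using \<gamma>[OF \<open>e \<in> snd G\<close>] uw by auto
    then have "\<gamma> e 0 = p u \<and> \<gamma> e 1 = p w \<or> \<gamma> e 0 = p w \<and> \<gamma> e 1 = p u"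
      by (auto simp: doubleton_eq_iff)
    then show ?thesis using uw by (metis insert_commute)
  qed
  define u w where "u e = (SOME u. \<exists>w. e = {u, w} \<and> u \<noteq> w \<and> u \<in> fst G \<and> w \<in> fst G \<and> \<gamma> e 0 = p u \<and> \<gamma> e 1 = p w)"
    and "w e = (SOME w. e = {u e, w} \<and> u e \<noteq> w \<and> u e \<in> fst G \<and> w \<in> fst G \<and> \<gamma> e 0 = p (u e) \<and> \<gamma> e 1 = p w)" for e
  have uw: "e = {u e, w e} \<and> u e \<noteq> w e \<and> u e \<in> fst G \<and> w e \<in> fst G \<and> \<gamma> e 0 = p (u e) \<and> \<gamma> e 1 = p (w e)"
    if "e \<in> snd G" for e
    unfolding w_def by (rule someI_ex, unfold u_def, rule someI_ex) (rule ends[OF that])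
  define h where "h e = (SOME g. path g \<and> path_image g \<subseteq> unit_sphere \<and> pathstart g = q (u e) \<and>
      (\<forall>t\<in>{0..1}. proj (g t) = \<gamma> e t))" for e
  have h: "path (h e) \<and> path_image (h e) \<subseteq> unit_sphere \<and> h e 0 = q (u e) \<and>
      (\<forall>t\<in>{0..1}. proj (h e t) = \<gamma> e t)" if "e \<in> snd G" for e
  proof -
    have "path (\<gamma> e)" "path_image (\<gamma> e) \<subseteq> projective_plane"
      using \<gamma>[OF that] by (auto simp: pathin_canon_iff path_image_def)
    moreover have "pathstart (\<gamma> e) = proj (q (u e))"
      using uw[OF that] q by (simp add: pathstart_def)
    ultimately have "\<exists>g. path g \<and> path_image g \<subseteq> unit_sphere \<and> pathstart g = q (u e) \<and>
      (\<forall>t\<in>{0..1}. proj (g t) = \<gamma> e t)"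
      using covering_space_lift_path_strong[OF covering_projective_plane, of "q (u e)" "\<gamma> e"] q uw[OF that]
      by metis
    then show ?thesis unfolding h_def pathstart_def by (rule someI2_ex) blast
  qed
  have hS: "h e t \<in> unit_sphere" if "e \<in> snd G" "t \<in> {0..1}" for e t
    using h[OF that(1)] that(2) unfolding path_image_def by blast
  define \<sigma> where "\<sigma> e \<longleftrightarrow> h e 1 \<noteq> q (w e)" for e
  have h1: "h e 1 = (if \<sigma> e then - q (w e) else q (w e))" if "e \<in> snd G" for e
  proof -
    have "proj (q (w e)) = proj (h e 1)" using h[OF that] uw[OF that] q by simp
    then have "h e 1 = q (w e) \<or> h e 1 = - q (w e)"
      using proj_eq_unit[of "q (w e)" "h e 1"] hS[OF that, of 1] q[of "w e"] uw[OF that] by auto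
    then show ?thesis by (auto simp: \<sigma>_def)
  qed
  have ne: "x \<noteq> - x" if "x \<in> unit_sphere" for x :: "real ^ 3"
  proof
    assume "x = - x"
    then have "x \<bullet> x = - (x \<bullet> x)" by (metis inner_minus_right)
    then show False using that by simp
  qed
  \<comment> \<open>The point of the fibre on the sheet b.\<close>
  define s :: "bool \<Rightarrow> real ^ 3 \<Rightarrow> real ^ 3" where "s b x = (if b then x else - x)" for b x
  have ps: "proj (s b x) = proj x" for b x by (simp add: s_def proj_minus)
  define P where "P = (\<lambda>(v, b). s b (q v))"
  define \<Gamma> where "\<Gamma> e' = (\<lambda>t. s ((u (fst ` e'), True) \<in> e') (h (fst ` e') t))" for e'
  define ce where "ce e b = {(u e, b), (w e, b \<noteq> \<sigma> e)}" for e b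
  have edges: "\<exists>e b. e \<in> snd G \<and> e' = ce e b" if "e' \<in> snd (double_cover G \<sigma>)" for e'
  proof -
    obtain x y b where xy: "{x, y} \<in> snd G" "e' = {(x, b), (y, b \<noteq> \<sigma> {x, y})}"
      using \<open>e' \<in> snd (double_cover G \<sigma>)\<close> unfolding double_cover_def by auto
    define e where "e = {x, y}"
    have eG: "e \<in> snd G" and e': "e' = {(x, b), (y, b \<noteq> \<sigma> e)}" using xy by (simp_all add: e_def)
    have "{x, y} = {u e, w e}" using conjunct1[OF uw[OF eG]] unfolding e_def .
    then consider "u e = x" "w e = y" | "w e = x" "u e = y" by (auto simp: doubleton_eq_iff)
    then show ?thesis
    proof cases
      case 1
      then have "e' = ce e b" by (simp only: e' ce_def)
      then show ?thesis using eG by blast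
    next
      case 2
      have "((b \<noteq> \<sigma> e) \<noteq> \<sigma> e) = b" by auto
      then have "e' = ce e (b \<noteq> \<sigma> e)" by (simp only: e' ce_def 2 insert_commute)
      then show ?thesis using eG by blast
    qed
  qed
  have \<Gamma>: "\<Gamma> (ce e b) = (\<lambda>t. s b (h e t))" if "e \<in> snd G" for e b
  proof -
    have "fst ` ce e b = e" using uw[OF that] by (auto simp: ce_def)
    moreover have "(u e, True) \<in> ce e b \<longleftrightarrow> b" using uw[OF that] by (auto simp: ce_def)
    ultimately show ?thesis by (simp add: \<Gamma>_def)
  qed
  have inner: "t \<in> {0..1}" if "t \<in> {0<..<1}" for t :: real using that by auto
  have "embeds_in (double_cover G \<sigma>) (top_of_set unit_sphere)"
    unfolding embeds_in_def
  proof (intro exI[of _ P] exI[of _ \<Gamma>] conjI ballI impI)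
    show "inj_on P (fst (double_cover G \<sigma>))"
    proof (rule inj_onI, clarify)
      fix v b v' b' assume v: "(v, b) \<in> fst (double_cover G \<sigma>)" "(v', b') \<in> fst (double_cover G \<sigma>)"
        and eq: "P (v, b) = P (v', b')"
      have V: "v \<in> fst G" "v' \<in> fst G" using v by (auto simp: double_cover_def)
      have "p v = p v'" using arg_cong[OF eq, of proj] q V by (simp add: P_def ps)
      then have "v = v'" using p(1) V by (meson inj_onD)
      moreover have "b = b'" using eq ne[of "q v"] q V(1) \<open>v = v'\<close>
        by (auto simp: P_def s_def split: if_splits)
      ultimately show "v = v' \<and> b = b'" by blast
    qed
    show "P ` fst (double_cover G \<sigma>) \<subseteq> topspace (top_of_set unit_sphere)"
      using q by (auto simp: P_def s_def double_cover_def)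
    fix e' assume e': "e' \<in> snd (double_cover G \<sigma>)"
    obtain e b where e: "e \<in> snd G" "e' = ce e b" using edges[OF e'] by blast
    have \<Gamma>e: "\<Gamma> e' = (\<lambda>t. s b (h e t))" unfolding e(2) by (rule \<Gamma>[OF e(1)])
    have pt: "proj (\<Gamma> e' t) = \<gamma> e t" if "t \<in> {0..1}" for t
      using h[OF e(1)] that by (simp add: \<Gamma>e ps)
    have "continuous_on {0..1} (\<lambda>t. s b (h e t))"
      using h[OF e(1)] by (cases b) (auto simp: s_def path_def intro!: continuous_intros)
    then show "pathin (top_of_set unit_sphere) (\<Gamma> e')"
      using hS[OF e(1)] by (auto simp: pathin_canon_iff path_def \<Gamma>e s_def)
    show "inj_on (\<Gamma> e') {0..1}"
      using \<gamma>[OF e(1)] pt by (metis (no_types, lifting) inj_on_def)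
    show "{\<Gamma> e' 0, \<Gamma> e' 1} = P ` e'"
      using h[OF e(1)] h1[OF e(1)] unfolding \<Gamma>e by (auto simp: e(2) ce_def P_def s_def)
    show "\<Gamma> e' ` {0<..<1} \<inter> P ` fst (double_cover G \<sigma>) = {}"
    proof (rule ccontr)
      assume "\<not> ?thesis"
      then obtain t x where "t \<in> {0<..<1}" "x \<in> fst (double_cover G \<sigma>)" "\<Gamma> e' t = P x" by blast
      then obtain v c where t: "t \<in> {0<..<1}" "v \<in> fst G" "\<Gamma> e' t = P (v, c)"
        unfolding double_cover_def by (metis fst_conv mem_Sigma_iff surj_pair)
      then have "\<gamma> e t = p v" using pt[OF inner[OF t(1)]] q by (simp add: P_def ps)
      then show False using \<gamma>[OF e(1)] t by blast
    qed
    fix f' assume f': "f' \<in> snd (double_cover G \<sigma>)" "e' \<noteq> f'"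
    obtain f c where f: "f \<in> snd G" "f' = ce f c" using edges[OF f'(1)] by blast
    have \<Gamma>f: "\<Gamma> f' = (\<lambda>t. s c (h f t))" unfolding f(2) by (rule \<Gamma>[OF f(1)])
    show "\<Gamma> e' ` {0<..<1} \<inter> \<Gamma> f' ` {0<..<1} = {}"
    proof (rule ccontr)
      assume "\<not> ?thesis"
      then obtain t t' where t: "t \<in> {0<..<1}" "t' \<in> {0<..<1}" "\<Gamma> e' t = \<Gamma> f' t'" by blast
      have "proj (\<Gamma> f' t') = \<gamma> f t'"
        using h[OF f(1)] inner[OF t(2)] by (simp add: \<Gamma>f ps)
      then have eq: "\<gamma> e t = \<gamma> f t'" using pt[OF inner[OF t(1)]] t(3) by simp
      then have "e = f" using dj[OF e(1) f(1)] t by blast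
      then have "t = t'" using eq \<gamma>[OF e(1)] inner t by (metis inj_onD)
      moreover have "b \<noteq> c" using f'(2) e f \<open>e = f\<close> by blast
      ultimately have "h e t = - h e t"
        using t(3) \<open>e = f\<close> by (auto simp: \<Gamma>e \<Gamma>f s_def split: if_splits)
      then show False using ne hS[OF e(1) inner[OF t(1)]] by blast
    qed
  qed
  then show ?thesis using that by blast
qed

section \<open>Planar graphs with an apex set\<close>

fun path_edges :: "'v list \<Rightarrow> 'v set set" where
  "path_edges (x # y # zs) = insert {x, y} (path_edges (y # zs))"
| "path_edges _ = {}"

lemma path_edges_subset: "e \<in> path_edges vs \<Longrightarrow> e \<subseteq> set vs"
  by (induction vs rule: path_edges.induct) auto

lemma Union_path_edges: "length vs \<ge> 2 \<Longrightarrow> \<Union>(path_edges vs) = set vs"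
proof (induction vs rule: path_edges.induct)
  case (1 x y zs)
  then show ?case by (cases zs) auto
qed auto

lemma path_edges_meet_interior:
  assumes "e \<in> path_edges (s # vs @ [t])" and "vs \<noteq> []" and "distinct (s # vs @ [t])"
  shows "e \<inter> set vs \<noteq> {}"
  using assms
proof (induction vs arbitrary: s)
  case (Cons x xs)
  show ?case
  proof (cases "e = {s, x}")
    case False
    then have e: "e \<in> path_edges (x # xs @ [t])" using Cons.prems(1) by simp
    then show ?thesis
      using Cons.IH[OF e] Cons.prems by (cases "xs = []") auto
  qed simp
qed simp

definition connected_in :: "'v graph \<Rightarrow> 'v set \<Rightarrow> bool" where
  "connected_in G W \<longleftrightarrow>
     (\<forall>u \<in> W. \<forall>v \<in> W. (u, v) \<in> {(x, y). x \<in> W \<and> y \<in> W \<and> {x, y} \<in> snd G}\<^sup>*)"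

definition touches :: "'v graph \<Rightarrow> 'v set \<Rightarrow> 'v \<Rightarrow> bool" where
  "touches G W v \<longleftrightarrow> (\<exists>w \<in> W. {v, w} \<in> snd G)"

definition planar :: "'v graph \<Rightarrow> bool" where
  "planar G \<longleftrightarrow> embeds_in G (top_of_set unit_sphere)"

locale sphere_drawing =
  fixes G :: "'v graph" and p :: "'v \<Rightarrow> real ^ 3" and \<gamma> :: "'v set \<Rightarrow> real \<Rightarrow> real ^ 3"
  assumes simple: "simple_graph G"
    and inj: "inj_on p (fst G)"
    and vertices: "p ` fst G \<subseteq> unit_sphere"
    and curve: "e \<in> snd G \<Longrightarrow> path (\<gamma> e) \<and> path_image (\<gamma> e) \<subseteq> unit_sphere \<and> inj_on (\<gamma> e) {0..1} \<and>
       {\<gamma> e 0, \<gamma> e 1} = p ` e \<and> \<gamma> e ` {0<..<1} \<inter> p ` fst G = {}"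
    and disj: "e \<in> snd G \<Longrightarrow> f \<in> snd G \<Longrightarrow> e \<noteq> f \<Longrightarrow> \<gamma> e ` {0<..<1} \<inter> \<gamma> f ` {0<..<1} = {}"
begin

lemma edge_vertices: "e \<in> snd G \<Longrightarrow> e \<subseteq> fst G"
  using simple by (auto simp: simple_graph_def)

lemma edge_distinct: "{u, w} \<in> snd G \<Longrightarrow> u \<noteq> w"
  using simple by (force simp: simple_graph_def)

lemma path_image_decomp: "e \<in> snd G \<Longrightarrow> path_image (\<gamma> e) = p ` e \<union> \<gamma> e ` {0<..<1}"
proof -
  assume e: "e \<in> snd G"
  have "{0..1::real} = {0, 1} \<union> {0<..<1}" by force
  then have "path_image (\<gamma> e) = {\<gamma> e 0, \<gamma> e 1} \<union> \<gamma> e ` {0<..<1}"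
    unfolding path_image_def by (simp only: image_Un image_insert image_empty)
  then show ?thesis using curve[OF e] by simp
qed

lemma arcs_meet:
  assumes "e \<in> snd G" and "f \<in> snd G" and "e \<noteq> f"
  shows "path_image (\<gamma> e) \<inter> path_image (\<gamma> f) = p ` (e \<inter> f)"
proof -
  have "p ` (e \<inter> f) = p ` e \<inter> p ` f"
    by (rule inj_on_image_Int[OF inj edge_vertices[OF assms(1)] edge_vertices[OF assms(2)]])
  moreover have "p ` e \<subseteq> p ` fst G" "p ` f \<subseteq> p ` fst G" using edge_vertices assms by blast+
  moreover have "\<gamma> e ` {0<..<1} \<inter> p ` fst G = {}" "\<gamma> f ` {0<..<1} \<inter> p ` fst G = {}"
    using curve assms by blast+
  moreover note disj[OF assms]
  moreover have "(A \<union> B) \<inter> (C \<union> D) = A \<inter> C"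
    if "A \<subseteq> V" "C \<subseteq> V" "B \<inter> V = {}" "D \<inter> V = {}" "B \<inter> D = {}" for A B C D V :: "(real ^ 3) set"
    using that by blast
  ultimately show ?thesis
    unfolding path_image_decomp[OF assms(1)] path_image_decomp[OF assms(2)] by simp
qed

lemma edge_arc: "{u, w} \<in> snd G \<Longrightarrow> arc_joins (path_image (\<gamma> {u, w})) (p u) (p w)"
proof -
  assume e: "{u, w} \<in> snd G"
  have "arc (\<gamma> {u, w})" using curve[OF e] by (simp add: arc_def)
  moreover have "pathstart (\<gamma> {u, w}) = p u \<and> pathfinish (\<gamma> {u, w}) = p w \<or>
      pathstart (\<gamma> {u, w}) = p w \<and> pathfinish (\<gamma> {u, w}) = p u"
    using curve[OF e] by (auto simp: pathstart_def pathfinish_def doubleton_eq_iff)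
  ultimately have "arc_joins (path_image (\<gamma> {u, w})) (p u) (p w) \<or>
      arc_joins (path_image (\<gamma> {u, w})) (p w) (p u)"
    unfolding arc_joins_def by blast
  then show ?thesis using arc_joins_sym by blast
qed

definition locus :: "'v list \<Rightarrow> (real ^ 3) set" where
  "locus vs = (\<Union>e \<in> path_edges vs. path_image (\<gamma> e))"

lemma locus_in_sphere: "path_edges vs \<subseteq> snd G \<Longrightarrow> locus vs \<subseteq> unit_sphere"
  unfolding locus_def using curve by blast

lemma locus_decomp:
  assumes "path_edges vs \<subseteq> snd G" "length vs \<ge> 2"
  shows "locus vs = p ` set vs \<union> (\<Union>e \<in> path_edges vs. \<gamma> e ` {0<..<1})"
proof -
  have "locus vs = (\<Union>e \<in> path_edges vs. p ` e \<union> \<gamma> e ` {0<..<1})"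
    unfolding locus_def using path_image_decomp assms(1) by (intro SUP_cong refl) blast
  also have "\<dots> = p ` \<Union>(path_edges vs) \<union> (\<Union>e \<in> path_edges vs. \<gamma> e ` {0<..<1})" by blast
  finally show ?thesis using Union_path_edges[OF assms(2)] by simp
qed

lemma loci_meet:
  assumes vs: "path_edges vs \<subseteq> snd G" "length vs \<ge> 2" and ws: "path_edges ws \<subseteq> snd G" "length ws \<ge> 2"
    and ne: "path_edges vs \<inter> path_edges ws = {}"
  shows "locus vs \<inter> locus ws = p ` (set vs \<inter> set ws)"
proof -
  have "locus vs \<inter> locus ws = (\<Union>e \<in> path_edges vs. \<Union>f \<in> path_edges ws. path_image (\<gamma> e) \<inter> path_image (\<gamma> f))"
    unfolding locus_def by blast
  also have "\<dots> = (\<Union>e \<in> path_edges vs. \<Union>f \<in> path_edges ws. p ` (e \<inter> f))"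
    using arcs_meet vs(1) ws(1) ne by (intro SUP_cong refl) blast
  also have "\<dots> = p ` (\<Union>(path_edges vs) \<inter> \<Union>(path_edges ws))" by blast
  finally show ?thesis unfolding Union_path_edges[OF vs(2)] Union_path_edges[OF ws(2)] .
qed

lemma locus_arc:
  assumes "path_edges vs \<subseteq> snd G" "length vs \<ge> 2" "distinct vs"
  shows "arc_joins (locus vs) (p (hd vs)) (p (last vs))"
  using assms
proof (induction vs rule: path_edges.induct)
  case (1 x y zs)
  show ?case
  proof (cases zs)
    case Nil
    then show ?thesis using 1 edge_arc by (simp add: locus_def)
  next
    case (Cons z zs')
    have e: "{x, y} \<in> snd G" using 1 by simp
    have IH: "arc_joins (locus (y # zs)) (p y) (p (last (y # zs)))" using 1 Cons by simp
    have ne: "{x, y} \<notin> path_edges (y # zs)" using 1(4) path_edges_subset[of "{x, y}" "y # zs"] by auto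
    have "locus [x, y] \<inter> locus (y # zs) = p ` (set [x, y] \<inter> set (y # zs))"
      by (rule loci_meet) (use 1 Cons ne in auto)
    also have "set [x, y] \<inter> set (y # zs) = {y}" using 1(4) by auto
    finally have "path_image (\<gamma> {x, y}) \<inter> locus (y # zs) = {p y}" by (simp add: locus_def)
    from arc_joins_trans[OF edge_arc[OF e] IH this]
    show ?thesis using Cons by (simp add: locus_def)
  qed
qed auto

text \<open>The open star of \<open>W\<close>. If \<open>W\<close> is connected in
  \<open>G\<close>, then so is the star as a point set, and every neighbour of \<open>W\<close>
  lies in its closure.\<close>
definition region :: "'v set \<Rightarrow> (real ^ 3) set" where
  "region W = p ` W \<union> (\<Union>e \<in> {e \<in> snd G. e \<inter> W \<noteq> {}}. \<gamma> e ` {0<..<1})"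

lemma region_in_sphere: "W \<subseteq> fst G \<Longrightarrow> region W \<subseteq> unit_sphere"
proof -
  assume "W \<subseteq> fst G"
  then have "p ` W \<subseteq> unit_sphere" using vertices by blast
  moreover have "\<gamma> e ` {0<..<1} \<subseteq> unit_sphere" if "e \<in> snd G" for e
    using path_image_decomp[OF that] curve[OF that] by blast
  ultimately show ?thesis unfolding region_def by blast
qed

lemma open_arc:
  assumes "e \<in> snd G" shows "connected (\<gamma> e ` {0<..<1})" "p ` e \<subseteq> closure (\<gamma> e ` {0<..<1})"
proof -
  obtain u w where e: "e = {u, w}" using assms simple by (auto simp: simple_graph_def card_2_iff)
  have A: "arc_joins (path_image (\<gamma> e)) (p u) (p w)" using edge_arc assms e by blast
  have "path_image (\<gamma> e) - {p u, p w} = \<gamma> e ` {0<..<1}"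
    using path_image_decomp[OF assms] curve[OF assms] edge_vertices[OF assms] e by blast
  then show "connected (\<gamma> e ` {0<..<1})" "p ` e \<subseteq> closure (\<gamma> e ` {0<..<1})"
    using arc_joins_interior[OF A] arc_joins_ends[OF A] e by auto
qed

lemma star_component:
  assumes "e \<in> snd G" "u \<in> e" "u \<in> W" "x \<in> \<gamma> e ` {0<..<1}"
  shows "connected_component (region W) (p u) x"
proof (rule connected_componentI)
  have "p u \<in> closure (\<gamma> e ` {0<..<1})" using open_arc(2)[OF assms(1)] assms(2) by blast
  then have "insert (p u) (\<gamma> e ` {0<..<1}) \<subseteq> closure (\<gamma> e ` {0<..<1})"
    using closure_subset[of "\<gamma> e ` {0<..<1}"] by blast
  then show "connected (insert (p u) (\<gamma> e ` {0<..<1}))"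
    by (intro connected_intermediate_closure[OF open_arc(1)[OF assms(1)]] subset_insertI)
  show "insert (p u) (\<gamma> e ` {0<..<1}) \<subseteq> region W"
    using assms by (auto simp: region_def)
qed (use assms in auto)

lemma region_connected:
  assumes con: "connected_in G W" and WG: "W \<subseteq> fst G"
  shows "connected (region W)"
proof (cases "W = {}")
  case False
  then obtain a where a: "a \<in> W" by blast
  have vert: "connected_component (region W) (p a) (p v)" if "v \<in> W" for v
  proof -
    have "(a, v) \<in> {(x, y). x \<in> W \<and> y \<in> W \<and> {x, y} \<in> snd G}\<^sup>*"
      using con a that by (simp add: connected_in_def)
    then show ?thesis
    proof (induction rule: rtrancl_induct)
      case base
      then show ?case using a by (simp add: connected_component_refl region_def)
    next
      case (step y z)
      then have yz: "y \<in> W" "z \<in> W" "{y, z} \<in> snd G" by auto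
      have x: "\<gamma> {y, z} (1/2) \<in> \<gamma> {y, z} ` {0<..<1}" by auto
      have "connected_component (region W) (p y) (\<gamma> {y, z} (1/2))"
        "connected_component (region W) (p z) (\<gamma> {y, z} (1/2))"
        by (rule star_component[OF yz(3) _ _ x]; use yz in simp)+
      then show ?case using step.IH by (meson connected_component_sym connected_component_trans)
    qed
  qed
  have "connected_component (region W) (p a) x" if "x \<in> region W" for x
  proof -
    consider v where "v \<in> W" "x = p v" | e u where "e \<in> snd G" "u \<in> e" "u \<in> W" "x \<in> \<gamma> e ` {0<..<1}"
      using \<open>x \<in> region W\<close> unfolding region_def by blast
    then show ?thesis
    proof cases
      case 2
      then show ?thesis using star_component[of e u W x] vert[of u] connected_component_trans by blast
    qed (use vert in blast)
  qed
  then show ?thesis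
    unfolding connected_iff_connected_component by (meson connected_component_sym connected_component_trans)
qed (simp add: region_def)

lemma region_touch:
  assumes "touches G W v"
  shows "p v \<in> closure (region W)"
proof -
  obtain w where w: "w \<in> W" "{v, w} \<in> snd G" using assms by (auto simp: touches_def)
  have "\<gamma> {v, w} ` {0<..<1} \<subseteq> region W" using w by (auto simp: region_def)
  then have "closure (\<gamma> {v, w} ` {0<..<1}) \<subseteq> closure (region W)" by (rule closure_mono)
  then show ?thesis using open_arc(2)[OF w(2)] by auto
qed

lemma region_avoids_locus:
  assumes vs: "path_edges vs \<subseteq> snd G" "length vs \<ge> 2" and W: "W \<subseteq> fst G" "W \<inter> set vs = {}"
  shows "region W \<inter> locus vs = {}"
proof -
  have sub: "set vs \<subseteq> fst G" using Union_path_edges[OF vs(2)] vs(1) edge_vertices by blast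
  have 1: "p ` W \<inter> p ` set vs = {}" using inj_on_image_Int[OF inj W(1) sub] W(2) by simp
  have ne: "e \<noteq> f" if "e \<in> path_edges vs" "f \<inter> W \<noteq> {}" for e f
    using path_edges_subset[OF that(1)] that(2) W(2) by blast
  have 2: "\<gamma> f ` {0<..<1} \<inter> \<gamma> e ` {0<..<1} = {}" if "e \<in> path_edges vs" "f \<in> snd G" "f \<inter> W \<noteq> {}" for e f
    using disj[of f e] ne[OF that(1,3)] that vs(1) by blast
  have 3: "\<gamma> e ` {0<..<1} \<inter> p ` fst G = {}" if "e \<in> snd G" for e using curve[OF that] by blast
  have "p ` W \<subseteq> p ` fst G" "p ` set vs \<subseteq> p ` fst G" using W(1) sub by blast+
  then have "p ` W \<inter> (\<Union>e \<in> path_edges vs. \<gamma> e ` {0<..<1}) = {}"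
    "(\<Union>e \<in> {e \<in> snd G. e \<inter> W \<noteq> {}}. \<gamma> e ` {0<..<1}) \<inter> p ` set vs = {}"
    using 3 vs(1) by blast+
  moreover have "(\<Union>e \<in> {e \<in> snd G. e \<inter> W \<noteq> {}}. \<gamma> e ` {0<..<1}) \<inter> (\<Union>e \<in> path_edges vs. \<gamma> e ` {0<..<1}) = {}"
    using 2 by blast
  ultimately show ?thesis
    unfolding locus_decomp[OF vs] region_def Int_Un_distrib Int_Un_distrib2 using 1 by simp
qed

end

lemma planar_sphere_drawing:
  assumes "planar G" and "simple_graph G"
  obtains p \<gamma> where "sphere_drawing G p \<gamma>"
proof -
  obtain p \<gamma> where p: "inj_on p (fst G)" "p ` fst G \<subseteq> topspace (top_of_set unit_sphere)"
    and \<gamma>: "\<forall>e \<in> snd G. pathin (top_of_set unit_sphere) (\<gamma> e) \<and> inj_on (\<gamma> e) {0..1} \<and> {\<gamma> e 0, \<gamma> e 1} = p ` e \<and>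
           \<gamma> e ` {0<..<1} \<inter> p ` fst G = {}"
    and dj: "\<forall>e \<in> snd G. \<forall>f \<in> snd G. e \<noteq> f \<longrightarrow> \<gamma> e ` {0<..<1} \<inter> \<gamma> f ` {0<..<1} = {}"
    using assms(1) unfolding planar_def embeds_in_def by (elim exE conjE) (rule that)
  have "sphere_drawing G p \<gamma>"
  proof
    show "p ` fst G \<subseteq> unit_sphere" using p(2) by simp
    fix e assume e: "e \<in> snd G"
    then show "path (\<gamma> e) \<and> path_image (\<gamma> e) \<subseteq> unit_sphere \<and> inj_on (\<gamma> e) {0..1} \<and>
       {\<gamma> e 0, \<gamma> e 1} = p ` e \<and> \<gamma> e ` {0<..<1} \<inter> p ` fst G = {}"
      using bspec[OF \<gamma> e] unfolding pathin_canon_iff path_image_def Pi_iff by blast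
  qed (use assms(2) p(1) dj in blast)+
  then show ?thesis using that by blast
qed

text \<open>Contracting \<open>W\<close> to a point gives a subdivision of
  \<open>K\<^sub>3\<^sub>,\<^sub>3\<close>; in the drawing the open star of \<open>W\<close> takes
  the place of that point.\<close>
lemma planar_no_theta_with_apex:
  assumes G: "planar G" "simple_graph G"
    and edges: "path_edges (s # xs @ [t]) \<subseteq> snd G" "path_edges (s # ys @ [t]) \<subseteq> snd G"
      "path_edges (s # zs @ [t]) \<subseteq> snd G"
    and dist: "distinct (s # t # xs @ ys @ zs)"
    and W: "W \<subseteq> fst G" "W \<inter> set (s # t # xs @ ys @ zs) = {}" "connected_in G W"
    and touch: "\<exists>v \<in> set xs. touches G W v" "\<exists>v \<in> set ys. touches G W v" "\<exists>v \<in> set zs. touches G W v"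
  shows False
proof -
  obtain p \<gamma> where "sphere_drawing G p \<gamma>" using planar_sphere_drawing[OF G] by blast
  then interpret sphere_drawing G p \<gamma> .
  let ?x = "s # xs @ [t]" and ?y = "s # ys @ [t]" and ?z = "s # zs @ [t]"
  have ne: "xs \<noteq> []" "ys \<noteq> []" "zs \<noteq> []" using touch by auto
  have disjoint_edges: "path_edges (s # us @ [t]) \<inter> path_edges (s # vs @ [t]) = {}"
    if "us \<noteq> []" "distinct (s # us @ [t])" "set us \<inter> set (s # vs @ [t]) = {}" for us vs
    using path_edges_meet_interior[OF _ that(1,2)] path_edges_subset[of _ "s # vs @ [t]"] that(3) by blast
  have meet: "locus (s # us @ [t]) \<inter> locus (s # vs @ [t]) = {p s, p t}"
    if "path_edges (s # us @ [t]) \<subseteq> snd G" "path_edges (s # vs @ [t]) \<subseteq> snd G"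
      "us \<noteq> []" "distinct (s # us @ [t])" "set us \<inter> set (s # vs @ [t]) = {}" for us vs
  proof -
    have "locus (s # us @ [t]) \<inter> locus (s # vs @ [t]) = p ` (set (s # us @ [t]) \<inter> set (s # vs @ [t]))"
      by (rule loci_meet[OF that(1) _ that(2) _ disjoint_edges[OF that(3-5)]]) auto
    also have "set (s # us @ [t]) \<inter> set (s # vs @ [t]) = {s, t}" using that(5) by auto
    finally show ?thesis by simp
  qed
  have arcs: "arc_joins (locus ?x) (p s) (p t)" "arc_joins (locus ?y) (p s) (p t)" "arc_joins (locus ?z) (p s) (p t)"
    using locus_arc[OF edges(1)] locus_arc[OF edges(2)] locus_arc[OF edges(3)] dist by auto
  have near: "closure (region W) \<inter> (locus (s # us @ [t]) - {p s, p t}) \<noteq> {}"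
    if us: "path_edges (s # us @ [t]) \<subseteq> snd G" "distinct (s # us @ [t])" "\<exists>v \<in> set us. touches G W v" for us
  proof -
    obtain v where v: "v \<in> set us" "touches G W v" using us(3) by blast
    have "v \<in> fst G" "s \<in> fst G" "t \<in> fst G"
      using Union_path_edges[of "s # us @ [t]"] us(1) edge_vertices v(1) by fastforce+
    then have "p v \<noteq> p s" "p v \<noteq> p t" using us(2) v(1) inj by (auto dest: inj_onD)
    moreover have "p v \<in> locus (s # us @ [t])" using locus_decomp[OF us(1)] v(1) by auto
    ultimately show ?thesis using region_touch[OF v(2)] by blast
  qed
  have away: "region W \<inter> locus (s # us @ [t]) = {}"
    if "path_edges (s # us @ [t]) \<subseteq> snd G" "set us \<subseteq> set (xs @ ys @ zs)" for us
    by (rule region_avoids_locus[OF that(1) _ W(1)]) (use W(2) that(2) in auto)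
  show False
  proof (rule theta_no_apex[OF arcs])
    show "locus ?x \<union> locus ?y \<union> locus ?z \<subseteq> unit_sphere" using locus_in_sphere edges by blast
    show "connected (region W)" by (rule region_connected[OF W(3,1)])
    have "region W \<inter> locus ?x = {}" "region W \<inter> locus ?y = {}" "region W \<inter> locus ?z = {}"
      using away edges by auto
    then show "region W \<subseteq> unit_sphere - (locus ?x \<union> locus ?y \<union> locus ?z)"
      using region_in_sphere[OF W(1)] by blast
    show "locus ?x \<inter> locus ?y = {p s, p t}" "locus ?x \<inter> locus ?z = {p s, p t}" "locus ?y \<inter> locus ?z = {p s, p t}"
      by (rule meet; use edges ne dist in auto)+
    show "closure (region W) \<inter> (locus ?x - {p s, p t}) \<noteq> {}"
      "closure (region W) \<inter> (locus ?y - {p s, p t}) \<noteq> {}"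
      "closure (region W) \<inter> (locus ?z - {p s, p t}) \<noteq> {}"
      by (rule near; use edges touch dist in auto)+
  qed
qed

text \<open>Contracting \<open>W\<close> to a point gives \<open>K\<^sub>5\<close>.\<close>
lemma planar_no_K4_with_apex:
  assumes G: "planar G" "simple_graph G"
    and edges: "{a, b} \<in> snd G" "{a, c} \<in> snd G" "{a, d} \<in> snd G" "{b, c} \<in> snd G" "{b, d} \<in> snd G" "{c, d} \<in> snd G"
    and dist: "distinct [a, b, c, d]"
    and W: "W \<subseteq> fst G" "W \<inter> {a, b, c, d} = {}" "connected_in G W"
    and touch: "\<forall>v \<in> {a, b, c, d}. touches G W v"
  shows False
proof -
  obtain p \<gamma> where "sphere_drawing G p \<gamma>" using planar_sphere_drawing[OF G] by blast
  then interpret sphere_drawing G p \<gamma> .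
  have ne: "a \<noteq> b" "a \<noteq> c" "a \<noteq> d" "b \<noteq> c" "b \<noteq> d" "c \<noteq> d" using dist by auto
  have V: "a \<in> fst G" "b \<in> fst G" "c \<in> fst G" "d \<in> fst G" using edge_vertices edges by blast+
  have meet: "path_image (\<gamma> {u, v}) \<inter> path_image (\<gamma> {u, w}) = {p u}"
    if "{u, v} \<in> snd G" "{u, w} \<in> snd G" "v \<noteq> w" for u v w
  proof -
    have "{u, v} \<noteq> {u, w}" "{u, v} \<inter> {u, w} = {u}"
      using that edge_distinct[OF that(1)] by (auto simp: doubleton_eq_iff)
    then show ?thesis using arcs_meet[OF that(1,2)] by (simp only: image_insert image_empty not_False_eq_True)
  qed
  have apart: "path_image (\<gamma> {u, v}) \<inter> path_image (\<gamma> {w, z}) = {}"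
    if "{u, v} \<in> snd G" "{w, z} \<in> snd G" "{u, v} \<inter> {w, z} = {}" for u v w z
    using arcs_meet[OF that(1,2)] that(3) by force
  have edges': "{b, a} \<in> snd G" "{c, a} \<in> snd G" "{d, a} \<in> snd G" "{c, b} \<in> snd G" "{d, b} \<in> snd G" "{d, c} \<in> snd G"
    using edges by (simp_all add: insert_commute)
  have away: "region W \<inter> path_image (\<gamma> {u, v}) = {}" if "{u, v} \<in> snd G" "W \<inter> {u, v} = {}" for u v
    using region_avoids_locus[of "[u, v]" W] that W(1) by (simp add: locus_def)
  have "region W \<inter> path_image (\<gamma> {a, b}) = {}" "region W \<inter> path_image (\<gamma> {a, c}) = {}"
    "region W \<inter> path_image (\<gamma> {a, d}) = {}" "region W \<inter> path_image (\<gamma> {b, c}) = {}"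
    "region W \<inter> path_image (\<gamma> {b, d}) = {}" "region W \<inter> path_image (\<gamma> {c, d}) = {}"
    by (rule away; use edges W(2) in blast)+
  then have reg: "region W \<subseteq> unit_sphere - (path_image (\<gamma> {a, b}) \<union> path_image (\<gamma> {a, c}) \<union> path_image (\<gamma> {a, d}) \<union>
      path_image (\<gamma> {b, c}) \<union> path_image (\<gamma> {b, d}) \<union> path_image (\<gamma> {c, d}))"
    using region_in_sphere[OF W(1)] by blast
  have sub: "path_image (\<gamma> {a, b}) \<union> path_image (\<gamma> {a, c}) \<union> path_image (\<gamma> {a, d}) \<union>
      path_image (\<gamma> {b, c}) \<union> path_image (\<gamma> {b, d}) \<union> path_image (\<gamma> {c, d}) \<subseteq> unit_sphere"
    using curve edges by (intro Un_least) auto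
  show False
  proof (rule K4_no_apex[OF edge_arc[OF edges(1)] edge_arc[OF edges(2)] edge_arc[OF edges(3)]
        edge_arc[OF edges(4)] edge_arc[OF edges(5)] edge_arc[OF edges(6)] _ _ _ _ _ _ _ _ _ _ _ _ _ _ _ _ sub
        region_connected[OF W(3,1)] reg])
    show "distinct [p a, p b, p c, p d]" using inj V ne by (auto dest: inj_onD)
    show "{p a, p b, p c, p d} \<subseteq> closure (region W)" using region_touch touch by auto
  qed (use meet[of a b c] meet[of a b d] meet[of a c d] meet[of b a c] meet[of b a d] meet[of b c d]
      meet[of c a b] meet[of c a d] meet[of c b d] meet[of d a b] meet[of d a c] meet[of d b c]
      apart[of a b c d] apart[of a c b d] apart[of a d b c] edges edges' ne in \<open>simp_all add: insert_commute\<close>)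
qed

section \<open>Cliques in projective graphs\<close>

lemma connected_in_root:
  assumes "a \<in> W" and "\<And>v. v \<in> W \<Longrightarrow> (a, v) \<in> {(x, y). x \<in> W \<and> y \<in> W \<and> {x, y} \<in> snd G}\<^sup>*"
  shows "connected_in G W"
proof -
  have "sym {(x, y). x \<in> W \<and> y \<in> W \<and> {x, y} \<in> snd G}" by (auto simp: sym_def insert_commute)
  then have "sym ({(x, y). x \<in> W \<and> y \<in> W \<and> {x, y} \<in> snd G}\<^sup>*)" by (rule sym_rtrancl)
  then show ?thesis unfolding connected_in_def using assms by (meson rtrancl_trans symD)
qed

definition clique_in :: "'v graph \<Rightarrow> 'v set \<Rightarrow> bool" where
  "clique_in G K \<longleftrightarrow> K \<subseteq> fst G \<and> (\<forall>x \<in> K. \<forall>y \<in> K. x \<noteq> y \<longrightarrow> {x, y} \<in> snd G)"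

lemma clique_in_subset: "clique_in G K \<Longrightarrow> L \<subseteq> K \<Longrightarrow> clique_in G L"
  by (auto simp: clique_in_def)

lemma connected_in_clique:
  assumes "clique_in G W" shows "connected_in G W"
proof -
  have "(u, v) \<in> {(x, y). x \<in> W \<and> y \<in> W \<and> {x, y} \<in> snd G}\<^sup>*" if "u \<in> W" "v \<in> W" for u v
  proof (cases "u = v")
    case False
    then have "(u, v) \<in> {(x, y). x \<in> W \<and> y \<in> W \<and> {x, y} \<in> snd G}"
      using assms that unfolding clique_in_def by blast
    then show ?thesis by (rule r_into_rtrancl)
  qed simp
  then show ?thesis by (simp add: connected_in_def)
qed

text \<open>The preimage of an odd triangle in the double cover is a hexagon, while that of an
  even one consists of two triangles.\<close>
definition odd_triangle :: "('v set \<Rightarrow> bool) \<Rightarrow> 'v set \<Rightarrow> bool" where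
  "odd_triangle \<sigma> K \<longleftrightarrow> (\<exists>x \<in> K. \<exists>y \<in> K. \<exists>z \<in> K. x \<noteq> y \<and> y \<noteq> z \<and> z \<noteq> x \<and>
     (\<sigma> {x, y} \<noteq> (\<sigma> {y, z} \<noteq> \<sigma> {z, x})))"

text \<open>A choice of one sheet over every vertex of \<open>K\<close> such that the chosen
  vertices are joined to each other in the double cover.\<close>
definition balanced :: "('v set \<Rightarrow> bool) \<Rightarrow> 'v set \<Rightarrow> ('v \<Rightarrow> bool) \<Rightarrow> bool" where
  "balanced \<sigma> K s \<longleftrightarrow> (\<forall>x \<in> K. \<forall>y \<in> K. x \<noteq> y \<longrightarrow> s y = (s x \<noteq> \<sigma> {x, y}))"

text \<open>Fix the sheet over one vertex \<open>a\<close> and choose over every other vertex the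
  neighbour of the fixed lift of \<open>a\<close>. The choices over \<open>x\<close> and
  \<open>y\<close> are compatible because the triangle \<open>a x y\<close> is even.\<close>
lemma balanced_if_no_odd_triangle:
  assumes "\<not> odd_triangle \<sigma> K"
  obtains s where "balanced \<sigma> K s"
proof (cases "K = {}")
  case False
  then obtain a where a: "a \<in> K" by blast
  define s where "s x = (x = a \<or> \<not> \<sigma> {a, x})" for x
  have "s y = (s x \<noteq> \<sigma> {x, y})" if xy: "x \<in> K" "y \<in> K" "x \<noteq> y" for x y
  proof (cases "x = a \<or> y = a")
    case True
    then show ?thesis using xy by (auto simp: s_def insert_commute)
  next
    case False
    then have "\<not> (\<sigma> {a, x} \<noteq> (\<sigma> {x, y} \<noteq> \<sigma> {y, a}))"
      using assms a xy unfolding odd_triangle_def by blast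
    then show ?thesis using False by (auto simp: s_def insert_commute)
  qed
  then have "balanced \<sigma> K s" unfolding balanced_def by blast
  then show ?thesis by (rule that)
qed (use that in \<open>auto simp: balanced_def\<close>)

lemma double_cover_edge:
  "{u, w} \<in> snd G \<Longrightarrow> c = (b \<noteq> \<sigma> {u, w}) \<Longrightarrow> {(u, b), (w, c)} \<in> snd (double_cover G \<sigma>)"
  by (auto simp: double_cover_def)

lemma double_cover_vertices: "fst (double_cover G \<sigma>) = fst G \<times> UNIV"
  by (simp add: double_cover_def)

lemma clique_lift:
  assumes "clique_in G K" and "balanced \<sigma> K s"
  shows "clique_in (double_cover G \<sigma>) ((\<lambda>x. (x, s x)) ` K)"
  unfolding clique_in_def
proof (intro conjI ballI impI)
  show "(\<lambda>x. (x, s x)) ` K \<subseteq> fst (double_cover G \<sigma>)"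
    using assms(1) by (auto simp: clique_in_def double_cover_vertices)
  fix u v assume "u \<in> (\<lambda>x. (x, s x)) ` K" "v \<in> (\<lambda>x. (x, s x)) ` K" "u \<noteq> v"
  then obtain x y where xy: "x \<in> K" "y \<in> K" "x \<noteq> y" "u = (x, s x)" "v = (y, s y)" by blast
  show "{u, v} \<in> snd (double_cover G \<sigma>)"
    unfolding xy(4,5)
  proof (rule double_cover_edge)
    show "{x, y} \<in> snd G" using assms(1) xy(1-3) by (simp add: clique_in_def)
    show "s y = (s x \<noteq> \<sigma> {x, y})" using assms(2) xy(1-3) unfolding balanced_def by blast
  qed
qed

lemma card_4_obtain:
  assumes "card K = 4" obtains a b c d where "K = {a, b, c, d}" "distinct [a, b, c, d]"
proof -
  have "finite K" using assms by (metis card.infinite zero_neq_numeral)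
  then obtain xs where xs: "set xs = K" "distinct xs" using finite_distinct_list by blast
  then have "length xs = 4" using assms distinct_card by metis
  then obtain a b c d where "xs = [a, b, c, d]" by (auto simp: numeral_eq_Suc length_Suc_conv)
  then show ?thesis using xs by (intro that[of a b c d]) auto
qed

lemma planar_no_clique_with_apex:
  assumes "planar G" "simple_graph G" and K: "clique_in G K" "card K = 4"
    and W: "W \<subseteq> fst G" "W \<inter> K = {}" "connected_in G W" and touch: "\<And>v. v \<in> K \<Longrightarrow> touches G W v"
  shows False
proof -
  obtain a b c d where abcd: "K = {a, b, c, d}" "distinct [a, b, c, d]" using card_4_obtain[OF K(2)] .
  have "{x, y} \<in> snd G" if "x \<in> K" "y \<in> K" "x \<noteq> y" for x y using K(1) that by (simp add: clique_in_def)
  then show False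
    using abcd W touch
    by (intro planar_no_K4_with_apex[OF assms(1,2), of a b c d W]) auto
qed

lemma planar_no_five_clique:
  assumes "planar G" "simple_graph G" "clique_in G K" "card K = 5"
  shows False
proof -
  have "finite K" using assms(4) by (metis card.infinite zero_neq_numeral)
  obtain e where e: "e \<in> K" using assms(4) by fastforce
  show False
  proof (rule planar_no_clique_with_apex[OF assms(1,2), of "K - {e}" "{e}"])
    show "card (K - {e}) = 4" using assms(4) e \<open>finite K\<close> by simp
    show "touches G {e} v" if "v \<in> K - {e}" for v
      using that e assms(3) by (auto simp: touches_def clique_in_def)
  qed (use assms(3) e in \<open>auto simp: clique_in_def connected_in_def\<close>)
qed

text \<open>Otherwise the clique lifts to a \<open>K\<^sub>5\<close> in the sphere.\<close>
lemma five_clique_odd_triangle: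
  assumes "planar (double_cover G \<sigma>)" "simple_graph G" "clique_in G K" "card K = 5"
  shows "odd_triangle \<sigma> K"
proof (rule ccontr)
  assume "\<not> odd_triangle \<sigma> K"
  then obtain s where "balanced \<sigma> K s" by (rule balanced_if_no_odd_triangle)
  moreover have "card ((\<lambda>x. (x, s x)) ` K) = 5"
    using assms(4) by (subst card_image) (auto simp: inj_on_def)
  ultimately show False
    using planar_no_five_clique[OF assms(1) simple_graph_double_cover[OF assms(2)]] clique_lift[OF assms(3)] by blast
qed

text \<open>Going once round an odd triangle leads to the other sheet.\<close>
lemma odd_triangle_cover_connected:
  assumes K: "clique_in G K" and odd: "odd_triangle \<sigma> K"
  shows "connected_in (double_cover G \<sigma>) (K \<times> UNIV)"
proof -
  obtain x y z where xyz: "x \<in> K" "y \<in> K" "z \<in> K" "x \<noteq> y" "y \<noteq> z" "z \<noteq> x"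
    and sg: "\<sigma> {x, y} \<noteq> (\<sigma> {y, z} \<noteq> \<sigma> {z, x})"
    using odd unfolding odd_triangle_def by blast
  let ?R = "{(u, v). u \<in> K \<times> UNIV \<and> v \<in> K \<times> UNIV \<and> {u, v} \<in> snd (double_cover G \<sigma>)}"
  have step: "((u, b), (w, b \<noteq> \<sigma> {u, w})) \<in> ?R" if "u \<in> K" "w \<in> K" "u \<noteq> w" for u w b
    using K that by (auto simp: clique_in_def intro!: double_cover_edge)
  have flip: "((x, True), (x, False)) \<in> ?R\<^sup>*"
  proof -
    have "((x, True), (y, True \<noteq> \<sigma> {x, y})) \<in> ?R\<^sup>*" using step[of x y True] xyz by blast
    also have "((y, True \<noteq> \<sigma> {x, y}), (z, (True \<noteq> \<sigma> {x, y}) \<noteq> \<sigma> {y, z})) \<in> ?R\<^sup>*"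
      using step[of y z] xyz by blast
    also have "((z, (True \<noteq> \<sigma> {x, y}) \<noteq> \<sigma> {y, z}), (x, ((True \<noteq> \<sigma> {x, y}) \<noteq> \<sigma> {y, z}) \<noteq> \<sigma> {z, x})) \<in> ?R\<^sup>*"
      using step[of z x] xyz by blast
    also have "(((True \<noteq> \<sigma> {x, y}) \<noteq> \<sigma> {y, z}) \<noteq> \<sigma> {z, x}) = False" using sg by auto
    finally show ?thesis .
  qed
  have root: "((x, True), (x, b)) \<in> ?R\<^sup>*" for b using flip by (cases b) auto
  show ?thesis
  proof (rule connected_in_root[of "(x, True)"])
    fix v assume "v \<in> K \<times> (UNIV :: bool set)"
    then obtain w b where w: "v = (w, b)" "w \<in> K" by blast
    show "((x, True), v) \<in> ?R\<^sup>*"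
    proof (cases "w = x")
      case False
      have "((x, b \<noteq> \<sigma> {x, w}), (w, (b \<noteq> \<sigma> {x, w}) \<noteq> \<sigma> {x, w})) \<in> ?R" by (rule step) (use w xyz False in auto)
      moreover have "((b \<noteq> \<sigma> {x, w}) \<noteq> \<sigma> {x, w}) = b" by auto
      ultimately show ?thesis using root[of "b \<noteq> \<sigma> {x, w}"] w by (simp add: rtrancl.rtrancl_into_rtrancl)
    qed (use root w in simp)
  qed (use xyz in simp)
qed

text \<open>The vertices \<open>v0\<close> and \<open>v2\<close> are joined by the path through
  \<open>v1\<close>, the path through \<open>d\<close> and the long way round the hexagon.\<close>
lemma planar_no_hexagon_with_apex:
  assumes G: "planar G" "simple_graph G"
    and hex: "{v0, v1} \<in> snd G" "{v1, v2} \<in> snd G" "{v2, v3} \<in> snd G" "{v3, v4} \<in> snd G" "{v4, v5} \<in> snd G" "{v5, v0} \<in> snd G"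
    and d: "{d, v0} \<in> snd G" "{d, v2} \<in> snd G"
    and dist: "distinct [v0, v1, v2, v3, v4, v5, d]"
    and W: "W \<subseteq> fst G" "W \<inter> {v0, v1, v2, v3, v4, v5, d} = {}" "connected_in G W"
    and touch: "touches G W v1" "touches G W v4" "touches G W d"
  shows False
  by (rule planar_no_theta_with_apex[OF G, of v0 "[v1]" v2 "[d]" "[v5, v4, v3]" W])
    (use assms in \<open>auto simp: insert_commute\<close>)

text \<open>Without odd triangle, one lifted copy of \<open>K\<close> is a
  \<open>K\<^sub>4\<close> with apex \<open>W\<close>. With an odd triangle, its preimage is a
  hexagon. A lift of the fourth vertex is adjacent to one vertex of each of the three antipodal
  pairs of the hexagon; two of these three vertices are at distance 2, and the hexagon with this
  lift is excluded.\<close>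
lemma four_clique_no_apex:
  assumes C: "planar (double_cover G \<sigma>)" and G: "simple_graph G"
    and K: "clique_in G K" "card K = 4"
    and W: "W \<subseteq> fst (double_cover G \<sigma>)" "W \<inter> (K \<times> UNIV) = {}" "connected_in (double_cover G \<sigma>) W"
    and touch: "\<And>v. v \<in> K \<times> UNIV \<Longrightarrow> touches (double_cover G \<sigma>) W v"
  shows False
proof (cases "odd_triangle \<sigma> K")
  case False
  then obtain s where s: "balanced \<sigma> K s" by (rule balanced_if_no_odd_triangle)
  have "card ((\<lambda>x. (x, s x)) ` K) = 4"
    using K(2) by (subst card_image) (auto simp: inj_on_def)
  moreover have "(\<lambda>x. (x, s x)) ` K \<subseteq> K \<times> UNIV" by blast
  ultimately show False
    using planar_no_clique_with_apex[OF C simple_graph_double_cover[OF G] clique_lift[OF K(1) s] _ W(1) _ W(3)]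
      W(2) touch by blast
next
  case True
  then obtain a b c where abc: "a \<in> K" "b \<in> K" "c \<in> K" "a \<noteq> b" "b \<noteq> c" "c \<noteq> a"
    and odd: "\<sigma> {a, b} \<noteq> (\<sigma> {b, c} \<noteq> \<sigma> {c, a})"
    unfolding odd_triangle_def by blast
  have "finite K" using K(2) by (metis card.infinite zero_neq_numeral)
  then have "card (K - {a, b, c}) = 1" using K(2) abc by (simp add: card_Diff_subset)
  then obtain d where "K - {a, b, c} = {d}" by (auto simp: card_1_singleton_iff)
  then have d: "d \<in> K" "d \<noteq> a" "d \<noteq> b" "d \<noteq> c" by auto
  let ?C = "double_cover G \<sigma>"
  define A where "A i = (a, i)" for i :: bool
  define B where "B i = (b, i \<noteq> \<sigma> {a, b})" for i
  define D where "D i = (c, (i \<noteq> \<sigma> {a, b}) \<noteq> \<sigma> {b, c})" for i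
  define d0 where "d0 = (d, True)"
  have E: "{x, y} \<in> snd G" if "x \<in> K" "y \<in> K" "x \<noteq> y" for x y
    using K(1) that by (simp add: clique_in_def)
  have AB: "{A i, B i} \<in> snd ?C" for i
    unfolding A_def B_def by (rule double_cover_edge[OF E]) (use abc in auto)
  have BD: "{B i, D i} \<in> snd ?C" for i
    unfolding B_def D_def by (rule double_cover_edge[OF E]) (use abc in auto)
  have DA: "{D i, A (\<not> i)} \<in> snd ?C" for i
    unfolding A_def D_def by (rule double_cover_edge[OF E]) (use abc odd in auto)
  obtain p where p: "{d0, A p} \<in> snd ?C"
    unfolding A_def d0_def using double_cover_edge[OF E[OF d(1) abc(1) d(2)]] by blast
  obtain q where q: "{d0, B q} \<in> snd ?C"
  proof -
    have "{d0, B (\<not> \<sigma> {d, b} \<noteq> \<sigma> {a, b})} \<in> snd ?C"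
      unfolding B_def d0_def by (rule double_cover_edge[OF E]) (use abc d in auto)
    then show ?thesis using that by blast
  qed
  obtain r where r: "{d0, D r} \<in> snd ?C"
  proof -
    have "{d0, D ((\<not> \<sigma> {d, c} \<noteq> \<sigma> {b, c}) \<noteq> \<sigma> {a, b})} \<in> snd ?C"
      unfolding D_def d0_def by (rule double_cover_edge[OF E]) (use abc d in auto)
    then show ?thesis using that by blast
  qed
  have neq: "A i \<noteq> B j" "A i \<noteq> D j" "B i \<noteq> D j" "A i \<noteq> d0" "B i \<noteq> d0" "D i \<noteq> d0"
    "B i \<noteq> A j" "D i \<noteq> A j" "D i \<noteq> B j"
    "A i = A j \<longleftrightarrow> i = j" "B i = B j \<longleftrightarrow> i = j" "D i = D j \<longleftrightarrow> i = j" for i j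
    using abc d by (auto simp: A_def B_def D_def d0_def)
  have off: "A i \<in> K \<times> UNIV" "B i \<in> K \<times> UNIV" "D i \<in> K \<times> UNIV" "d0 \<in> K \<times> UNIV" for i
    using abc d by (auto simp: A_def B_def D_def d0_def)
  note hexagon = planar_no_hexagon_with_apex[OF C simple_graph_double_cover[OF G], where W = W and d = d0]
  have W': "W \<inter> {u0, u1, u2, u3, u4, u5, d0} = {}" if "{u0, u1, u2, u3, u4, u5} \<subseteq> K \<times> UNIV" for u0 u1 u2 u3 u4 u5
    using W(2) off(4) that by blast
  have more: "{B i, A i} \<in> snd ?C" "{D i, B i} \<in> snd ?C" "{A (\<not> i), D i} \<in> snd ?C"
    "{A i, D (\<not> i)} \<in> snd ?C" "{D (\<not> i), A i} \<in> snd ?C" for i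
    using AB[of i] BD[of i] DA[of i] DA[of "\<not> i"] by (simp_all add: insert_commute)
  note edges = AB BD DA more
  consider "q = (\<not> p)" | "r = (\<not> q)" | "p = q" "q = r" by blast
  then show False
  proof cases
    case 1
    show False
      by (rule hexagon[of "A p" "D (\<not> p)" "B (\<not> p)" "A (\<not> p)" "D p" "B p", OF _ _ _ _ _ _ _ _ _ W(1) W' W(3)])
        (use edges p q 1 neq off touch in simp_all)
  next
    case 2
    show False
      by (rule hexagon[of "B q" "A q" "D (\<not> q)" "B (\<not> q)" "A (\<not> q)" "D q", OF _ _ _ _ _ _ _ _ _ W(1) W' W(3)])
        (use edges q r 2 neq off touch in simp_all)
  next
    case 3
    show False
      by (rule hexagon[of "A p" "B p" "D p" "A (\<not> p)" "B (\<not> p)" "D (\<not> p)", OF _ _ _ _ _ _ _ _ _ W(1) W' W(3)])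
        (use edges p r 3 neq off touch in simp_all)
  qed
qed

text \<open>An odd triangle in \<open>L\<close> makes the whole preimage of \<open>L\<close>
  connected, and it touches the whole preimage of \<open>K\<close>.\<close>
lemma clique_beside_odd_clique:
  assumes C: "planar (double_cover G \<sigma>)" and G: "simple_graph G"
    and K: "clique_in G K" "card K = 4" and L: "clique_in G L" "K \<inter> L = {}"
    and adj: "\<And>x. x \<in> K \<Longrightarrow> \<exists>y \<in> L. {x, y} \<in> snd G"
  shows "\<not> odd_triangle \<sigma> L"
proof
  assume odd: "odd_triangle \<sigma> L"
  show False
  proof (rule four_clique_no_apex[OF C G K, of "L \<times> UNIV"])
    show "L \<times> UNIV \<subseteq> fst (double_cover G \<sigma>)"
      using L(1) by (auto simp: clique_in_def double_cover_vertices)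
    show "connected_in (double_cover G \<sigma>) (L \<times> UNIV)" by (rule odd_triangle_cover_connected[OF L(1) odd])
    fix v assume "v \<in> K \<times> (UNIV :: bool set)"
    then obtain x b where v: "v = (x, b)" "x \<in> K" by blast
    obtain y where y: "y \<in> L" "{x, y} \<in> snd G" using adj v by blast
    show "touches (double_cover G \<sigma>) (L \<times> UNIV) v"
      unfolding touches_def v(1) using y double_cover_edge[OF y(2) refl]
      by (intro bexI[of _ "(y, b \<noteq> \<sigma> {x, y})"]) auto
  qed (use L in auto)
qed

definition projective :: "'v graph \<Rightarrow> bool" where
  "projective G \<longleftrightarrow> embeds_in G (top_of_set projective_plane)"

lemma projective_double_cover:
  assumes "projective G" "simple_graph G"
  obtains \<sigma> where "planar (double_cover G \<sigma>)"
  using projective_lifts_to_double_cover assms unfolding projective_def planar_def by blast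

text \<open>Five of the vertices contain an odd triangle, and the four vertices outside this
  triangle form a clique beside it.\<close>
lemma projective_no_seven_clique:
  assumes G: "projective G" "simple_graph G" and K: "clique_in G K" "card K = 7"
  shows False
proof -
  obtain \<sigma> where C: "planar (double_cover G \<sigma>)" using projective_double_cover[OF G] .
  have fin: "finite K" using K(2) by (metis card.infinite zero_neq_numeral)
  have "5 \<le> card K" using K(2) by simp
  then obtain L where L: "L \<subseteq> K" "card L = 5" by (rule obtain_subset_with_card_n)
  have "odd_triangle \<sigma> L" by (rule five_clique_odd_triangle[OF C G(2) clique_in_subset[OF K(1) L(1)] L(2)])
  then obtain x y z where xyz: "x \<in> K" "y \<in> K" "z \<in> K" "x \<noteq> y" "y \<noteq> z" "z \<noteq> x"
    and odd: "odd_triangle \<sigma> {x, y, z}"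
    using L(1) unfolding odd_triangle_def by blast
  have "card (K - {x, y, z}) = 4" using K(2) fin xyz by (simp add: card_Diff_subset)
  moreover have "clique_in G (K - {x, y, z})" "clique_in G {x, y, z}"
    using clique_in_subset[OF K(1)] xyz by auto
  moreover have "\<exists>v \<in> {x, y, z}. {u, v} \<in> snd G" if "u \<in> K - {x, y, z}" for u
    using K(1) that xyz by (auto simp: clique_in_def)
  ultimately show False
    using clique_beside_odd_clique[OF C G(2), of "K - {x, y, z}" "{x, y, z}"] odd by blast
qed

lemma projective_no_clique_beside_five_clique:
  assumes G: "projective G" "simple_graph G" and K: "clique_in G K" "card K = 4"
    and L: "clique_in G L" "card L = 5" "K \<inter> L = {}"
    and adj: "\<And>x. x \<in> K \<Longrightarrow> \<exists>y \<in> L. {x, y} \<in> snd G"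
  shows False
proof -
  obtain \<sigma> where C: "planar (double_cover G \<sigma>)" using projective_double_cover[OF G] .
  show False
    using clique_beside_odd_clique[OF C G(2) K L(1,3) adj] five_clique_odd_triangle[OF C G(2) L(1,2)] by blast
qed

text \<open>By \<open>clique_beside_odd_clique\<close> neither clique has an odd triangle, so the
  preimage of each consists of two copies. Consider one copy of \<open>K\<close> and its matching
  edges. If they all lead to the same copy of \<open>f ` K\<close>, that copy is an apex.
  Otherwise the matching edges of the second copy of \<open>K\<close> also reach both copies of
  \<open>f ` K\<close>, and these three cliques together are a connected apex.\<close>
lemma projective_no_joined_four_cliques:
  assumes G: "projective G" "simple_graph G" and K: "clique_in G K" "card K = 4"
    and f: "inj_on f K" "clique_in G (f ` K)" "K \<inter> f ` K = {}"
    and adj: "\<And>x. x \<in> K \<Longrightarrow> {x, f x} \<in> snd G"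
  shows False
proof -
  obtain \<sigma> where C: "planar (double_cover G \<sigma>)" using projective_double_cover[OF G] .
  let ?C = "double_cover G \<sigma>"
  have fK: "card (f ` K) = 4" using card_image[OF f(1)] K(2) by simp
  have "\<not> odd_triangle \<sigma> (f ` K)"
    by (rule clique_beside_odd_clique[OF C G(2) K f(2,3)]) (use adj in blast)
  then obtain t where t: "balanced \<sigma> (f ` K) t" by (rule balanced_if_no_odd_triangle)
  have "\<not> odd_triangle \<sigma> K"
  proof (rule clique_beside_odd_clique[OF C G(2) f(2) fK K(1)])
    fix y assume "y \<in> f ` K"
    then obtain x where x: "x \<in> K" "y = f x" by blast
    then have "{y, x} \<in> snd G" using adj[OF x(1)] by (simp add: insert_commute)
    then show "\<exists>x \<in> K. {y, x} \<in> snd G" using x(1) by blast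
  qed (use f(3) in blast)
  then obtain s where s: "balanced \<sigma> K s" by (rule balanced_if_no_odd_triangle)
  \<comment> \<open>The copy of f ` K that the vertex (x, s x) is joined to.\<close>
  define m where "m x = (t (f x) \<noteq> (s x \<noteq> \<sigma> {x, f x}))" for x
  define Kp where "Kp = (\<lambda>x. (x, s x)) ` K"
  have flip: "balanced \<sigma> M (\<lambda>x. s x \<noteq> b)" if "balanced \<sigma> M s" for M s b
    unfolding balanced_def
  proof (intro ballI impI)
    fix x y assume "x \<in> M" "y \<in> M" "x \<noteq> y"
    then have "s y = (s x \<noteq> \<sigma> {x, y})" using that unfolding balanced_def by blast
    then show "(s y \<noteq> b) = ((s x \<noteq> b) \<noteq> \<sigma> {x, y})" by (simp only:) blast
  qed
  have Kp: "clique_in ?C Kp" "card Kp = 4"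
    unfolding Kp_def by (rule clique_lift[OF K(1) s]) (simp add: card_image inj_on_def K(2))
  have edge: "{(x, s x \<noteq> b), (f x, t (f x) \<noteq> (m x \<noteq> b))} \<in> snd ?C" if "x \<in> K" for x b
    by (rule double_cover_edge[OF adj[OF that]]) (auto simp: m_def)
  have fc: "clique_in ?C ((\<lambda>y. (y, t y \<noteq> b)) ` f ` K)" for b
    by (rule clique_lift[OF f(2) flip[OF t]])
  note apex = planar_no_clique_with_apex[OF C simple_graph_double_cover[OF G(2)] Kp]
  show False
  proof (cases "\<exists>b. \<forall>x \<in> K. m x = b")
    case True
    then obtain b where b: "\<And>x. x \<in> K \<Longrightarrow> m x = b" by blast
    let ?W = "(\<lambda>y. (y, t y \<noteq> b)) ` f ` K"
    show False
    proof (rule apex[of ?W])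
      show "?W \<subseteq> fst ?C" using fc[of b] by (simp add: clique_in_def)
      show "connected_in ?C ?W" by (rule connected_in_clique[OF fc])
      show "?W \<inter> Kp = {}" using f(3) by (auto simp: Kp_def)
      show "touches ?C ?W v" if v: "v \<in> Kp" for v
      proof -
        obtain x where x: "x \<in> K" "v = (x, s x)" using v by (auto simp: Kp_def)
        show ?thesis unfolding touches_def
          using edge[OF x(1), of False] b[OF x(1)] x by (intro bexI[of _ "(f x, t (f x) \<noteq> b)"]) auto
      qed
    qed
  next
    case False
    then obtain x1 x0 where x: "x1 \<in> K" "m x1" "x0 \<in> K" "\<not> m x0" by blast
    let ?W = "(\<lambda>x. (x, s x \<noteq> True)) ` K \<union> (f ` K) \<times> UNIV"
    let ?R = "{(u, v). u \<in> ?W \<and> v \<in> ?W \<and> {u, v} \<in> snd ?C}"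
    have within: "(u, v) \<in> ?R\<^sup>*" if "clique_in ?C M" "M \<subseteq> ?W" "u \<in> M" "v \<in> M" for M u v
    proof (cases "u = v")
      case False
      then have "(u, v) \<in> ?R" using that unfolding clique_in_def by blast
      then show ?thesis by (rule r_into_rtrancl)
    qed simp
    have Km: "clique_in ?C ((\<lambda>x. (x, s x \<noteq> True)) ` K)" by (rule clique_lift[OF K(1) flip[OF s]])
    have down: "((x1, s x1 \<noteq> True), (y, t y \<noteq> b)) \<in> ?R\<^sup>*" if y: "y \<in> f ` K" for y b
    proof -
      obtain z where z: "z \<in> K" "(m z \<noteq> True) = b" using x by (cases b) auto
      have "((x1, s x1 \<noteq> True), (z, s z \<noteq> True)) \<in> ?R\<^sup>*"
        by (rule within[OF Km]) (use x z in auto)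
      also have "((z, s z \<noteq> True), (f z, t (f z) \<noteq> b)) \<in> ?R"
        using edge[OF z(1), of True] z by auto
      also have "((f z, t (f z) \<noteq> b), (y, t y \<noteq> b)) \<in> ?R\<^sup>*"
        by (rule within[OF fc[of b]]) (use y z in auto)
      finally show ?thesis .
    qed
    show False
    proof (rule apex[of ?W])
      show "?W \<subseteq> fst ?C" using K(1) f(2) by (auto simp: clique_in_def double_cover_vertices)
      show "connected_in ?C ?W"
      proof (rule connected_in_root[of "(x1, s x1 \<noteq> True)"])
        fix v assume "v \<in> ?W"
        then consider z where "z \<in> K" "v = (z, s z \<noteq> True)" | y c where "y \<in> f ` K" "v = (y, c)" by blast
        then show "((x1, s x1 \<noteq> True), v) \<in> ?R\<^sup>*"
        proof cases
          case 1
          then show ?thesis by (intro within[OF Km]) (use x in auto)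
        next
          case 2
          have "(t y \<noteq> (t y \<noteq> c)) = c" by auto
          then show ?thesis using down[OF 2(1), of "t y \<noteq> c"] 2(2) by simp
        qed
      qed (use x in auto)
      show "?W \<inter> Kp = {}" using f(3) by (auto simp: Kp_def)
      show "touches ?C ?W v" if v: "v \<in> Kp" for v
      proof -
        obtain x where x: "x \<in> K" "v = (x, s x)" using v by (auto simp: Kp_def)
        show ?thesis unfolding touches_def
          using edge[OF x(1), of False] x by (intro bexI[of _ "(f x, t (f x) \<noteq> m x)"]) auto
      qed
    qed
  qed
qed

section \<open>Straight-line drawings in homogeneous coordinates\<close>

text \<open>The open cones spanned by \<open>a\<close>, \<open>b\<close> and by \<open>c\<close>,
  \<open>d\<close> are disjoint.\<close>
definition apart :: "'a::real_vector \<Rightarrow> 'a \<Rightarrow> 'a \<Rightarrow> 'a \<Rightarrow> bool" where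
  "apart a b c d \<longleftrightarrow>
     (\<forall>s t s' t'. s > 0 \<and> t > 0 \<and> s' > 0 \<and> t' > 0 \<longrightarrow> s *\<^sub>R a + t *\<^sub>R b \<noteq> s' *\<^sub>R c + t' *\<^sub>R d)"

text \<open>The vector \<open>w\<close> is the normal of a plane that separates the two cones.\<close>
lemma apartI:
  fixes w :: "'a::real_inner"
  assumes "w \<bullet> a \<ge> 0" "w \<bullet> b \<ge> 0" "w \<bullet> c \<le> 0" "w \<bullet> d \<le> 0"
    and "w \<bullet> a > 0 \<or> w \<bullet> b > 0 \<or> w \<bullet> c < 0 \<or> w \<bullet> d < 0"
  shows "apart a b c d"
  unfolding apart_def
proof (intro allI impI notI)
  fix s t s' t' :: real
  assume pos: "s > 0 \<and> t > 0 \<and> s' > 0 \<and> t' > 0" and eq: "s *\<^sub>R a + t *\<^sub>R b = s' *\<^sub>R c + t' *\<^sub>R d"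
  have sum: "s * (w \<bullet> a) + t * (w \<bullet> b) = s' * (w \<bullet> c) + t' * (w \<bullet> d)"
    using arg_cong[OF eq, of "inner w"] by (simp add: inner_add_right)
  have "s * (w \<bullet> a) \<ge> 0" "t * (w \<bullet> b) \<ge> 0" "s' * (w \<bullet> c) \<le> 0" "t' * (w \<bullet> d) \<le> 0"
    using pos assms(1-4) by (auto intro: mult_nonneg_nonneg mult_nonneg_nonpos)
  moreover from this have "s * (w \<bullet> a) = 0" "t * (w \<bullet> b) = 0" "s' * (w \<bullet> c) = 0" "t' * (w \<bullet> d) = 0"
    using sum by linarith+
  ultimately show False using pos assms(5) by auto
qed

text \<open>The surface is a quotient \<open>\<kappa>\<close> of the nonzero vectors by scaling.
  The edge \<open>e\<close> is drawn as the image of the segment from \<open>a e\<close> to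
  \<open>b e\<close>, and images of segments are disjoint if the open cones over them are, up to
  sign.\<close>
lemma straight_line_embedding:
  fixes \<kappa> :: "'a::real_normed_vector \<Rightarrow> 'b"
  assumes cont: "continuous_map (top_of_set (- {0})) U \<kappa>"
    and dir: "\<And>x y. x \<noteq> 0 \<Longrightarrow> y \<noteq> 0 \<Longrightarrow> \<kappa> x = \<kappa> y \<Longrightarrow> \<exists>c. c \<noteq> 0 \<and> y = c *\<^sub>R x"
    and vert: "\<And>u v. u \<in> V \<Longrightarrow> v \<in> V \<Longrightarrow> u \<noteq> v \<Longrightarrow> \<forall>c. f v \<noteq> c *\<^sub>R f u" "\<And>v. v \<in> V \<Longrightarrow> f v \<noteq> 0"
    and ends: "\<And>e. e \<in> E \<Longrightarrow> {\<kappa> (a e), \<kappa> (b e)} = \<kappa> ` f ` e"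
    and indep: "\<And>e s t. e \<in> E \<Longrightarrow> s *\<^sub>R a e + t *\<^sub>R b e = 0 \<Longrightarrow> s = 0 \<and> t = 0"
    and off: "\<And>e v. e \<in> E \<Longrightarrow> v \<in> V \<Longrightarrow> v \<notin> e \<Longrightarrow> apart (a e) (b e) (f v) (f v) \<and> apart (a e) (b e) (- f v) (- f v)"
    and on: "\<And>e v. e \<in> E \<Longrightarrow> v \<in> e \<Longrightarrow> \<exists>c. c \<noteq> 0 \<and> (f v = c *\<^sub>R a e \<or> f v = c *\<^sub>R b e)"
    and disj: "\<And>e e'. e \<in> E \<Longrightarrow> e' \<in> E \<Longrightarrow> e \<noteq> e' \<Longrightarrow>
        apart (a e) (b e) (a e') (b e') \<and> apart (a e) (b e) (- a e') (- b e')"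
  shows "embeds_in (V, E) U"
proof -
  define pt where "pt e t = (1 - t) *\<^sub>R a e + t *\<^sub>R b e" for e and t :: real
  have nz: "pt e t \<noteq> 0" if "e \<in> E" for e t
    using indep[OF that, of "1 - t" t] by (auto simp: pt_def)
  have coord: "s = s' \<and> t = t'" if "e \<in> E" "s *\<^sub>R a e + t *\<^sub>R b e = s' *\<^sub>R a e + t' *\<^sub>R b e" for e s t s' t'
  proof -
    have "(s - s') *\<^sub>R a e + (t - t') *\<^sub>R b e = 0" using that(2) by (simp add: algebra_simps)
    then show ?thesis using indep[OF that(1)] by fastforce
  qed
  have conv: "c *\<^sub>R pt e t = (c * (1 - t)) *\<^sub>R a e + (c * t) *\<^sub>R b e" for c e t
    by (simp add: pt_def scaleR_add_right)
  have same: "s = t" if e: "e \<in> E" and eq: "\<kappa> (pt e s) = \<kappa> (pt e t)" for e s t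
  proof -
    obtain c where "pt e t = c *\<^sub>R pt e s" using dir[OF nz[OF e] nz[OF e] eq] by blast
    then have "(1 - t) *\<^sub>R a e + t *\<^sub>R b e = (c * (1 - s)) *\<^sub>R a e + (c * s) *\<^sub>R b e"
      unfolding conv by (simp add: pt_def)
    then have "1 - t = c * (1 - s)" "t = c * s" using coord[OF e] by blast+
    moreover from this have "c = 1" by (simp add: algebra_simps)
    ultimately show ?thesis by simp
  qed
  have sep: False
    if e: "e \<in> E" "t \<in> {0<..<1}" and y: "y = s' *\<^sub>R c + t' *\<^sub>R d" "s' > 0" "t' > 0" "y \<noteq> 0" and \<kappa>: "\<kappa> (pt e t) = \<kappa> y"
      and ap: "apart (a e) (b e) c d \<and> apart (a e) (b e) (- c) (- d)" for e t y c d s' t'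
  proof -
    obtain r where r: "r \<noteq> 0" "pt e t = r *\<^sub>R y" using dir[OF y(4) nz[OF e(1)] \<kappa>[symmetric]] by blast
    have t: "1 - t > 0" "t > 0" using e(2) by auto
    show False
    proof (cases "r > 0")
      case True
      have "(1 - t) *\<^sub>R a e + t *\<^sub>R b e = (r * s') *\<^sub>R c + (r * t') *\<^sub>R d"
        using r(2) unfolding pt_def y(1) by (simp add: scaleR_add_right)
      then show False using ap t y(2,3) True unfolding apart_def by (metis mult_pos_pos)
    next
      case False
      then have "- r > 0" using r(1) by simp
      moreover have "(1 - t) *\<^sub>R a e + t *\<^sub>R b e = (- r * s') *\<^sub>R (- c) + (- r * t') *\<^sub>R (- d)"
        using r(2) unfolding pt_def y(1) by (simp add: scaleR_add_right)
      ultimately show False using ap t y(2,3) unfolding apart_def by (metis mult_pos_pos)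
    qed
  qed
  show ?thesis
    unfolding embeds_in_def fst_conv snd_conv
  proof (intro exI[of _ "\<lambda>v. \<kappa> (f v)"] exI[of _ "\<lambda>e t. \<kappa> (pt e t)"] conjI ballI impI)
    show "inj_on (\<lambda>v. \<kappa> (f v)) V"
      by (rule inj_onI) (use dir vert in blast)
    show "(\<lambda>v. \<kappa> (f v)) ` V \<subseteq> topspace U"
      using cont vert(2) by (auto simp: continuous_map_def)
    fix e assume e: "e \<in> E"
    have "continuous_map (top_of_set {0..1}) (top_of_set (- {0})) (pt e)"
      using nz[OF e] by (auto simp: pt_def intro!: continuous_intros)
    from continuous_map_compose[OF this cont]
    show "pathin U (\<lambda>t. \<kappa> (pt e t))" by (simp add: pathin_def o_def)
    show "inj_on (\<lambda>t. \<kappa> (pt e t)) {0..1}" by (rule inj_onI) (rule same[OF e])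
    show "{\<kappa> (pt e 0), \<kappa> (pt e 1)} = (\<lambda>v. \<kappa> (f v)) ` e"
      using ends[OF e] by (simp add: pt_def image_image)
    show "(\<lambda>t. \<kappa> (pt e t)) ` {0<..<1} \<inter> (\<lambda>v. \<kappa> (f v)) ` V = {}"
    proof (rule ccontr)
      assume "\<not> ?thesis"
      then obtain t v where t: "t \<in> {0<..<1}" "v \<in> V" "\<kappa> (pt e t) = \<kappa> (f v)" by blast
      show False
      proof (cases "v \<in> e")
        case True
        then obtain c where "c \<noteq> 0" "f v = c *\<^sub>R a e \<or> f v = c *\<^sub>R b e" using on[OF e] by blast
        moreover obtain r where "pt e t = r *\<^sub>R f v" using dir[OF vert(2)[OF t(2)] nz[OF e] t(3)[symmetric]] by blast
        ultimately have "(1 - t) *\<^sub>R a e + t *\<^sub>R b e = (r * c) *\<^sub>R a e + 0 *\<^sub>R b e \<or>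
            (1 - t) *\<^sub>R a e + t *\<^sub>R b e = 0 *\<^sub>R a e + (r * c) *\<^sub>R b e"
          by (auto simp: pt_def)
        then have "t = 0 \<or> 1 - t = 0" using coord[OF e] by blast
        then show False using t(1) by auto
      next
        case False
        have "f v = (1/2) *\<^sub>R f v + (1/2) *\<^sub>R f v" by (simp flip: scaleR_add_left)
        then show False
          by (rule sep[OF e t(1) _ _ _ vert(2)[OF t(2)] t(3) off[OF e t(2) False]]) auto
      qed
    qed
    fix e' assume e': "e' \<in> E" "e \<noteq> e'"
    show "(\<lambda>t. \<kappa> (pt e t)) ` {0<..<1} \<inter> (\<lambda>t. \<kappa> (pt e' t)) ` {0<..<1} = {}"
    proof (rule ccontr)
      assume "\<not> ?thesis"
      then obtain t t' where t: "t \<in> {0<..<1}" "t' \<in> {0<..<1}" "\<kappa> (pt e t) = \<kappa> (pt e' t')" by blast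
      show False
        by (rule sep[OF e t(1) pt_def _ _ nz[OF e'(1)] t(3) disj[OF e e']]) (use t(2) in auto)
    qed
  qed
qed

type_synonym ivec = "int \<times> int \<times> int"

definition real_vec :: "ivec \<Rightarrow> real ^ 3" where
  "real_vec v = (case v of (x, y, z) \<Rightarrow> vector [of_int x, of_int y, of_int z])"

fun ineg :: "ivec \<Rightarrow> ivec" where "ineg (x, y, z) = (- x, - y, - z)"

fun idot :: "ivec \<Rightarrow> ivec \<Rightarrow> int" where
  "idot (x, y, z) (x', y', z') = x * x' + y * y' + z * z'"

fun icross :: "ivec \<Rightarrow> ivec \<Rightarrow> ivec" where
  "icross (x, y, z) (x', y', z') = (y * z' - z * y', z * x' - x * z', x * y' - y * x')"

text \<open>An integer form of the hypotheses of \<open>apartI\<close>, for symbolic evaluation: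
  conditionals and \<open>let\<close> compute each inner product at most once and stop at the
  first violated inequality.\<close>
definition witness :: "ivec \<Rightarrow> ivec \<Rightarrow> ivec \<Rightarrow> ivec \<Rightarrow> ivec \<Rightarrow> bool" where
  "witness a b c d w =
     (let p = idot w a in if p < 0 then False else
      let q = idot w b in if q < 0 then False else
      let r = idot w c in if r > 0 then False else
      let s = idot w d in if s > 0 then False else
      if p > 0 then True else if q > 0 then True else if r < 0 then True else s < 0)"

fun some_witness :: "ivec \<Rightarrow> ivec \<Rightarrow> ivec \<Rightarrow> ivec \<Rightarrow> ivec list \<Rightarrow> bool" where
  "some_witness a b c d [] = False"
| "some_witness a b c d (w # ws) =
     (if witness a b c d w then True else if witness a b c d (ineg w) then True
      else some_witness a b c d ws)"

text \<open>The planes tried are those spanned by two of the four vectors.\<close>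
definition separable :: "ivec \<Rightarrow> ivec \<Rightarrow> ivec \<Rightarrow> ivec \<Rightarrow> bool" where
  "separable a b c d =
     some_witness a b c d [icross a b, icross c d, icross a c, icross a d, icross b c, icross b d]"

definition separable_both :: "ivec \<Rightarrow> ivec \<Rightarrow> ivec \<Rightarrow> ivec \<Rightarrow> bool" where
  "separable_both a b c d = (if separable a b c d then separable a b (ineg c) (ineg d) else False)"

text \<open>The vertices are integer vectors in homogeneous coordinates. An entry \<open>(i, j,
  s)\<close> is an edge along the segment from vector \<open>i\<close> to vector \<open>j\<close>
  or, if \<open>s\<close> holds, to the negative of vector \<open>j\<close>. In the projective
  plane these are the two segments of a line that have the same ends; on the sphere only \<open>s
  = False\<close> leads to vertex \<open>j\<close>.\<close>
type_synonym drawing = "ivec list \<times> (nat \<times> nat \<times> bool) list"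

definition drawn_graph :: "drawing \<Rightarrow> nat graph" where
  "drawn_graph D = ({..<length (fst D)}, (\<lambda>(i, j, s). {i, j}) ` set (snd D))"

definition tail_vec :: "drawing \<Rightarrow> nat \<times> nat \<times> bool \<Rightarrow> ivec" where
  "tail_vec D e = (case e of (i, j, s) \<Rightarrow> fst D ! i)"

definition head_vec :: "drawing \<Rightarrow> nat \<times> nat \<times> bool \<Rightarrow> ivec" where
  "head_vec D e = (case e of (i, j, s) \<Rightarrow> if s then ineg (fst D ! j) else fst D ! j)"

definition valid_drawing :: "drawing \<Rightarrow> bool" where
  "valid_drawing D \<longleftrightarrow>
     (\<forall>(i, j, s) \<in> set (snd D). i < j \<and> j < length (fst D)) \<and>
     (0, 0, 0) \<notin> set (fst D) \<and> sorted_wrt (\<lambda>v w. icross v w \<noteq> (0, 0, 0)) (fst D) \<and>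
     (\<forall>e \<in> set (snd D). \<forall>k \<in> set [0..<length (fst D)]. k = fst e \<or> k = fst (snd e) \<or>
        separable_both (tail_vec D e) (head_vec D e) (fst D ! k) (fst D ! k)) \<and>
     sorted_wrt (\<lambda>e e'. separable_both (tail_vec D e) (head_vec D e) (tail_vec D e') (head_vec D e')) (snd D)"

lemma real_vec_simps:
  "real_vec (ineg v) = - real_vec v" "real_vec w \<bullet> real_vec v = of_int (idot w v)"
  "real_vec (0, 0, 0) = 0"
  by (cases v; cases w; simp add: real_vec_def vec_eq_iff forall_3 inner_vec_def sum_3)+

lemma witness_apart: "witness a b c d w \<Longrightarrow> apart (real_vec a) (real_vec b) (real_vec c) (real_vec d)"
  by (rule apartI[of "real_vec w"]) (auto simp: witness_def real_vec_simps Let_def split: if_splits)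

lemma separable_apart:
  "separable a b c d \<Longrightarrow> apart (real_vec a) (real_vec b) (real_vec c) (real_vec d)"
proof -
  have "some_witness a b c d ws \<Longrightarrow> apart (real_vec a) (real_vec b) (real_vec c) (real_vec d)" for ws
    by (induction ws) (auto split: if_splits dest: witness_apart)
  then show "separable a b c d \<Longrightarrow> ?thesis" by (simp only: separable_def)
qed

lemma separable_both_apart:
  assumes "separable_both a b c d"
  shows "apart (real_vec a) (real_vec b) (real_vec c) (real_vec d) \<and>
    apart (real_vec a) (real_vec b) (- real_vec c) (- real_vec d)"
  using assms separable_apart[of a b c d] separable_apart[of a b "ineg c" "ineg d"]
  by (simp add: separable_both_def real_vec_simps split: if_splits)

lemma apart_swap: "apart a b c d \<Longrightarrow> apart c d a b"
  unfolding apart_def by metis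

lemma apart_minus: "apart a b (- c) (- d) \<Longrightarrow> apart c d (- a) (- b)"
  unfolding apart_def
proof (intro allI impI notI)
  fix s t s' t' :: real
  assume *: "\<forall>s t s' t'. s > 0 \<and> t > 0 \<and> s' > 0 \<and> t' > 0 \<longrightarrow> s *\<^sub>R a + t *\<^sub>R b \<noteq> s' *\<^sub>R - c + t' *\<^sub>R - d"
    and pos: "s > 0 \<and> t > 0 \<and> s' > 0 \<and> t' > 0" and eq: "s *\<^sub>R c + t *\<^sub>R d = s' *\<^sub>R - a + t' *\<^sub>R - b"
  have "s' *\<^sub>R a + t' *\<^sub>R b = - (s *\<^sub>R c + t *\<^sub>R d)" using eq by simp
  also have "\<dots> = s *\<^sub>R - c + t *\<^sub>R - d" by simp
  finally show False using * pos by blast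
qed

lemma icross_independent:
  assumes "icross v w \<noteq> (0, 0, 0)" and "s *\<^sub>R real_vec v + t *\<^sub>R real_vec w = 0"
  shows "s = 0 \<and> t = 0"
proof -
  obtain x y z where v: "v = (x, y, z)" by (cases v)
  obtain x' y' z' where w: "w = (x', y', z')" by (cases w)
  have eqs: "s * x + t * x' = 0" "s * y + t * y' = 0" "s * z + t * z' = 0"
    using assms(2) by (auto simp: v w real_vec_def vec_eq_iff forall_3)
  have nz: "real_of_int (y * z' - z * y') \<noteq> 0 \<or> real_of_int (z * x' - x * z') \<noteq> 0 \<or> real_of_int (x * y' - y * x') \<noteq> 0"
    using assms(1) unfolding of_int_eq_0_iff by (auto simp: v w)
  have "s * (y * z' - z * y') = (s * y + t * y') * z' - (s * z + t * z') * y'"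
    "s * (z * x' - x * z') = (s * z + t * z') * x' - (s * x + t * x') * z'"
    "s * (x * y' - y * x') = (s * x + t * x') * y' - (s * y + t * y') * x'"
    "t * (y * z' - z * y') = (s * z + t * z') * y - (s * y + t * y') * z"
    "t * (z * x' - x * z') = (s * x + t * x') * z - (s * z + t * z') * x"
    "t * (x * y' - y * x') = (s * y + t * y') * x - (s * x + t * x') * y"
    by (simp_all add: algebra_simps)
  then have "s * real_of_int (y * z' - z * y') = 0" "s * real_of_int (z * x' - x * z') = 0"
    "s * real_of_int (x * y' - y * x') = 0" "t * real_of_int (y * z' - z * y') = 0"
    "t * real_of_int (z * x' - x * z') = 0" "t * real_of_int (x * y' - y * x') = 0"
    unfolding eqs by simp_all
  then show ?thesis using nz by auto
qed

lemma sorted_wrt_sym: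
  assumes "sorted_wrt P xs" "x \<in> set xs" "y \<in> set xs" "x \<noteq> y"
  shows "P x y \<or> P y x"
  using assms by (induction xs) auto

lemma valid_drawing_embeds:
  fixes \<kappa> :: "real ^ 3 \<Rightarrow> 'b"
  assumes D: "valid_drawing D"
    and cont: "continuous_map (top_of_set (- {0})) U \<kappa>"
    and dir: "\<And>x y. x \<noteq> 0 \<Longrightarrow> y \<noteq> 0 \<Longrightarrow> \<kappa> x = \<kappa> y \<Longrightarrow> \<exists>c. c \<noteq> 0 \<and> y = c *\<^sub>R x"
    and sign: "(\<forall>x. \<kappa> (- x) = \<kappa> x) \<or> (\<forall>(i, j, s) \<in> set (snd D). \<not> s)"
  shows "embeds_in (drawn_graph D) U"
proof -
  define f where "f i = real_vec (fst D ! i)" for i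
  define ent where "ent e = (SOME x. x \<in> set (snd D) \<and> e = (\<lambda>(i, j, s). {i, j}) x)" for e
  define a where "a e = real_vec (tail_vec D (ent e))" for e
  define b where "b e = real_vec (head_vec D (ent e))" for e
  let ?n = "length (fst D)" and ?E = "(\<lambda>(i, j, s). {i, j}) ` set (snd D)"
  have ent: "\<exists>i j s. ent e = (i, j, s) \<and> (i, j, s) \<in> set (snd D) \<and> e = {i, j} \<and> i < j \<and> j < ?n"
    if "e \<in> ?E" for e
  proof -
    have *: "ent e \<in> set (snd D) \<and> e = (\<lambda>(i, j, s). {i, j}) (ent e)"
      unfolding ent_def by (rule someI_ex) (use that in blast)
    obtain i j s where x: "ent e = (i, j, s)" by (cases "ent e") auto
    have "i < j \<and> j < ?n" using D * unfolding x valid_drawing_def by fast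
    then show ?thesis using * x by auto
  qed
  have ends: "\<exists>i j. e = {i, j} \<and> i < j \<and> j < ?n \<and> a e = f i \<and> (b e = f j \<or> b e = - f j \<and> (\<forall>x. \<kappa> (- x) = \<kappa> x)) \<and>
      ent e \<in> set (snd D) \<and> fst (ent e) = i \<and> fst (snd (ent e)) = j"
    if e: "e \<in> ?E" for e
  proof -
    obtain i j s where x: "ent e = (i, j, s)" "(i, j, s) \<in> set (snd D)" "e = {i, j}" "i < j" "j < ?n"
      using ent[OF e] by blast
    have "a e = f i" by (simp add: a_def f_def tail_vec_def x(1))
    moreover have "b e = (if s then - f j else f j)" by (simp add: b_def f_def head_vec_def x(1) real_vec_simps)
    moreover have "s \<longrightarrow> (\<forall>x. \<kappa> (- x) = \<kappa> x)" using sign x(2) by fast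
    ultimately show ?thesis using x by (intro exI[of _ i] exI[of _ j]) auto
  qed
  have cross: "icross (fst D ! i) (fst D ! j) \<noteq> (0, 0, 0)" if "i < j" "j < ?n" for i j
    using D that unfolding valid_drawing_def by (simp add: sorted_wrt_iff_nth_less)
  have indep: "s = 0 \<and> t = 0" if "i < j" "j < ?n" "s *\<^sub>R f i + t *\<^sub>R f j = 0" for i j s t
    using icross_independent[OF cross[OF that(1,2)]] that(3) by (simp add: f_def)
  have "embeds_in ({..<?n}, ?E) U"
  proof (rule straight_line_embedding[OF cont dir, where f = f and a = a and b = b])
    fix u v assume uv: "u \<in> {..<?n}" "v \<in> {..<?n}" "u \<noteq> v"
    show "\<forall>c. f v \<noteq> c *\<^sub>R f u"
    proof (intro allI notI)
      fix c assume eq: "f v = c *\<^sub>R f u"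
      then have "(- c) *\<^sub>R f u + 1 *\<^sub>R f v = 0" "1 *\<^sub>R f v + (- c) *\<^sub>R f u = 0" by simp_all
      then show False using indep[of u v "- c" 1] indep[of v u 1 "- c"] uv by (cases "u < v") auto
    qed
  next
    fix e assume e: "e \<in> ?E"
    obtain i j where x: "e = {i, j}" "i < j" "j < ?n" "a e = f i" "b e = f j \<or> b e = - f j \<and> (\<forall>x. \<kappa> (- x) = \<kappa> x)"
      using ends[OF e] by blast
    show "{\<kappa> (a e), \<kappa> (b e)} = \<kappa> ` f ` e" using x by auto
    show "\<exists>c. c \<noteq> 0 \<and> (f v = c *\<^sub>R a e \<or> f v = c *\<^sub>R b e)" if v: "v \<in> e" for v
    proof -
      consider "v = i" | "v = j" "b e = f j" | "v = j" "b e = - f j" using v x by blast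
      then show ?thesis
        by cases (use x in \<open>auto intro: exI[of _ 1] exI[of _ "-1"]\<close>)
    qed
    show "s = 0 \<and> t = 0" if eq: "s *\<^sub>R a e + t *\<^sub>R b e = 0" for s t
      using indep[OF x(2,3), of s t] indep[OF x(2,3), of s "- t"] x(4,5) eq by auto
  next
    fix e v assume ev: "e \<in> ?E" "v \<in> {..<?n}" "v \<notin> e"
    obtain i j where x: "e = {i, j}" "ent e \<in> set (snd D)" "fst (ent e) = i" "fst (snd (ent e)) = j"
      using ends[OF ev(1)] by blast
    have "separable_both (tail_vec D (ent e)) (head_vec D (ent e)) (fst D ! v) (fst D ! v)"
    proof -
      have "\<forall>k \<in> set [0..<?n]. k = i \<or> k = j \<or>
          separable_both (tail_vec D (ent e)) (head_vec D (ent e)) (fst D ! k) (fst D ! k)"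
        using D x(2-4) unfolding valid_drawing_def by blast
      moreover have "v \<in> set [0..<?n]" using ev(2) by simp
      moreover have "v \<noteq> i" "v \<noteq> j" using ev(3) x(1) by auto
      ultimately show ?thesis by blast
    qed
    then show "apart (a e) (b e) (f v) (f v) \<and> apart (a e) (b e) (- f v) (- f v)"
      using separable_both_apart unfolding a_def b_def f_def by blast
  next
    fix e e' assume e: "e \<in> ?E" "e' \<in> ?E" "e \<noteq> e'"
    obtain i j s where x: "ent e = (i, j, s)" "(i, j, s) \<in> set (snd D)" "e = {i, j}" using ent[OF e(1)] by blast
    obtain i' j' s' where x': "ent e' = (i', j', s')" "(i', j', s') \<in> set (snd D)" "e' = {i', j'}"
      using ent[OF e(2)] by blast
    have ee: "ent e \<in> set (snd D)" "ent e' \<in> set (snd D)" using x x' by simp_all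
    have "ent e \<noteq> ent e'"
    proof
      assume "ent e = ent e'"
      then have "i = i'" "j = j'" using x(1) x'(1) by simp_all
      then show False using x(3) x'(3) e(3) by simp
    qed
    note ee = ee this
    let ?S = "\<lambda>e e'. separable_both (tail_vec D e) (head_vec D e) (tail_vec D e') (head_vec D e')"
    have "?S (ent e) (ent e') \<or> ?S (ent e') (ent e)"
      using D ee unfolding valid_drawing_def by (intro sorted_wrt_sym) auto
    then show "apart (a e) (b e) (a e') (b e') \<and> apart (a e) (b e) (- a e') (- b e')"
      unfolding a_def b_def by (meson separable_both_apart apart_swap apart_minus)
  next
    fix v assume v: "v \<in> {..<?n}"
    show "f v \<noteq> 0"
    proof -
      have "fst D ! v \<noteq> (0, 0, 0)" using D v unfolding valid_drawing_def by (metis lessThan_iff nth_mem)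
      then show ?thesis unfolding f_def by (cases "fst D ! v") (auto simp: real_vec_def vec_eq_iff forall_3)
    qed
  qed
  then show ?thesis by (simp add: drawn_graph_def)
qed

text \<open>The vertices of \<open>D\<close> stand for the positions in the list \<open>hs\<close>
  of edges, and edges with a common end are joined.\<close>
definition valid_line_drawing :: "(nat \<times> nat) list \<Rightarrow> drawing \<Rightarrow> bool" where
  "valid_line_drawing hs D \<longleftrightarrow> valid_drawing D \<and> length (fst D) = length hs \<and> distinct hs \<and>
     (\<forall>(i, j) \<in> set hs. i < j) \<and>
     (\<forall>l \<in> set [0..<length hs]. \<forall>k \<in> set [0..<l].
        fst (hs ! k) \<noteq> fst (hs ! l) \<and> fst (hs ! k) \<noteq> snd (hs ! l) \<and>
        snd (hs ! k) \<noteq> fst (hs ! l) \<and> snd (hs ! k) \<noteq> snd (hs ! l) \<or>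
        List.member (snd D) (k, l, False) \<or> List.member (snd D) (k, l, True))"

definition edge_set :: "(nat \<times> nat) list \<Rightarrow> nat set set" where
  "edge_set hs = (\<lambda>(i, j). {i, j}) ` set hs"

lemma embeds_in_injection:
  assumes H: "embeds_in H U" and inj: "inj_on \<phi> (fst G)" "\<phi> ` fst G \<subseteq> fst H"
    and sub: "\<And>e. e \<in> snd G \<Longrightarrow> e \<subseteq> fst G \<and> \<phi> ` e \<in> snd H"
  shows "embeds_in G U"
proof -
  obtain p \<gamma> where p: "inj_on p (fst H)" "p ` fst H \<subseteq> topspace U"
    and \<gamma>': "\<forall>e \<in> snd H. pathin U (\<gamma> e) \<and> inj_on (\<gamma> e) {0..1} \<and> {\<gamma> e 0, \<gamma> e 1} = p ` e \<and>
           \<gamma> e ` {0<..<1} \<inter> p ` fst H = {}"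
    and dj': "\<forall>e \<in> snd H. \<forall>f \<in> snd H. e \<noteq> f \<longrightarrow> \<gamma> e ` {0<..<1} \<inter> \<gamma> f ` {0<..<1} = {}"
    using H unfolding embeds_in_def by (elim exE conjE) (rule that)
  note \<gamma> = bspec[OF \<gamma>'] and dj = dj'[rule_format]
  show ?thesis
    unfolding embeds_in_def
  proof (intro exI[of _ "p \<circ> \<phi>"] exI[of _ "\<lambda>e. \<gamma> (\<phi> ` e)"] conjI ballI impI)
    show "inj_on (p \<circ> \<phi>) (fst G)" using p(1) inj by (meson comp_inj_on inj_on_subset)
    show "(p \<circ> \<phi>) ` fst G \<subseteq> topspace U" using p(2) inj(2) by (auto simp: image_comp[symmetric])
    fix e assume e: "e \<in> snd G"
    note sub = sub[OF e]
    show "pathin U (\<gamma> (\<phi> ` e))" "inj_on (\<gamma> (\<phi> ` e)) {0..1}" using \<gamma> sub by blast+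
    show "{\<gamma> (\<phi> ` e) 0, \<gamma> (\<phi> ` e) 1} = (p \<circ> \<phi>) ` e" using \<gamma> sub by (simp add: image_comp)
    have "(p \<circ> \<phi>) ` fst G \<subseteq> p ` fst H" using inj(2) by auto
    moreover have "\<gamma> (\<phi> ` e) ` {0<..<1} \<inter> p ` fst H = {}" using \<gamma>[of "\<phi> ` e"] sub by blast
    ultimately show "\<gamma> (\<phi> ` e) ` {0<..<1} \<inter> (p \<circ> \<phi>) ` fst G = {}" by blast
    fix f assume f: "f \<in> snd G" "e \<noteq> f"
    have "\<phi> ` e \<noteq> \<phi> ` f"
      using inj_on_image_eq_iff[OF inj(1)] sub assms(4)[OF f(1)] f(2) by blast
    then show "\<gamma> (\<phi> ` e) ` {0<..<1} \<inter> \<gamma> (\<phi> ` f) ` {0<..<1} = {}"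
      using dj[of "\<phi> ` e" "\<phi> ` f"] sub assms(4)[OF f(1)] by blast
  qed
qed

lemma line_graph_embeds_in:
  assumes D: "embeds_in (drawn_graph D) U" "valid_line_drawing hs D"
    and G: "simple_graph G" and inj: "inj_on \<phi> (fst G)" and sub: "\<And>e. e \<in> snd G \<Longrightarrow> \<phi> ` e \<in> edge_set hs"
  shows "embeds_in (line_graph G) U"
proof -
  define \<iota> where "\<iota> e = (SOME k. k < length hs \<and> \<phi> ` e = {fst (hs ! k), snd (hs ! k)})" for e
  have \<iota>: "\<iota> e < length hs \<and> \<phi> ` e = {fst (hs ! \<iota> e), snd (hs ! \<iota> e)}" if "e \<in> snd G" for e
    unfolding \<iota>_def
  proof (rule someI_ex)
    obtain h where "h \<in> set hs" "\<phi> ` e = {fst h, snd h}"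
      using sub[OF \<open>e \<in> snd G\<close>] unfolding edge_set_def by force
    then show "\<exists>k. k < length hs \<and> \<phi> ` e = {fst (hs ! k), snd (hs ! k)}"
      by (metis in_set_conv_nth)
  qed
  have eG: "e \<subseteq> fst G" if "e \<in> snd G" for e using G that by (simp add: simple_graph_def)
  have inj\<iota>: "inj_on \<iota> (snd G)"
    by (rule inj_onI) (metis \<iota> eG inj inj_on_image_eq_iff)
  have n: "length (fst D) = length hs" using D(2) by (simp add: valid_line_drawing_def)
  show ?thesis
  proof (rule embeds_in_injection[OF D(1), where \<phi> = \<iota>])
    show "inj_on \<iota> (fst (line_graph G))" using inj\<iota> by (simp add: line_graph_def)
    show "\<iota> ` fst (line_graph G) \<subseteq> fst (drawn_graph D)"
      using \<iota> n by (auto simp: line_graph_def drawn_graph_def)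
    fix c assume "c \<in> snd (line_graph G)"
    then obtain e f where ef: "c = {e, f}" "e \<in> snd G" "f \<in> snd G" "e \<noteq> f" "e \<inter> f \<noteq> {}"
      by (auto simp: line_graph_def)
    have "{k, l} \<in> snd (drawn_graph D)"
      if kl: "k < l" "l < length hs" "{fst (hs ! k), snd (hs ! k)} \<inter> {fst (hs ! l), snd (hs ! l)} \<noteq> {}" for k l
    proof -
      have "List.member (snd D) (k, l, False) \<or> List.member (snd D) (k, l, True)"
        using D(2) kl unfolding valid_line_drawing_def by fastforce
      then show ?thesis unfolding drawn_graph_def by (force simp: List.member_iff)
    qed
    note joined = this
    have "\<iota> e \<noteq> \<iota> f" using inj\<iota> ef by (meson inj_onD)
    moreover have "\<phi> ` e \<inter> \<phi> ` f \<noteq> {}" using ef(5) by blast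
    ultimately consider "\<iota> e < \<iota> f" "\<phi> ` e \<inter> \<phi> ` f \<noteq> {}" | "\<iota> f < \<iota> e" "\<phi> ` f \<inter> \<phi> ` e \<noteq> {}"
      by (metis inf_commute linorder_neqE_nat)
    then have "{\<iota> e, \<iota> f} \<in> snd (drawn_graph D)"
    proof cases
      case 1
      then show ?thesis using joined[of "\<iota> e" "\<iota> f"] \<iota>[OF ef(2)] \<iota>[OF ef(3)] by simp
    next
      case 2
      then have "{\<iota> f, \<iota> e} \<in> snd (drawn_graph D)"
        using joined[of "\<iota> f" "\<iota> e"] \<iota>[OF ef(2)] \<iota>[OF ef(3)] by simp
      then show ?thesis by (simp add: insert_commute)
    qed
    then show "c \<subseteq> fst (line_graph G) \<and> \<iota> ` c \<in> snd (drawn_graph D)"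
      using ef by (simp add: line_graph_def)
  qed
qed

lemma line_graph_projective:
  assumes "valid_line_drawing hs D"
    and "simple_graph G" "inj_on \<phi> (fst G)" "\<And>e. e \<in> snd G \<Longrightarrow> \<phi> ` e \<in> edge_set hs"
  shows "embeds_in (line_graph G) (top_of_set projective_plane)"
proof (rule line_graph_embeds_in[OF _ assms])
  show "embeds_in (drawn_graph D) (top_of_set projective_plane)"
  proof (rule valid_drawing_embeds[where \<kappa> = proj])
    show "valid_drawing D" using assms(1) by (simp add: valid_line_drawing_def)
    show "continuous_map (top_of_set (- {0})) (top_of_set projective_plane) proj"
      using continuous_on_proj proj_in_projective_plane by auto
    show "\<exists>c. c \<noteq> 0 \<and> y = c *\<^sub>R x" if "x \<noteq> 0" "y \<noteq> 0" "proj x = proj y" for x y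
      using proj_eqD[OF that(3,2)] by blast
  qed (simp add: proj_minus)
qed

lemma line_graph_spherical:
  assumes "valid_line_drawing hs D" and plain: "\<forall>(i, j, s) \<in> set (snd D). \<not> s"
    and "simple_graph G" "inj_on \<phi> (fst G)" "\<And>e. e \<in> snd G \<Longrightarrow> \<phi> ` e \<in> edge_set hs"
  shows "embeds_in (line_graph G) (top_of_set unit_sphere)"
proof (rule line_graph_embeds_in[OF _ assms(1,3-)])
  let ?\<kappa> = "\<lambda>x :: real ^ 3. inverse (norm x) *\<^sub>R x"
  show "embeds_in (drawn_graph D) (top_of_set unit_sphere)"
  proof (rule valid_drawing_embeds[where \<kappa> = ?\<kappa>])
    show "valid_drawing D" using assms(1) by (simp add: valid_line_drawing_def)
    show "continuous_map (top_of_set (- {0})) (top_of_set unit_sphere) ?\<kappa>"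
      by (auto intro!: continuous_intros)
    show "\<exists>c. c \<noteq> 0 \<and> y = c *\<^sub>R x" if "x \<noteq> 0" "y \<noteq> 0" "?\<kappa> x = ?\<kappa> y" for x y
    proof (intro exI conjI)
      have "norm y *\<^sub>R ?\<kappa> y = y" using that(2) by simp
      then show "y = (norm y * inverse (norm x)) *\<^sub>R x" using that(3) by (metis scaleR_scaleR)
      show "norm y * inverse (norm x) \<noteq> 0" using that by simp
    qed
  qed (use plain in simp)
qed

text \<open>The coordinates of the drawings below were found by computer search, apart from the
  evident planar ones. The line graph of the star with \<open>n\<close> edges is
  \<open>K\<^sub>n\<close>, that of \<open>K\<^sub>3\<^sub>,\<^sub>3\<close> is the graph of moves
  of a rook on a board with nine cells; the net is a triangle with a pendant edge at each vertex.\<close>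
definition claw4_edges :: "(nat \<times> nat) list" where
  "claw4_edges = [(0, 1), (0, 2), (0, 3), (0, 4)]"

definition claw4_drawing :: drawing where
  "claw4_drawing =
    ([(0, 0, 1), (3, 0, 1), (-2, 3, 1), (-2, -3, 1)],
     [(0, 1, False), (0, 2, False), (0, 3, False), (1, 2, False), (1, 3, False), (2, 3, False)])"

lemma claw4_drawing_valid: "valid_line_drawing claw4_edges claw4_drawing"
  by code_simp

definition K23_edges :: "(nat \<times> nat) list" where
  "K23_edges = [(0, 2), (0, 3), (0, 4), (1, 2), (1, 3), (1, 4)]"

definition K23_drawing :: drawing where
  "K23_drawing =
    ([(1, 0, 1), (-1, 1, 1), (-1, -1, 1), (4, 0, 1), (-3, 3, 1), (-3, -3, 1)],
     [(0, 1, False), (0, 2, False), (0, 3, False), (1, 2, False), (1, 4, False), (2, 5, False), (3, 4, False), (3, 5, False), (4, 5, False)])"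

lemma K23_drawing_valid: "valid_line_drawing K23_edges K23_drawing"
  by code_simp

definition net_edges :: "(nat \<times> nat) list" where
  "net_edges = [(0, 1), (1, 2), (0, 2), (0, 3), (1, 4), (2, 5)]"

definition net_drawing :: drawing where
  "net_drawing =
    ([(1, 1, 1), (-1, 1, 1), (0, -1, 1), (3, -2, 1), (0, 4, 1), (-3, -2, 1)],
     [(0, 1, False), (0, 2, False), (0, 3, False), (0, 4, False), (1, 2, False), (1, 4, False), (1, 5, False), (2, 3, False), (2, 5, False)])"

lemma net_drawing_valid: "valid_line_drawing net_edges net_drawing"
  by code_simp

definition claw6_edges :: "(nat \<times> nat) list" where
  "claw6_edges = [(0, 1), (0, 2), (0, 3), (0, 4), (0, 5), (0, 6)]"

definition claw6_drawing :: drawing where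
  "claw6_drawing =
    ([(-2, -4, -1), (4, 7, -2), (-3, -3, -3), (-1, -3, -2), (2, -3, 0), (2, 3, -1)],
     [(0, 1, True), (0, 2, False), (0, 3, False), (0, 4, False), (0, 5, True), (1, 2, False), (1, 3, False), (1, 4, True), (1, 5, False), (2, 3, False), (2, 4, True), (2, 5, True), (3, 4, False), (3, 5, False), (4, 5, False)])"

lemma claw6_drawing_valid: "valid_line_drawing claw6_edges claw6_drawing"
  by code_simp

definition K33_edges :: "(nat \<times> nat) list" where
  "K33_edges = [(0, 3), (0, 4), (0, 5), (1, 3), (1, 4), (1, 5), (2, 3), (2, 4), (2, 5)]"

definition K33_drawing :: drawing where
  "K33_drawing =
    ([(-3, -1, 1), (2, 1, -2), (0, 0, 1), (-3, 1, 3), (-1, 0, -3), (-3, 2, 0), (3, 0, 6), (3, 4, 7), (-5, 5, 2)],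
     [(0, 1, True), (0, 2, False), (0, 3, False), (0, 6, True), (1, 2, True), (1, 4, False), (1, 7, False), (2, 5, False), (2, 8, False), (3, 4, False), (3, 5, False), (3, 6, True), (4, 5, False), (4, 7, False), (5, 8, False), (6, 7, False), (6, 8, False), (7, 8, False)])"

lemma K33_drawing_valid: "valid_line_drawing K33_edges K33_drawing"
  by code_simp

definition wheel_edges :: "(nat \<times> nat) list" where
  "wheel_edges = [(0, 1), (0, 2), (0, 3), (0, 4), (1, 2), (2, 3), (3, 4), (1, 4)]"

definition wheel_drawing :: drawing where
  "wheel_drawing =
    ([(3, 0, 1), (0, 3, 1), (-3, 0, 1), (0, -3, 1), (1, 1, 1), (-1, 1, 1), (-1, -1, 1), (1, -1, 1)],
     [(0, 1, False), (0, 2, True), (0, 3, False), (0, 4, False), (0, 7, False), (1, 2, False), (1, 3, True), (1, 4, False), (1, 5, False), (2, 3, False), (2, 5, False), (2, 6, False), (3, 6, False), (3, 7, False), (4, 5, False), (4, 7, False), (5, 6, False), (6, 7, False)])"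

lemma wheel_drawing_valid: "valid_line_drawing wheel_edges wheel_drawing"
  by code_simp

section \<open>Crosscap number one and line graphs\<close>

lemma crosscap_number_eq_1_iff: "crosscap_number G = 1 \<longleftrightarrow> projective G \<and> \<not> planar G"
proof -
  let ?S = "{k. embeds_in G (nonorientable_surface k)}"
  have S: "0 \<in> ?S \<longleftrightarrow> planar G" "1 \<in> ?S \<longleftrightarrow> projective G"
    unfolding mem_Collect_eq planar_def projective_def embeds_in_N0 embeds_in_N1 by simp_all
  show ?thesis
  proof
    assume *: "crosscap_number G = 1"
    then have "(INF k \<in> ?S. enat k) = enat 1" by (simp add: crosscap_number_def one_enat_def)
    moreover have "?S \<noteq> {}"
    proof
      assume "?S = {}"
      then have "crosscap_number G = \<infinity>" by (simp add: crosscap_number_def top_enat_def)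
      then show False using * by simp
    qed
    ultimately have "enat 1 \<in> enat ` ?S" by (metis Inf_enat_def LeastI_ex image_is_empty ex_in_conv)
    then have "1 \<in> ?S" by (auto simp: image_iff)
    moreover have "0 \<notin> ?S"
    proof
      assume "0 \<in> ?S"
      then have "(INF k \<in> ?S. enat k) \<le> enat 0" by (rule INF_lower)
      then show False using * by (simp add: crosscap_number_def zero_enat_def[symmetric])
    qed
    ultimately show "projective G \<and> \<not> planar G" using S by blast
  next
    assume "projective G \<and> \<not> planar G"
    then have 1: "1 \<in> ?S" and 0: "0 \<notin> ?S" using S by blast+
    have "(INF k \<in> ?S. enat k) \<le> enat 1" using 1 by (rule INF_lower)
    moreover have "enat 1 \<le> (INF k \<in> ?S. enat k)"
    proof (rule INF_greatest)
      fix k assume "k \<in> ?S"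
      then have "k \<noteq> 0" using 0 by metis
      then show "enat 1 \<le> enat k" by simp
    qed
    ultimately show "crosscap_number G = 1" by (simp add: crosscap_number_def one_enat_def)
  qed
qed

lemma simple_line_graph: "simple_graph (line_graph G)"
  unfolding simple_graph_def
proof
  fix c assume "c \<in> snd (line_graph G)"
  then obtain e f where "c = {e, f}" "e \<in> snd G" "f \<in> snd G" "e \<noteq> f" by (auto simp: line_graph_def)
  then show "c \<subseteq> fst (line_graph G) \<and> card c = 2" by (simp add: line_graph_def)
qed

lemma line_graph_adjacent:
  "e \<in> snd G \<Longrightarrow> f \<in> snd G \<Longrightarrow> e \<noteq> f \<Longrightarrow> v \<in> e \<Longrightarrow> v \<in> f \<Longrightarrow> {e, f} \<in> snd (line_graph G)"
  unfolding line_graph_def by auto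

lemma line_graph_vertices: "fst (line_graph G) = snd G"
  by (simp add: line_graph_def)

lemma line_graph_embeds_in_injection:
  assumes "embeds_in (line_graph H) U" and inj: "inj_on \<phi> (fst G)" and G: "simple_graph G"
    and sub: "\<And>e. e \<in> snd G \<Longrightarrow> \<phi> ` e \<in> snd H"
  shows "embeds_in (line_graph G) U"
proof (rule embeds_in_injection[OF assms(1), where \<phi> = "image \<phi>"])
  have eG: "e \<subseteq> fst G" if "e \<in> snd G" for e using G that by (simp add: simple_graph_def)
  then show inj': "inj_on ((`) \<phi>) (fst (line_graph G))"
    using inj_on_image_eq_iff[OF inj] by (auto simp: inj_on_def line_graph_def)
  show "(`) \<phi> ` fst (line_graph G) \<subseteq> fst (line_graph H)"
    using sub by (auto simp: line_graph_def)
  fix c assume "c \<in> snd (line_graph G)"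
  then obtain e f where ef: "c = {e, f}" "e \<in> snd G" "f \<in> snd G" "e \<noteq> f" "e \<inter> f \<noteq> {}"
    by (auto simp: line_graph_def)
  obtain v where "v \<in> e" "v \<in> f" using ef(5) by blast
  moreover have "\<phi> ` e \<noteq> \<phi> ` f" using inj' ef by (auto simp: inj_on_def line_graph_def)
  ultimately have "{\<phi> ` e, \<phi> ` f} \<in> snd (line_graph H)"
    using sub ef by (intro line_graph_adjacent[of _ _ _ "\<phi> v"]) auto
  then show "c \<subseteq> fst (line_graph G) \<and> (`) \<phi> ` c \<in> snd (line_graph H)"
    using ef by (simp add: line_graph_def)
qed

lemma star_clique:
  assumes "\<And>w. w \<in> N \<Longrightarrow> {v, w} \<in> snd G"
  shows "clique_in (line_graph G) ((\<lambda>w. {v, w}) ` N)"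
  unfolding clique_in_def line_graph_vertices
proof (intro conjI ballI impI)
  show "(\<lambda>w. {v, w}) ` N \<subseteq> snd G" using assms by blast
  fix e f assume "e \<in> (\<lambda>w. {v, w}) ` N" "f \<in> (\<lambda>w. {v, w}) ` N" "e \<noteq> f"
  then show "{e, f} \<in> snd (line_graph G)" using assms by (intro line_graph_adjacent[of _ _ _ v]) auto
qed

lemma card_star:
  assumes "v \<notin> N" shows "card ((\<lambda>w. {v, w}) ` N) = card N"
  by (rule card_image) (use assms in \<open>auto simp: inj_on_def doubleton_eq_iff\<close>)

lemma edge_ends_distinct: "simple_graph G \<Longrightarrow> {u, w} \<in> snd G \<Longrightarrow> u \<noteq> w"
  by (force simp: simple_graph_def)

lemma line_graph_seven_star:
  assumes G: "simple_graph G" and N: "\<And>w. w \<in> N \<Longrightarrow> {v, w} \<in> snd G" "card N = 7"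
  shows "\<not> projective (line_graph G)"
proof
  assume "projective (line_graph G)"
  moreover have "v \<notin> N" using edge_ends_distinct[OF G N(1)] by blast
  ultimately show False
    using projective_no_seven_clique[OF _ simple_line_graph star_clique[OF N(1)]] card_star N(2) by metis
qed

lemma line_graph_five_star:
  assumes G: "simple_graph G" and N: "\<And>w. w \<in> N \<Longrightarrow> {v, w} \<in> snd G" "card N = 5"
  shows "\<not> planar (line_graph G)"
proof
  assume "planar (line_graph G)"
  moreover have "v \<notin> N" using edge_ends_distinct[OF G N(1)] by blast
  ultimately show False
    using planar_no_five_clique[OF _ simple_line_graph star_clique[OF N(1)]] card_star N(2) by metis
qed

text \<open>The edges at \<open>u\<close> without \<open>{u, v}\<close> form a 4-clique and the
  edges at \<open>v\<close> a 5-clique; the edge \<open>{u, v}\<close> belongs to the second and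
  meets every edge of the first.\<close>
lemma line_graph_double_star:
  assumes G: "simple_graph G" and uv: "{u, v} \<in> snd G"
    and N: "\<And>w. w \<in> N \<Longrightarrow> {u, w} \<in> snd G" "v \<notin> N" "card N = 4"
    and M: "\<And>w. w \<in> M \<Longrightarrow> {v, w} \<in> snd G" "u \<notin> M" "card M = 4"
  shows "\<not> projective (line_graph G)"
proof
  assume P: "projective (line_graph G)"
  have ne: "u \<noteq> v" "u \<notin> N" "v \<notin> M" using edge_ends_distinct[OF G] uv N(1) M(1) by blast+
  let ?K = "(\<lambda>w. {u, w}) ` N" and ?L = "(\<lambda>w. {v, w}) ` insert u M"
  have "card (insert u M) = 5" using M(2,3) by (metis card.infinite card_insert_disjoint eval_nat_numeral(3) zero_neq_numeral numeral_eq_Suc pred_numeral_simps(3) semiring_norm(26,27,28))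
  then have cL: "card ?L = 5" using ne by (subst card_star) auto
  have M': "{v, w} \<in> snd G" if "w \<in> insert u M" for w
    using M(1) uv that by (cases "w = u") (simp_all add: insert_commute[of v u])
  show False
  proof (rule projective_no_clique_beside_five_clique[OF P simple_line_graph star_clique[OF N(1)] _ star_clique[OF M'] cL])
    show "card ?K = 4" using card_star ne N(3) by metis
    show "?K \<inter> ?L = {}" using ne N(2) M(2) by (auto simp: doubleton_eq_iff)
    show "\<exists>f \<in> ?L. {e, f} \<in> snd (line_graph G)" if e: "e \<in> ?K" for e
    proof (rule bexI[of _ "{v, u}"])
      show "{e, {v, u}} \<in> snd (line_graph G)"
        using e N uv ne by (intro line_graph_adjacent[of _ _ _ u]) (auto simp: insert_commute doubleton_eq_iff)
    qed simp
  qed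
qed

text \<open>The edges at \<open>u\<close> and the edges at \<open>v\<close> form two 4-cliques,
  and edges with the same end in \<open>N\<close> match.\<close>
lemma line_graph_K24:
  assumes G: "simple_graph G" and uv: "u \<noteq> v"
    and N: "\<And>w. w \<in> N \<Longrightarrow> {u, w} \<in> snd G" "\<And>w. w \<in> N \<Longrightarrow> {v, w} \<in> snd G" "card N = 4"
  shows "\<not> projective (line_graph G)"
proof
  assume P: "projective (line_graph G)"
  have ne: "u \<notin> N" "v \<notin> N" using edge_ends_distinct[OF G] N(1,2) by blast+
  let ?K = "(\<lambda>w. {u, w}) ` N" and ?f = "\<lambda>e. insert v (e - {u})"
  have f: "?f {u, w} = {v, w}" if "w \<in> N" for w using that ne uv by auto
  have fK: "?f ` ?K = (\<lambda>w. {v, w}) ` N" unfolding image_image using f by (rule image_cong[OF refl])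
  show False
  proof (rule projective_no_joined_four_cliques[OF P simple_line_graph star_clique[OF N(1)], where f = ?f])
    show "card ?K = 4" using card_star ne N(3) by metis
    show "inj_on ?f ?K"
    proof (rule inj_onI)
      fix e e' assume "e \<in> ?K" "e' \<in> ?K" "?f e = ?f e'"
      then obtain w w' where w: "w \<in> N" "w' \<in> N" "e = {u, w}" "e' = {u, w'}" "{v, w} = {v, w'}"
        using f by auto
      then show "e = e'" by (auto simp: doubleton_eq_iff)
    qed
    show "clique_in (line_graph G) (?f ` ?K)" unfolding fK by (rule star_clique[OF N(2)])
    show "?K \<inter> ?f ` ?K = {}" unfolding fK using ne uv by (auto simp: doubleton_eq_iff)
    show "{e, ?f e} \<in> snd (line_graph G)" if e: "e \<in> ?K" for e
    proof -
      obtain w where w: "w \<in> N" "e = {u, w}" using e by blast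
      show ?thesis unfolding w(2) f[OF w(1)]
        using N w(1) uv ne by (intro line_graph_adjacent[of _ _ _ w]) (auto simp: doubleton_eq_iff)
    qed
  qed
qed

text \<open>The line graph is a \<open>3 \<times> 3\<close> grid whose rows and columns are
  triangles. The row of \<open>c\<close> is connected and touches every cell of the other two
  rows, which contain a theta graph.\<close>
lemma line_graph_K33_not_planar:
  assumes G: "simple_graph G" and dist: "distinct [a, b, c, x, y, z]"
    and E: "\<And>u v. u \<in> {a, b, c} \<Longrightarrow> v \<in> {x, y, z} \<Longrightarrow> {u, v} \<in> snd G"
  shows "\<not> planar (line_graph G)"
proof
  assume P: "planar (line_graph G)"
  let ?L = "line_graph G"
  have rows: "{{u, v}, {u, w}} \<in> snd ?L" if "u \<in> {a, b, c}" "v \<in> {x, y, z}" "w \<in> {x, y, z}" "v \<noteq> w" for u v w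
    using E that dist by (intro line_graph_adjacent[of _ _ _ u]) (auto simp: doubleton_eq_iff)
  have cols: "{{u, w}, {v, w}} \<in> snd ?L" if "u \<in> {a, b, c}" "v \<in> {a, b, c}" "w \<in> {x, y, z}" "u \<noteq> v" for u v w
    using E that dist by (intro line_graph_adjacent[of _ _ _ w]) (auto simp: doubleton_eq_iff)
  have ne: "a \<noteq> b" "a \<noteq> c" "b \<noteq> c" "x \<noteq> y" "x \<noteq> z" "y \<noteq> z" using dist by auto
  let ?W = "(\<lambda>w. {c, w}) ` {x, y, z}"
  have touch: "touches ?L ?W {u, w}" if "u \<in> {a, b}" "w \<in> {x, y, z}" for u w
    unfolding touches_def using cols[of u c w] that ne by blast
  show False
  proof (rule planar_no_theta_with_apex[OF P simple_line_graph, of "{a, x}" "[{a, y}]" "{b, y}" "[{b, x}]" "[{a, z}, {b, z}]" ?W])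
    show "path_edges ({a, x} # [{a, y}] @ [{b, y}]) \<subseteq> snd ?L"
      using rows[of a x y] cols[of a b y] ne by simp
    show "path_edges ({a, x} # [{b, x}] @ [{b, y}]) \<subseteq> snd ?L"
      using rows[of b x y] cols[of a b x] ne by simp
    show "path_edges ({a, x} # [{a, z}, {b, z}] @ [{b, y}]) \<subseteq> snd ?L"
      using rows[of a x z] rows[of b z y] cols[of a b z] ne by simp
    show "distinct ({a, x} # {b, y} # [{a, y}] @ [{b, x}] @ [{a, z}, {b, z}])"
      using dist by (auto simp: doubleton_eq_iff)
    show "?W \<subseteq> fst ?L" using E by (auto simp: line_graph_vertices)
    show "?W \<inter> set ({a, x} # {b, y} # [{a, y}] @ [{b, x}] @ [{a, z}, {b, z}]) = {}"
      using dist by (auto simp: doubleton_eq_iff)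
    show "connected_in ?L ?W" by (rule connected_in_clique[OF star_clique]) (use E in blast)
  qed (use touch in auto)
qed

text \<open>The four spokes form a clique, and the rim is connected and touches each of them.\<close>
lemma line_graph_wheel_not_planar:
  assumes G: "simple_graph G" and dist: "distinct [h, a, b, c, d]"
    and E: "\<And>v. v \<in> {a, b, c, d} \<Longrightarrow> {h, v} \<in> snd G" "{a, b} \<in> snd G" "{b, c} \<in> snd G" "{c, d} \<in> snd G" "{d, a} \<in> snd G"
  shows "\<not> planar (line_graph G)"
proof
  assume P: "planar (line_graph G)"
  let ?L = "line_graph G" and ?W = "{{a, b}, {b, c}, {c, d}, {d, a}}"
  have ne: "h \<noteq> a" "h \<noteq> b" "h \<noteq> c" "h \<noteq> d" "a \<noteq> b" "a \<noteq> c" "a \<noteq> d" "b \<noteq> c" "b \<noteq> d" "c \<noteq> d" using dist by auto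
  have adj: "{{a, b}, {b, c}} \<in> snd ?L" "{{b, c}, {c, d}} \<in> snd ?L" "{{c, d}, {d, a}} \<in> snd ?L"
    using line_graph_adjacent[of "{a, b}" G "{b, c}" b] line_graph_adjacent[of "{b, c}" G "{c, d}" c]
      line_graph_adjacent[of "{c, d}" G "{d, a}" d] E(2-5) ne
    by (auto simp: doubleton_eq_iff)
  have spokes: "{{h, v}, {v, w}} \<in> snd ?L" if "v \<in> {a, b, c, d}" "{v, w} \<in> ?W" "{v, w} \<in> snd G" "w \<noteq> h" for v w
    using E(1)[OF that(1)] that(1,3,4) ne by (intro line_graph_adjacent[of _ _ _ v]) (auto simp: doubleton_eq_iff)
  have touch: "touches ?L ?W {h, v}" if "v \<in> {a, b, c, d}" for v
  proof -
    have "\<exists>w. {v, w} \<in> ?W \<and> {v, w} \<in> snd G \<and> w \<noteq> h" using that E(2-5) ne by blast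
    then show ?thesis using spokes[OF that] unfolding touches_def by blast
  qed
  show False
  proof (rule planar_no_clique_with_apex[OF P simple_line_graph star_clique[of "{a, b, c, d}" h], of ?W])
    show "card ((\<lambda>w. {h, w}) ` {a, b, c, d}) = 4" using ne by (subst card_star) auto
    show "?W \<subseteq> fst ?L" using E by (simp add: line_graph_vertices)
    show "?W \<inter> (\<lambda>w. {h, w}) ` {a, b, c, d} = {}" using ne by (auto simp: doubleton_eq_iff)
    show "connected_in ?L ?W"
    proof (rule connected_in_root[of "{a, b}"])
      let ?R = "{(u, v). u \<in> ?W \<and> v \<in> ?W \<and> {u, v} \<in> snd ?L}"
      have r: "({a, b}, {b, c}) \<in> ?R" "({b, c}, {c, d}) \<in> ?R" "({c, d}, {d, a}) \<in> ?R" using adj by auto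
      fix e assume "e \<in> ?W"
      then consider "e = {a, b}" | "e = {b, c}" | "e = {c, d}" | "e = {d, a}" by blast
      then show "({a, b}, e) \<in> ?R\<^sup>*"
        by cases (use r in \<open>meson rtrancl.simps rtrancl_trans r_into_rtrancl\<close>)+
    qed simp
  qed (use touch E in auto)
qed

section \<open>Nilpotents and the essential graph\<close>

definition nilpotents :: "('a, 'm) ring_scheme \<Rightarrow> 'a set" where
  "nilpotents R = {x \<in> carrier R. \<exists>n::nat. x [^]\<^bsub>R\<^esub> n = \<zero>\<^bsub>R\<^esub>}"

locale finite_cring = cring +
  assumes finite_carrier: "finite (carrier R)" and nontrivial: "\<one> \<noteq> \<zero>"
begin

text \<open>The powers of \<open>x\<close> repeat, say \<open>x\<close> to the power \<open>a +
  d\<close> equals \<open>x\<close> to the power \<open>a\<close>. Every multiple of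
  \<open>d\<close> that is at least \<open>a\<close> is then the exponent of an idempotent power.\<close>
lemma idempotent_power:
  assumes x: "x \<in> carrier R"
  obtains m :: nat where "m > 0" "x [^] m \<otimes> x [^] m = x [^] m"
proof -
  have "\<not> inj (\<lambda>n::nat. x [^] n)"
  proof
    assume "inj (\<lambda>n::nat. x [^] n)"
    moreover have "range (\<lambda>n::nat. x [^] n) \<subseteq> carrier R" using x by auto
    ultimately show False
      using finite_carrier by (meson finite_imageD finite_subset infinite_UNIV_nat)
  qed
  then obtain a b :: nat where ab: "a < b" "x [^] a = x [^] b"
    unfolding inj_on_def by (metis linorder_neqE_nat)
  define d where "d = b - a"
  have d: "d > 0" "x [^] (a + d) = x [^] a" using ab by (simp_all add: d_def)
  have shift: "x [^] (n + k * d) = x [^] n" if "n \<ge> a" for n k :: nat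
  proof (induction k)
    case (Suc k)
    have "x [^] (n + Suc k * d) = x [^] (a + d) \<otimes> x [^] (n - a + k * d)"
      using that x by (simp add: nat_pow_mult algebra_simps)
    also have "\<dots> = x [^] (n + k * d)" unfolding d(2) using that x by (simp add: nat_pow_mult)
    finally show ?case using Suc.IH by simp
  qed simp
  let ?m = "(a + 1) * d"
  have "a \<le> ?m" using d(1) by (metis add.commute le_add2 le_trans mult.commute mult_le_mono1 nat_mult_1 One_nat_def Suc_leI)
  then have "x [^] (?m + (a + 1) * d) = x [^] ?m" by (rule shift)
  then have "x [^] ?m \<otimes> x [^] ?m = x [^] ?m" using x by (simp add: nat_pow_mult)
  then show ?thesis using that[of ?m] d(1) by simp
qed

lemma nilpotents_carrier: "x \<in> nilpotents R \<Longrightarrow> x \<in> carrier R"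
  by (simp add: nilpotents_def)

lemma zero_nilpotent: "\<zero> \<in> nilpotents R"
  unfolding nilpotents_def by (auto intro!: exI[of _ "1::nat"])

lemma nilpotents_mult: "x \<in> nilpotents R \<Longrightarrow> y \<in> carrier R \<Longrightarrow> x \<otimes> y \<in> nilpotents R"
  unfolding nilpotents_def by (auto simp: nat_pow_distrib) (metis l_null nat_pow_closed)

lemma nilpotents_mult': "x \<in> nilpotents R \<Longrightarrow> y \<in> carrier R \<Longrightarrow> y \<otimes> x \<in> nilpotents R"
  using nilpotents_mult m_comm nilpotents_carrier by metis

text \<open>Multiply \<open>j\<close> by the highest power of \<open>x\<close> that does not
  annihilate it.\<close>
lemma nilpotent_kills:
  assumes x: "x \<in> nilpotents R" and j: "j \<in> carrier R" "j \<noteq> \<zero>"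
  obtains k :: nat where "x [^] k \<otimes> j \<noteq> \<zero>" "x \<otimes> (x [^] k \<otimes> j) = \<zero>"
proof -
  have xc: "x \<in> carrier R" using x by (simp add: nilpotents_def)
  obtain n :: nat where n: "x [^] n = \<zero>" using x by (auto simp: nilpotents_def)
  define m where "m = (LEAST m. x [^] (m::nat) \<otimes> j = \<zero>)"
  have ex: "\<exists>m::nat. x [^] m \<otimes> j = \<zero>" using n j by (intro exI[of _ n]) simp
  have m: "x [^] m \<otimes> j = \<zero>" unfolding m_def by (rule LeastI_ex[OF ex])
  have "m \<noteq> 0" using m j by (intro notI) simp
  then obtain k where k: "m = Suc k" by (cases m) auto
  have "x [^] k \<otimes> j \<noteq> \<zero>"
    using not_less_Least[of k "\<lambda>m. x [^] m \<otimes> j = \<zero>"] k by (simp add: m_def)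
  moreover have "x \<otimes> (x [^] k \<otimes> j) = \<zero>"
    using m k xc j(1) by (simp add: m_assoc[symmetric] m_comm)
  ultimately show ?thesis using that by blast
qed

lemma nilpotent_annihilator:
  assumes "x \<in> nilpotents R"
  obtains y where "y \<in> carrier R" "y \<noteq> \<zero>" "x \<otimes> y = \<zero>"
proof -
  obtain k :: nat where "x [^] k \<otimes> \<one> \<noteq> \<zero>" "x \<otimes> (x [^] k \<otimes> \<one>) = \<zero>"
    using nilpotent_kills[OF assms one_closed nontrivial] .
  then show ?thesis using that[of "x [^] k \<otimes> \<one>"] assms by (simp add: nilpotents_def)
qed

lemma ann_ideal: "x \<in> carrier R \<Longrightarrow> ideal (ann R x) R"
proof (rule idealI)
  assume x: "x \<in> carrier R"
  show "ring R" by (rule ring_axioms)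
  show "subgroup (ann R x) (add_monoid R)"
    by (rule group.subgroupI[OF add.group_axioms])
      (use x in \<open>auto simp: ann_def r_distr r_minus a_inv_def[symmetric] intro: exI[of _ \<zero>]\<close>)
  show "\<And>a y. a \<in> ann R x \<Longrightarrow> y \<in> carrier R \<Longrightarrow> y \<otimes> a \<in> ann R x"
    using x by (auto simp: ann_def m_lcomm)
  show "\<And>a y. a \<in> ann R x \<Longrightarrow> y \<in> carrier R \<Longrightarrow> a \<otimes> y \<in> ann R x"
    using x by (auto simp: ann_def m_assoc[symmetric])
qed

text \<open>For nilpotent \<open>x\<close>, every nonzero ideal contains some \<open>j \<noteq>
  0\<close> and hence a nonzero multiple of \<open>j\<close> that \<open>x\<close> annihilates.
  Otherwise some power \<open>f\<close> of \<open>x\<close> is a nonzero idempotent; an element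
  \<open>y\<close> of the ideal of \<open>f\<close> satisfies \<open>y = f y\<close>, and \<open>f
  y = 0\<close> if \<open>x y = 0\<close>, so this ideal meets the annihilator of \<open>x\<close>
  only in 0.\<close>
lemma essential_ann_iff:
  assumes x: "x \<in> carrier R"
  shows "essential_ideal (ann R x) R \<longleftrightarrow> x \<in> nilpotents R"
proof
  assume nil: "x \<in> nilpotents R"
  show "essential_ideal (ann R x) R"
    unfolding essential_ideal_def
  proof (intro conjI allI impI ann_ideal[OF x])
    fix J assume J: "ideal J R \<and> J \<noteq> {\<zero>}"
    then interpret J: ideal J R by blast
    have "\<zero> \<in> J" by (rule additive_subgroup.zero_closed[OF J.additive_subgroup_axioms])
    then obtain j where j: "j \<in> J" "j \<noteq> \<zero>" using J by blast
    have jc: "j \<in> carrier R" using j(1) J.a_subset by blast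
    obtain k :: nat where k: "x [^] k \<otimes> j \<noteq> \<zero>" "x \<otimes> (x [^] k \<otimes> j) = \<zero>"
      using nilpotent_kills[OF nil jc j(2)] .
    have "x [^] k \<otimes> j \<in> ann R x \<inter> J"
      using k(2) x jc j(1) J.I_l_closed by (simp add: ann_def)
    then show "ann R x \<inter> J \<noteq> {\<zero>}" using k(1) by blast
  qed
next
  assume ess: "essential_ideal (ann R x) R"
  show "x \<in> nilpotents R"
  proof (rule ccontr)
    assume not: "x \<notin> nilpotents R"
    obtain m :: nat where m: "m > 0" "x [^] m \<otimes> x [^] m = x [^] m" using idempotent_power[OF x] .
    define f where "f = x [^] m"
    have f: "f \<in> carrier R" "f \<noteq> \<zero>" "f \<otimes> f = f" using not x m by (auto simp: f_def nilpotents_def)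
    have "f \<in> PIdl f" using cgenideal_self[OF f(1)] .
    then have "PIdl f \<noteq> {\<zero>}" using f(2) by blast
    then have "ann R x \<inter> PIdl f \<noteq> {\<zero>}"
      using ess cgenideal_ideal[OF f(1)] unfolding essential_ideal_def by blast
    moreover have "ann R x \<inter> PIdl f = {\<zero>}"
    proof (intro equalityI subsetI)
      fix y assume y: "y \<in> ann R x \<inter> PIdl f"
      then have yc: "y \<in> carrier R" "x \<otimes> y = \<zero>" by (auto simp: ann_def)
      obtain s where s: "s \<in> carrier R" "y = s \<otimes> f" using y by (auto simp: cgenideal_def)
      obtain l where l: "m = Suc l" using m(1) by (cases m) auto
      have "f \<otimes> y = x [^] l \<otimes> (x \<otimes> y)" using x yc(1) by (simp add: f_def l m_assoc)
      also have "\<dots> = \<zero>" using x yc(2) by simp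
      finally have "f \<otimes> y = \<zero>" .
      moreover have "f \<otimes> y = y" using f s by (metis m_assoc m_comm)
      ultimately show "y \<in> {\<zero>}" by simp
    next
      fix y assume "y \<in> {\<zero>}"
      then show "y \<in> ann R x \<inter> PIdl f"
        using x additive_subgroup.zero_closed[OF ideal.axioms(1)[OF cgenideal_ideal[OF f(1)]]]
        by (simp add: ann_def)
    qed
    ultimately show False by blast
  qed
qed

lemma zero_divisors_carrier: "x \<in> zero_divisors R \<Longrightarrow> x \<in> carrier R"
  by (simp add: zero_divisors_def)

lemma nilpotent_zero_divisor: "x \<in> nilpotents R \<Longrightarrow> x \<in> zero_divisors R"
  using nilpotent_annihilator[of x] by (auto simp: zero_divisors_def nilpotents_def)

lemma unit_not_zero_divisor: "x \<in> Units R \<Longrightarrow> x \<notin> zero_divisors R"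
proof
  assume x: "x \<in> Units R" and "x \<in> zero_divisors R"
  then obtain y where y: "y \<in> carrier R" "y \<noteq> \<zero>" "x \<otimes> y = \<zero>" by (auto simp: zero_divisors_def)
  have "y = inv x \<otimes> (x \<otimes> y)" using x y(1) by (metis Units_closed Units_inv_closed Units_l_inv l_one m_assoc)
  then show False using x y(2,3) by simp
qed

lemma unit_not_nilpotent: "x \<in> Units R \<Longrightarrow> x \<notin> nilpotents R"
  using unit_not_zero_divisor nilpotent_zero_divisor by blast

lemma essential_graph_vertices: "fst (essential_graph R) = zero_divisors R - {\<zero>}"
  by (simp add: essential_graph_def Let_def)

lemma essential_graph_edge_iff:
  "{u, v} \<in> snd (essential_graph R) \<longleftrightarrow>
     u \<in> zero_divisors R - {\<zero>} \<and> v \<in> zero_divisors R - {\<zero>} \<and> u \<noteq> v \<and> u \<otimes> v \<in> nilpotents R"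
proof -
  have *: "essential_ideal (ann R (u \<otimes> v)) R \<longleftrightarrow> u \<otimes> v \<in> nilpotents R"
    if "u \<in> zero_divisors R - {\<zero>}" "v \<in> zero_divisors R - {\<zero>}" for u v
    using that by (intro essential_ann_iff) (auto simp: zero_divisors_def)
  have comm: "u \<otimes> v = v \<otimes> u" if "u \<in> zero_divisors R - {\<zero>}" "v \<in> zero_divisors R - {\<zero>}" for u v
    using that by (intro m_comm) (auto simp: zero_divisors_def)
  show ?thesis
    unfolding essential_graph_def Let_def snd_conv using * comm
    by (auto simp: doubleton_eq_iff)
qed

lemma simple_essential_graph: "simple_graph (essential_graph R)"
  unfolding simple_graph_def essential_graph_def Let_def by auto

lemma essential_graph_edgeE:
  assumes "e \<in> snd (essential_graph R)"
  obtains u v where "e = {u, v}" "u \<in> zero_divisors R - {\<zero>}" "v \<in> zero_divisors R - {\<zero>}" "u \<noteq> v" "u \<otimes> v \<in> nilpotents R"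
proof -
  obtain u v where "e = {u, v}" using assms by (auto simp: essential_graph_def Let_def)
  then show ?thesis using that essential_graph_edge_iff assms by metis
qed

text \<open>The vertices \<open>u\<close> and \<open>v\<close> are adjacent, and each has four
  more neighbours among the other nonzero elements of its annihilator.\<close>
lemma double_star_not_projective:
  assumes u: "u \<in> carrier R" "u \<otimes> u \<noteq> \<zero>" and v: "v \<in> carrier R" "v \<otimes> v \<noteq> \<zero>" and uv: "u \<otimes> v = \<zero>"
    and ann: "card (ann R u) \<ge> 6" "card (ann R v) \<ge> 6"
  shows "\<not> projective (line_graph (essential_graph R))"
proof -
  have vu: "v \<otimes> u = \<zero>" using u v uv m_comm by metis
  have nz: "u \<noteq> \<zero>" "v \<noteq> \<zero>" using u v by auto
  have zd: "a \<in> zero_divisors R" if "a \<in> carrier R" "b \<in> carrier R" "b \<noteq> \<zero>" "a \<otimes> b = \<zero>" for a b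
    using that by (auto simp: zero_divisors_def)
  have nbr: "{a, w} \<in> snd (essential_graph R)"
    if "a \<in> carrier R" "a \<noteq> \<zero>" "a \<otimes> a \<noteq> \<zero>" "w \<in> ann R a" "w \<noteq> \<zero>" for a w
  proof -
    have w: "w \<in> carrier R" "a \<otimes> w = \<zero>" "w \<otimes> a = \<zero>" using that m_comm by (auto simp: ann_def)
    have "a \<noteq> w" using w(2) that(3) by auto
    then show ?thesis
      unfolding essential_graph_edge_iff using that w zd[of a w] zd[of w a] zero_nilpotent by simp
  qed
  have pick: "\<exists>N \<subseteq> ann R a - {\<zero>, b}. card N = 4" if "card (ann R a) \<ge> 6" for a b
  proof -
    have "card (ann R a) - card {\<zero>, b} \<le> card (ann R a - {\<zero>, b})" by (rule diff_card_le_card_Diff) simp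
    moreover have "card {\<zero>, b} \<le> 2" by (cases "b = \<zero>") auto
    ultimately have "4 \<le> card (ann R a - {\<zero>, b})" using that by linarith
    then show ?thesis by (meson obtain_subset_with_card_n)
  qed
  obtain N where N: "N \<subseteq> ann R u - {\<zero>, v}" "card N = 4" using pick[OF ann(1)] by blast
  obtain M where M: "M \<subseteq> ann R v - {\<zero>, u}" "card M = 4" using pick[OF ann(2)] by blast
  have "v \<in> ann R u" using uv v by (simp add: ann_def)
  then have "{u, v} \<in> snd (essential_graph R)" using nbr u nz by blast
  then show ?thesis
    by (rule line_graph_double_star[OF simple_essential_graph _ _ _ N(2) _ _ M(2)])
      (use N(1) M(1) nbr u v nz in blast)+
qed

end

lemma finite_cring_iso_transfer:
  assumes A: "finite_cring A" and B: "finite_cring B" and h: "h \<in> ring_iso A B"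
  shows "embeds_in (line_graph (essential_graph B)) U \<Longrightarrow> embeds_in (line_graph (essential_graph A)) U"
proof -
  interpret A: finite_cring A by fact
  interpret B: finite_cring B by fact
  have hom: "h \<in> ring_hom A B" and bij: "bij_betw h (carrier A) (carrier B)" using h by (auto simp: ring_iso_def)
  interpret h: ring_hom_cring A B h
    by (intro ring_hom_cringI A.is_cring B.is_cring hom)
  have inj: "inj_on h (carrier A)" using bij by (simp add: bij_betw_def)
  have hz: "h x = \<zero>\<^bsub>B\<^esub> \<longleftrightarrow> x = \<zero>\<^bsub>A\<^esub>" if "x \<in> carrier A" for x
    using inj that h.hom_zero by (metis A.zero_closed inj_onD)
  have nil: "h x \<in> nilpotents B" if x: "x \<in> nilpotents A" for x
  proof -
    obtain n :: nat where n: "x \<in> carrier A" "x [^]\<^bsub>A\<^esub> n = \<zero>\<^bsub>A\<^esub>" using x by (auto simp: nilpotents_def)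
    have "h (x [^]\<^bsub>A\<^esub> k) = h x [^]\<^bsub>B\<^esub> k" for k :: nat
      by (induction k) (use n(1) in simp_all)
    then have "h x [^]\<^bsub>B\<^esub> n = \<zero>\<^bsub>B\<^esub>" using n(2) by (metis h.hom_zero)
    then show ?thesis using n(1) by (auto simp: nilpotents_def)
  qed
  have zd: "h x \<in> zero_divisors B - {\<zero>\<^bsub>B\<^esub>}" if x: "x \<in> zero_divisors A - {\<zero>\<^bsub>A\<^esub>}" for x
  proof -
    obtain y where y: "x \<in> carrier A" "y \<in> carrier A" "y \<noteq> \<zero>\<^bsub>A\<^esub>" "x \<otimes>\<^bsub>A\<^esub> y = \<zero>\<^bsub>A\<^esub>" "x \<noteq> \<zero>\<^bsub>A\<^esub>"
      using x by (auto simp: zero_divisors_def)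
    have "h x \<otimes>\<^bsub>B\<^esub> h y = \<zero>\<^bsub>B\<^esub>" using h.hom_mult[OF y(1,2)] y(4) by simp
    then show ?thesis using y hz by (auto simp: zero_divisors_def)
  qed
  show "embeds_in (line_graph (essential_graph A)) U" if "embeds_in (line_graph (essential_graph B)) U"
  proof (rule line_graph_embeds_in_injection[OF that _ A.simple_essential_graph, where \<phi> = h])
    show "inj_on h (fst (essential_graph A))"
      unfolding A.essential_graph_vertices by (rule inj_on_subset[OF inj]) (auto simp: zero_divisors_def)
    fix e assume "e \<in> snd (essential_graph A)"
    then obtain u v where e: "e = {u, v}" "u \<in> zero_divisors A - {\<zero>\<^bsub>A\<^esub>}" "v \<in> zero_divisors A - {\<zero>\<^bsub>A\<^esub>}"
      "u \<noteq> v" "u \<otimes>\<^bsub>A\<^esub> v \<in> nilpotents A"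
      by (rule A.essential_graph_edgeE)
    have uv: "u \<in> carrier A" "v \<in> carrier A" using e A.zero_divisors_carrier by blast+
    have "h u \<otimes>\<^bsub>B\<^esub> h v \<in> nilpotents B" using nil[OF e(5)] h.hom_mult[OF uv] by simp
    moreover have "h u \<noteq> h v" using inj uv e(4) by (meson inj_onD)
    ultimately show "h ` e \<in> snd (essential_graph B)"
      using zd e by (simp add: B.essential_graph_edge_iff)
  qed
qed

lemma crosscap_number_iso:
  assumes "finite_cring A" "finite_cring B" "A \<simeq> B"
  shows "crosscap_number (line_graph (essential_graph A)) = crosscap_number (line_graph (essential_graph B))"
proof -
  obtain h where h: "h \<in> ring_iso A B" using assms(3) by (auto simp: is_ring_iso_def)
  have "B \<simeq> A" using ring_iso_sym[OF _ assms(3)] assms(1) by (simp add: finite_cring_def cring_def)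
  then obtain g where g: "g \<in> ring_iso B A" by (auto simp: is_ring_iso_def)
  have "embeds_in (line_graph (essential_graph A)) U \<longleftrightarrow> embeds_in (line_graph (essential_graph B)) U" for U :: "(real^3) set topology"
    using finite_cring_iso_transfer[OF assms(1,2) h] finite_cring_iso_transfer[OF assms(2,1) g] by blast
  then show ?thesis by (simp add: crosscap_number_def)
qed

lemma RDirProd_simps:
  "carrier (RDirProd R S) = carrier R \<times> carrier S"
  "(a, b) \<otimes>\<^bsub>RDirProd R S\<^esub> (c, d) = (a \<otimes>\<^bsub>R\<^esub> c, b \<otimes>\<^bsub>S\<^esub> d)"
  "(a, b) \<oplus>\<^bsub>RDirProd R S\<^esub> (c, d) = (a \<oplus>\<^bsub>R\<^esub> c, b \<oplus>\<^bsub>S\<^esub> d)"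
  "\<one>\<^bsub>RDirProd R S\<^esub> = (\<one>\<^bsub>R\<^esub>, \<one>\<^bsub>S\<^esub>)" "\<zero>\<^bsub>RDirProd R S\<^esub> = (\<zero>\<^bsub>R\<^esub>, \<zero>\<^bsub>S\<^esub>)"
  by (simp_all add: RDirProd_def DirProd_def monoid.defs)

lemma finite_cring_RDirProd:
  assumes "finite_cring R" "finite_cring S" shows "finite_cring (RDirProd R S)"
proof -
  interpret R: finite_cring R by fact
  interpret S: finite_cring S by fact
  interpret P: ring "RDirProd R S" by (rule RDirProd_ring[OF R.ring_axioms S.ring_axioms])
  show ?thesis
  proof unfold_locales
    show "x \<otimes>\<^bsub>RDirProd R S\<^esub> y = y \<otimes>\<^bsub>RDirProd R S\<^esub> x" if "x \<in> carrier (RDirProd R S)" "y \<in> carrier (RDirProd R S)" for x y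
      using that R.m_comm S.m_comm by (auto simp: RDirProd_simps)
  qed (auto simp: RDirProd_simps R.finite_carrier S.finite_carrier R.nontrivial)
qed

lemma RDirProd_pow:
  assumes "finite_cring R" "finite_cring S"
  shows "(a, b) [^]\<^bsub>RDirProd R S\<^esub> (n::nat) = (a [^]\<^bsub>R\<^esub> n, b [^]\<^bsub>S\<^esub> n)"
proof -
  interpret R: finite_cring R by fact
  interpret S: finite_cring S by fact
  interpret P: finite_cring "RDirProd R S" by (rule finite_cring_RDirProd) fact+
  show ?thesis by (induction n) (simp_all add: RDirProd_simps)
qed

lemma nilpotents_RDirProd:
  assumes "finite_cring R" "finite_cring S"
  shows "nilpotents (RDirProd R S) = nilpotents R \<times> nilpotents S"
proof -
  interpret R: finite_cring R by fact
  interpret S: finite_cring S by fact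
  have "x [^]\<^bsub>R\<^esub> (n + m) = \<zero>\<^bsub>R\<^esub>" if "x \<in> carrier R" "x [^]\<^bsub>R\<^esub> n = \<zero>\<^bsub>R\<^esub>" for x and n m :: nat
    using that by (simp flip: R.nat_pow_mult)
  moreover have "x [^]\<^bsub>S\<^esub> (n + m) = \<zero>\<^bsub>S\<^esub>" if "x \<in> carrier S" "x [^]\<^bsub>S\<^esub> m = \<zero>\<^bsub>S\<^esub>" for x and n m :: nat
    using that by (simp flip: S.nat_pow_mult)
  ultimately show ?thesis
    unfolding nilpotents_def using RDirProd_pow[OF assms] by (fastforce simp: RDirProd_simps)
qed

section \<open>Idempotents\<close>

text \<open>The factor \<open>R e\<close> that belongs to an idempotent \<open>e\<close>. It has
  the same element type as \<open>R\<close>, so that decompositions can be repeated.\<close>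
definition corner :: "('a, 'm) ring_scheme \<Rightarrow> 'a \<Rightarrow> ('a, 'm) ring_scheme" where
  "corner R e = R \<lparr>carrier := (\<lambda>x. e \<otimes>\<^bsub>R\<^esub> x) ` carrier R, one := e\<rparr>"

context finite_cring
begin

lemma corner_simps:
  "carrier (corner R e) = (\<lambda>x. e \<otimes> x) ` carrier R" "\<one>\<^bsub>corner R e\<^esub> = e" "\<zero>\<^bsub>corner R e\<^esub> = \<zero>"
  "x \<otimes>\<^bsub>corner R e\<^esub> y = x \<otimes> y" "x \<oplus>\<^bsub>corner R e\<^esub> y = x \<oplus> y"
  by (simp_all add: corner_def)

lemma corner_finite_cring:
  assumes e: "e \<in> carrier R" "e \<otimes> e = e" "e \<noteq> \<zero>"
  shows "finite_cring (corner R e)"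
proof -
  have absorb: "e \<otimes> (e \<otimes> x) = e \<otimes> x" if "x \<in> carrier R" for x
    using e that by (simp flip: m_assoc)
  have mem: "x \<in> carrier (corner R e) \<longleftrightarrow> x \<in> carrier R \<and> e \<otimes> x = x" for x
    using absorb e(1) by (auto simp: corner_simps) (metis image_eqI)
  have cr: "cring (corner R e)"
  proof (rule cringI)
    show "abelian_group (corner R e)"
    proof (rule abelian_groupI)
      fix x assume x: "x \<in> carrier (corner R e)"
      have "e \<otimes> (\<ominus> x) = \<ominus> x" using x e(1) mem[of x] by (simp add: r_minus)
      then have "\<ominus> x \<in> carrier (corner R e)" using x mem by simp
      moreover have "\<ominus> x \<oplus> x = \<zero>" using x mem by (simp add: l_neg)
      ultimately show "\<exists>y \<in> carrier (corner R e). y \<oplus>\<^bsub>corner R e\<^esub> x = \<zero>\<^bsub>corner R e\<^esub>"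
        by (auto simp: corner_simps(3-5))
    qed (use e(1) in \<open>auto simp: mem corner_simps(3-5) r_distr a_ac\<close>)
    show "comm_monoid (corner R e)"
    proof (rule comm_monoidI)
      fix x y assume "x \<in> carrier (corner R e)" "y \<in> carrier (corner R e)"
      then have xy: "x \<in> carrier R" "y \<in> carrier R" "e \<otimes> x = x" by (simp_all add: mem)
      then have "e \<otimes> (x \<otimes> y) = x \<otimes> y" using e(1) by (metis m_assoc)
      then show "x \<otimes>\<^bsub>corner R e\<^esub> y \<in> carrier (corner R e)" using xy by (simp add: mem corner_simps(4))
      show "x \<otimes>\<^bsub>corner R e\<^esub> y = y \<otimes>\<^bsub>corner R e\<^esub> x" using xy by (simp add: corner_simps(4) m_comm)
    qed (use e in \<open>auto simp: mem corner_simps(2,4) m_assoc\<close>)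
  qed (auto simp: mem corner_simps(2-5) l_distr)
  then show ?thesis
    unfolding finite_cring_def finite_cring_axioms_def using e(3) finite_carrier by (simp add: corner_simps)
qed

lemma corner_decomposition:
  assumes e: "e \<in> carrier R" "e \<otimes> e = e"
  shows "R \<simeq> RDirProd (corner R e) (corner R (\<one> \<ominus> e))"
proof -
  let ?f = "\<one> \<ominus> e"
  have f: "?f \<in> carrier R" "?f \<otimes> ?f = ?f" "e \<otimes> ?f = \<zero>" "?f \<otimes> e = \<zero>" "e \<oplus> ?f = \<one>"
    using e by algebra+
  have split: "e \<otimes> x \<oplus> ?f \<otimes> x = x" if "x \<in> carrier R" for x
    using e f that by (metis l_distr l_one)
  have "(\<lambda>x. (e \<otimes> x, ?f \<otimes> x)) \<in> ring_iso R (RDirProd (corner R e) (corner R ?f))"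
  proof (rule ring_iso_memI)
    show "bij_betw (\<lambda>x. (e \<otimes> x, ?f \<otimes> x)) (carrier R) (carrier (RDirProd (corner R e) (corner R ?f)))"
      unfolding bij_betw_def
    proof (intro conjI equalityI subsetI)
      show "inj_on (\<lambda>x. (e \<otimes> x, ?f \<otimes> x)) (carrier R)" by (rule inj_onI) (metis split prod.inject)
      fix z assume "z \<in> carrier (RDirProd (corner R e) (corner R ?f))"
      then obtain x y where z: "z = (e \<otimes> x, ?f \<otimes> y)" "x \<in> carrier R" "y \<in> carrier R"
        by (auto simp: RDirProd_simps corner_simps)
      have "e \<otimes> (e \<otimes> x \<oplus> ?f \<otimes> y) = e \<otimes> x" "?f \<otimes> (e \<otimes> x \<oplus> ?f \<otimes> y) = ?f \<otimes> y"
        using e f z(2,3) by (simp_all add: r_distr flip: m_assoc)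
      then show "z \<in> (\<lambda>x. (e \<otimes> x, ?f \<otimes> x)) ` carrier R"
        using z e f by (intro image_eqI[of _ _ "e \<otimes> x \<oplus> ?f \<otimes> y"]) auto
    qed (auto simp: RDirProd_simps corner_simps)
    fix x y assume xy: "x \<in> carrier R" "y \<in> carrier R"
    have "g \<otimes> (x \<otimes> y) = (g \<otimes> x) \<otimes> (g \<otimes> y)" if "g \<in> carrier R" "g \<otimes> g = g" for g
    proof -
      have "(g \<otimes> x) \<otimes> (g \<otimes> y) = (g \<otimes> g) \<otimes> (x \<otimes> y)" using that(1) xy by algebra
      then show ?thesis using that(2) by simp
    qed
    then show "(e \<otimes> (x \<otimes> y), ?f \<otimes> (x \<otimes> y)) =
        (e \<otimes> x, ?f \<otimes> x) \<otimes>\<^bsub>RDirProd (corner R e) (corner R ?f)\<^esub> (e \<otimes> y, ?f \<otimes> y)"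
      using e f by (simp add: RDirProd_simps corner_simps)
    show "(e \<otimes> (x \<oplus> y), ?f \<otimes> (x \<oplus> y)) =
        (e \<otimes> x, ?f \<otimes> x) \<oplus>\<^bsub>RDirProd (corner R e) (corner R ?f)\<^esub> (e \<otimes> y, ?f \<otimes> y)"
      using e f xy by (simp add: RDirProd_simps corner_simps r_distr)
  qed (use e f in \<open>auto simp: RDirProd_simps corner_simps\<close>)
  then show ?thesis by (auto simp: is_ring_iso_def)
qed

definition indecomposable :: bool where
  "indecomposable \<longleftrightarrow> (\<forall>e \<in> carrier R. e \<otimes> e = e \<longrightarrow> e = \<zero> \<or> e = \<one>)"

lemma decomposable_product:
  assumes "\<not> indecomposable"
  obtains S T :: "('a, 'b) ring_scheme" where "finite_cring S" "finite_cring T" "R \<simeq> RDirProd S T"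
proof -
  obtain e where e: "e \<in> carrier R" "e \<otimes> e = e" "e \<noteq> \<zero>" "e \<noteq> \<one>"
    using assms by (auto simp: indecomposable_def)
  have "\<one> \<ominus> e \<in> carrier R" "(\<one> \<ominus> e) \<otimes> (\<one> \<ominus> e) = \<one> \<ominus> e" using e(1,2) by algebra+
  moreover have "\<one> \<ominus> e \<noteq> \<zero>" using e by (simp add: r_right_minus_eq)
  ultimately show ?thesis
    using that[OF corner_finite_cring[OF e(1-3)] corner_finite_cring corner_decomposition[OF e(1,2)]] by blast
qed

text \<open>An idempotent power of \<open>x\<close> is 1 or 0.\<close>
lemma indecomposable_unit_or_nilpotent:
  assumes "indecomposable" and x: "x \<in> carrier R"
  shows "x \<in> Units R \<or> x \<in> nilpotents R"
proof -
  obtain m :: nat where m: "m > 0" "x [^] m \<otimes> x [^] m = x [^] m" using idempotent_power[OF x] .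
  then consider "x [^] m = \<zero>" | "x [^] m = \<one>" using assms by (auto simp: indecomposable_def)
  then show ?thesis
  proof cases
    case 1
    then show ?thesis using x by (auto simp: nilpotents_def)
  next
    case 2
    obtain k where "m = Suc k" using m(1) by (cases m) auto
    then have "x [^] k \<otimes> x = \<one>" "x \<otimes> x [^] k = \<one>" using 2 x m_comm by auto
    then show ?thesis using x unfolding Units_def by blast
  qed
qed

text \<open>Otherwise \<open>(1 + n) y = 0\<close> for some \<open>y \<noteq> 0\<close>, and some
  nonzero multiple of \<open>y\<close> is annihilated by \<open>1 + n\<close> and by
  \<open>n\<close>.\<close>
lemma one_plus_nilpotent:
  assumes n: "n \<in> nilpotents R" shows "\<one> \<oplus> n \<notin> nilpotents R"
proof
  have nc: "n \<in> carrier R" using n by (simp add: nilpotents_def)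
  assume "\<one> \<oplus> n \<in> nilpotents R"
  then obtain y where y: "y \<in> carrier R" "y \<noteq> \<zero>" "(\<one> \<oplus> n) \<otimes> y = \<zero>" by (rule nilpotent_annihilator)
  obtain k :: nat where k: "n [^] k \<otimes> y \<noteq> \<zero>" "n \<otimes> (n [^] k \<otimes> y) = \<zero>" using nilpotent_kills[OF n y(1,2)] .
  have "(\<one> \<oplus> n) \<otimes> (n [^] k \<otimes> y) = n [^] k \<otimes> ((\<one> \<oplus> n) \<otimes> y)"
    using nc y(1) by (intro m_lcomm) auto
  then have "(\<one> \<oplus> n) \<otimes> (n [^] k \<otimes> y) = \<zero>" using y(3) nc by simp
  moreover have "(\<one> \<oplus> n) \<otimes> (n [^] k \<otimes> y) = n [^] k \<otimes> y \<oplus> n \<otimes> (n [^] k \<otimes> y)"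
    using nc y(1) by (simp add: l_distr)
  ultimately show False using k nc y(1) by simp
qed

text \<open>All elements outside the set of nilpotents are units, so this set is an ideal that
  contains every proper ideal.\<close>
lemma indecomposable_local:
  assumes "indecomposable" shows "local_ring R"
proof -
  note un = indecomposable_unit_or_nilpotent[OF assms]
  let ?N = "nilpotents R"
  have minus: "\<ominus> x \<in> ?N" if "x \<in> ?N" for x
    using nilpotents_mult'[OF that, of "\<ominus> \<one>"] nilpotents_carrier[OF that] by (simp add: l_minus)
  have add: "x \<oplus> y \<in> ?N" if x: "x \<in> ?N" and y: "y \<in> ?N" for x y
  proof (rule ccontr)
    have c: "x \<in> carrier R" "y \<in> carrier R" using x y nilpotents_carrier by blast+
    assume "x \<oplus> y \<notin> ?N"
    then have u: "x \<oplus> y \<in> Units R" using un c by blast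
    define v where "v = inv (x \<oplus> y)"
    have v: "v \<in> carrier R" "v \<otimes> (x \<oplus> y) = \<one>" using u by (simp_all add: v_def)
    have "v \<otimes> x = v \<otimes> (x \<oplus> y) \<oplus> v \<otimes> (\<ominus> y)" using v(1) c by algebra
    then have "v \<otimes> x = \<one> \<oplus> v \<otimes> (\<ominus> y)" unfolding v(2) .
    moreover have "v \<otimes> x \<in> ?N" "v \<otimes> (\<ominus> y) \<in> ?N" using nilpotents_mult' x minus[OF y] v by blast+
    ultimately show False using one_plus_nilpotent by metis
  qed
  have idl: "ideal ?N R"
  proof (rule idealI[OF ring_axioms])
    show "subgroup ?N (add_monoid R)"
    proof (rule group.subgroupI[OF add.group_axioms])
      show "inv\<^bsub>add_monoid R\<^esub> x \<in> ?N" if "x \<in> ?N" for x using minus[OF that] by (simp add: a_inv_def)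
    qed (use zero_nilpotent add nilpotents_carrier in auto)
  qed (auto intro: nilpotents_mult nilpotents_mult')
  have one: "\<one> \<notin> ?N" using unit_not_nilpotent[OF Units_one_closed] .
  have proper: "J \<subseteq> ?N" if J: "ideal J R" "J \<noteq> carrier R" for J
  proof (rule ccontr)
    interpret J: ideal J R by fact
    assume "\<not> J \<subseteq> ?N"
    then obtain x where x: "x \<in> J" "x \<notin> ?N" by blast
    then have "x \<in> Units R" using un J.a_subset by blast
    then have "\<one> \<in> J" using J.I_l_closed[OF x(1), of "inv x"] by simp
    then show False using J.one_imp_carrier J(2) by blast
  qed
  have "maximalideal ?N R"
  proof (rule maximalidealI[OF idl])
    show "carrier R \<noteq> ?N" using one by blast
    show "J = ?N \<or> J = carrier R" if "ideal J R" "?N \<subseteq> J" "J \<subseteq> carrier R" for J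
      using proper[OF that(1)] that(2) by blast
  qed
  moreover have "M = ?N" if M: "maximalideal M R" for M
  proof -
    interpret M: maximalideal M R by fact
    have "M \<subseteq> ?N" using proper[OF M.ideal_axioms] M.I_notcarr by blast
    then have "?N = M \<or> ?N = carrier R" using M.I_maximal[OF idl] nilpotents_carrier by blast
    then show ?thesis using one by blast
  qed
  ultimately show ?thesis unfolding local_ring_def by blast
qed

lemma card_nilpotents_le_units:
  assumes "indecomposable"
  shows "card (nilpotents R) \<le> card (Units R)"
proof (rule card_inj_on_le[of "\<lambda>n. \<one> \<oplus> n"])
  show "inj_on (\<lambda>n. \<one> \<oplus> n) (nilpotents R)"
    by (rule inj_onI) (use nilpotents_carrier in \<open>simp add: add.l_cancel\<close>)
  show "(\<lambda>n. \<one> \<oplus> n) ` nilpotents R \<subseteq> Units R"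
    using one_plus_nilpotent indecomposable_unit_or_nilpotent[OF assms] nilpotents_carrier by blast
  show "finite (Units R)" using finite_carrier Units_closed by (meson finite_subset subsetI)
qed

lemma finite_nilpotents: "finite (nilpotents R)"
  using finite_carrier nilpotents_carrier by (meson finite_subset subsetI)

lemma finite_Units: "finite (Units R)"
  using finite_carrier Units_closed by (meson finite_subset subsetI)

lemma card_carrier_split:
  assumes "indecomposable"
  shows "card (carrier R) = card (Units R) + card (nilpotents R)"
proof -
  have "carrier R = Units R \<union> nilpotents R"
    using indecomposable_unit_or_nilpotent[OF assms] Units_closed nilpotents_carrier by blast
  moreover have "Units R \<inter> nilpotents R = {}" using unit_not_nilpotent by blast
  ultimately show ?thesis using card_Un_disjoint finite_Units finite_nilpotents by metis
qed

end

section \<open>Essential graphs of products\<close>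

lemma (in finite_cring) card_carrier_ge_2: "2 \<le> card (carrier R)"
proof -
  have "card {\<zero>, \<one>} \<le> card (carrier R)" by (rule card_mono[OF finite_carrier]) auto
  then show ?thesis using nontrivial by simp
qed

lemma (in finite_cring) card_2_carrier:
  assumes "card (carrier R) = 2" shows "carrier R = {\<zero>, \<one>}"
  by (rule card_seteq[symmetric]) (use finite_carrier assms nontrivial in auto)

lemma (in finite_cring) card_2_nilpotents:
  assumes "card (carrier R) = 2" shows "nilpotents R = {\<zero>}"
  using card_2_carrier[OF assms] nilpotents_carrier zero_nilpotent unit_not_nilpotent[OF Units_one_closed] by blast

lemma (in finite_cring) card_2_indecomposable:
  assumes "card (carrier R) = 2" shows "indecomposable"
  using card_2_carrier[OF assms] by (auto simp: indecomposable_def)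

subsection \<open>Three factors\<close>

text \<open>If one factor has at least three elements, take the unit elements of the two other
  factors: each of them is annihilated by at least \<open>2 * 3\<close> elements.\<close>
lemma three_factors_not_projective:
  assumes "finite_cring S" "finite_cring T" "finite_cring Q"
    and big: "card (carrier S) \<noteq> 2 \<or> card (carrier T) \<noteq> 2 \<or> card (carrier Q) \<noteq> 2"
  shows "\<not> projective (line_graph (essential_graph (RDirProd S (RDirProd T Q))))"
proof -
  interpret S: finite_cring S by fact
  interpret T: finite_cring T by fact
  interpret Q: finite_cring Q by fact
  let ?P = "RDirProd S (RDirProd T Q)"
  interpret P: finite_cring ?P by (intro finite_cring_RDirProd) fact+
  note c2 = S.card_carrier_ge_2 T.card_carrier_ge_2 Q.card_carrier_ge_2
  have fin: "finite (ann ?P x)" for x using P.finite_carrier by (rule rev_finite_subset) (auto simp: ann_def)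
  have big_prod: "m * n \<ge> 6" if "m \<ge> 2 \<and> n \<ge> 3 \<or> m \<ge> 3 \<and> n \<ge> 2" for m n :: nat
    using that mult_le_mono[of 2 m 3 n] mult_le_mono[of 3 m 2 n] by auto
  have annS: "card (carrier T) * card (carrier Q) \<le> card (ann ?P (\<one>\<^bsub>S\<^esub>, \<zero>\<^bsub>T\<^esub>, \<zero>\<^bsub>Q\<^esub>))"
  proof -
    have "card ({\<zero>\<^bsub>S\<^esub>} \<times> carrier T \<times> carrier Q) \<le> card (ann ?P (\<one>\<^bsub>S\<^esub>, \<zero>\<^bsub>T\<^esub>, \<zero>\<^bsub>Q\<^esub>))"
      by (rule card_mono[OF fin]) (auto simp: ann_def RDirProd_simps)
    then show ?thesis by (simp add: card_cartesian_product)
  qed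
  have annT: "card (carrier S) * card (carrier Q) \<le> card (ann ?P (\<zero>\<^bsub>S\<^esub>, \<one>\<^bsub>T\<^esub>, \<zero>\<^bsub>Q\<^esub>))"
  proof -
    have "card (carrier S \<times> {\<zero>\<^bsub>T\<^esub>} \<times> carrier Q) \<le> card (ann ?P (\<zero>\<^bsub>S\<^esub>, \<one>\<^bsub>T\<^esub>, \<zero>\<^bsub>Q\<^esub>))"
      by (rule card_mono[OF fin]) (auto simp: ann_def RDirProd_simps)
    then show ?thesis by (simp add: card_cartesian_product)
  qed
  have annQ: "card (carrier S) * card (carrier T) \<le> card (ann ?P (\<zero>\<^bsub>S\<^esub>, \<zero>\<^bsub>T\<^esub>, \<one>\<^bsub>Q\<^esub>))"
  proof -
    have "card (carrier S \<times> carrier T \<times> {\<zero>\<^bsub>Q\<^esub>}) \<le> card (ann ?P (\<zero>\<^bsub>S\<^esub>, \<zero>\<^bsub>T\<^esub>, \<one>\<^bsub>Q\<^esub>))"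
      by (rule card_mono[OF fin]) (auto simp: ann_def RDirProd_simps)
    then show ?thesis by (simp add: card_cartesian_product)
  qed
  consider "card (carrier S) \<ge> 3" | "card (carrier T) \<ge> 3" | "card (carrier Q) \<ge> 3" using big c2 by linarith
  then show ?thesis
  proof cases
    case 1
    show ?thesis
      by (rule P.double_star_not_projective[of "(\<zero>\<^bsub>S\<^esub>, \<one>\<^bsub>T\<^esub>, \<zero>\<^bsub>Q\<^esub>)" "(\<zero>\<^bsub>S\<^esub>, \<zero>\<^bsub>T\<^esub>, \<one>\<^bsub>Q\<^esub>)"])
        (use order_trans[OF big_prod annT] order_trans[OF big_prod annQ] 1 c2 T.nontrivial Q.nontrivial
          in \<open>simp_all add: RDirProd_simps\<close>)
  next
    case 2
    show ?thesis
      by (rule P.double_star_not_projective[of "(\<one>\<^bsub>S\<^esub>, \<zero>\<^bsub>T\<^esub>, \<zero>\<^bsub>Q\<^esub>)" "(\<zero>\<^bsub>S\<^esub>, \<zero>\<^bsub>T\<^esub>, \<one>\<^bsub>Q\<^esub>)"])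
        (use order_trans[OF big_prod annS] order_trans[OF big_prod annQ] 2 c2 S.nontrivial Q.nontrivial
          in \<open>simp_all add: RDirProd_simps\<close>)
  next
    case 3
    show ?thesis
      by (rule P.double_star_not_projective[of "(\<one>\<^bsub>S\<^esub>, \<zero>\<^bsub>T\<^esub>, \<zero>\<^bsub>Q\<^esub>)" "(\<zero>\<^bsub>S\<^esub>, \<one>\<^bsub>T\<^esub>, \<zero>\<^bsub>Q\<^esub>)"])
        (use order_trans[OF big_prod annS] order_trans[OF big_prod annT] 3 c2 S.nontrivial T.nontrivial
          in \<open>simp_all add: RDirProd_simps\<close>)
  qed
qed

text \<open>The essential graph of the product of three rings of order 2 is the net: the elements
  with one nonzero component form a triangle, and the pendant neighbour of each is its complement.
  The labels 6 and 7 only make the function injective.\<close>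
definition net_label :: "bool \<times> bool \<times> bool \<Rightarrow> nat" where
  "net_label s =
     (if s = (True, False, False) then 0 else if s = (False, True, False) then 1
      else if s = (False, False, True) then 2 else if s = (False, True, True) then 3
      else if s = (True, False, True) then 4 else if s = (True, True, False) then 5
      else if s = (True, True, True) then 6 else 7)"

lemma inj_net_label: "inj net_label"
proof (rule injI)
  fix s s' assume eq: "net_label s = net_label s'"
  obtain a b c a' b' c' where ss: "s = (a, b, c)" "s' = (a', b', c')" by (cases s; cases s') blast
  show "s = s'"
    using eq unfolding ss
    by (cases a; cases b; cases c; cases a'; cases b'; cases c') (simp_all add: net_label_def)
qed

lemma net_label_edge:
  assumes "\<not> (a \<and> a')" "\<not> (b \<and> b')" "\<not> (c \<and> c')" "a \<or> b \<or> c" "a' \<or> b' \<or> c'"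
  shows "{net_label (a, b, c), net_label (a', b', c')} \<in> edge_set net_edges"
  using assms
  by (cases a; cases b; cases c; cases a'; cases b'; cases c')
    (simp_all add: net_label_def edge_set_def net_edges_def doubleton_eq_iff)

lemma three_factors_planar:
  assumes "finite_cring S" "finite_cring T" "finite_cring Q"
    and two: "card (carrier S) = 2" "card (carrier T) = 2" "card (carrier Q) = 2"
  shows "planar (line_graph (essential_graph (RDirProd S (RDirProd T Q))))"
proof -
  interpret S: finite_cring S by fact
  interpret T: finite_cring T by fact
  interpret Q: finite_cring Q by fact
  let ?P = "RDirProd S (RDirProd T Q)"
  interpret P: finite_cring ?P by (intro finite_cring_RDirProd) fact+
  note car = S.card_2_carrier[OF two(1)] T.card_2_carrier[OF two(2)] Q.card_2_carrier[OF two(3)]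
  have nil: "nilpotents ?P = {\<zero>\<^bsub>S\<^esub>} \<times> {\<zero>\<^bsub>T\<^esub>} \<times> {\<zero>\<^bsub>Q\<^esub>}"
    using S.card_2_nilpotents T.card_2_nilpotents Q.card_2_nilpotents two
    by (simp add: nilpotents_RDirProd finite_cring_RDirProd assms)
  define \<tau> where "\<tau> = (\<lambda>(x, y, z). (x \<noteq> \<zero>\<^bsub>S\<^esub>, y \<noteq> \<zero>\<^bsub>T\<^esub>, z \<noteq> \<zero>\<^bsub>Q\<^esub>))"
  have "inj_on \<tau> (carrier ?P)"
    by (rule inj_onI) (auto simp: \<tau>_def RDirProd_simps car)
  then have inj: "inj_on (net_label \<circ> \<tau>) (fst (essential_graph ?P))"
  proof -
    assume "inj_on \<tau> (carrier ?P)"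
    then have "inj_on \<tau> (fst (essential_graph ?P))"
      by (rule inj_on_subset) (use P.zero_divisors_carrier in \<open>auto simp: P.essential_graph_vertices\<close>)
    then show ?thesis by (rule comp_inj_on) (rule inj_on_subset[OF inj_net_label subset_UNIV])
  qed
  show ?thesis unfolding planar_def
  proof (rule line_graph_spherical[OF net_drawing_valid _ P.simple_essential_graph inj])
    show "\<forall>(i, j, s) \<in> set (snd net_drawing). \<not> s" by (simp add: net_drawing_def)
    fix e assume "e \<in> snd (essential_graph ?P)"
    then obtain u v where e: "e = {u, v}" "u \<in> zero_divisors ?P - {\<zero>\<^bsub>?P\<^esub>}" "v \<in> zero_divisors ?P - {\<zero>\<^bsub>?P\<^esub>}"
      "u \<otimes>\<^bsub>?P\<^esub> v \<in> nilpotents ?P"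
      by (rule P.essential_graph_edgeE)
    obtain a b c where u: "u = (a, b, c)" by (cases u)
    obtain a' b' c' where v: "v = (a', b', c')" by (cases v)
    have mem: "a \<in> {\<zero>\<^bsub>S\<^esub>, \<one>\<^bsub>S\<^esub>}" "b \<in> {\<zero>\<^bsub>T\<^esub>, \<one>\<^bsub>T\<^esub>}" "c \<in> {\<zero>\<^bsub>Q\<^esub>, \<one>\<^bsub>Q\<^esub>}"
      "a' \<in> {\<zero>\<^bsub>S\<^esub>, \<one>\<^bsub>S\<^esub>}" "b' \<in> {\<zero>\<^bsub>T\<^esub>, \<one>\<^bsub>T\<^esub>}" "c' \<in> {\<zero>\<^bsub>Q\<^esub>, \<one>\<^bsub>Q\<^esub>}"
      using e(2,3) by (auto simp: zero_divisors_def RDirProd_simps car u v)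
    have nz: "u \<noteq> \<zero>\<^bsub>?P\<^esub>" "v \<noteq> \<zero>\<^bsub>?P\<^esub>" using e(2,3) by auto
    have "a \<otimes>\<^bsub>S\<^esub> a' = \<zero>\<^bsub>S\<^esub>" "b \<otimes>\<^bsub>T\<^esub> b' = \<zero>\<^bsub>T\<^esub>" "c \<otimes>\<^bsub>Q\<^esub> c' = \<zero>\<^bsub>Q\<^esub>"
      using e(4) by (simp_all add: nil u v RDirProd_simps)
    then have "\<not> (a \<noteq> \<zero>\<^bsub>S\<^esub> \<and> a' \<noteq> \<zero>\<^bsub>S\<^esub>)" "\<not> (b \<noteq> \<zero>\<^bsub>T\<^esub> \<and> b' \<noteq> \<zero>\<^bsub>T\<^esub>)" "\<not> (c \<noteq> \<zero>\<^bsub>Q\<^esub> \<and> c' \<noteq> \<zero>\<^bsub>Q\<^esub>)"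
      using mem S.nontrivial T.nontrivial Q.nontrivial by auto
    moreover have "a \<noteq> \<zero>\<^bsub>S\<^esub> \<or> b \<noteq> \<zero>\<^bsub>T\<^esub> \<or> c \<noteq> \<zero>\<^bsub>Q\<^esub>" "a' \<noteq> \<zero>\<^bsub>S\<^esub> \<or> b' \<noteq> \<zero>\<^bsub>T\<^esub> \<or> c' \<noteq> \<zero>\<^bsub>Q\<^esub>"
      using nz by (auto simp: u v RDirProd_simps)
    ultimately have "{net_label (\<tau> u), net_label (\<tau> v)} \<in> edge_set net_edges"
      unfolding u v \<tau>_def split by (rule net_label_edge)
    then show "(net_label \<circ> \<tau>) ` e \<in> edge_set net_edges" by (simp add: e(1))
  qed
qed

subsection \<open>Two factors\<close>

lemma product_zero_divisors:
  assumes S: "finite_cring S" "finite_cring.indecomposable S" and T: "finite_cring T" "finite_cring.indecomposable T"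
  shows "zero_divisors (RDirProd S T) = carrier S \<times> nilpotents T \<union> nilpotents S \<times> carrier T"
proof -
  interpret S: finite_cring S by fact
  interpret T: finite_cring T by fact
  interpret P: finite_cring "RDirProd S T" by (rule finite_cring_RDirProd) fact+
  show ?thesis
  proof (intro equalityI subsetI)
    fix z assume z: "z \<in> zero_divisors (RDirProd S T)"
    obtain x y where xy: "z = (x, y)" "x \<in> carrier S" "y \<in> carrier T"
      using z by (auto simp: zero_divisors_def RDirProd_simps)
    have "\<not> (x \<in> Units S \<and> y \<in> Units T)"
    proof
      assume U: "x \<in> Units S \<and> y \<in> Units T"
      then obtain x' y' where "x' \<in> carrier S" "x' \<otimes>\<^bsub>S\<^esub> x = \<one>\<^bsub>S\<^esub>" "x \<otimes>\<^bsub>S\<^esub> x' = \<one>\<^bsub>S\<^esub>"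
        "y' \<in> carrier T" "y' \<otimes>\<^bsub>T\<^esub> y = \<one>\<^bsub>T\<^esub>" "y \<otimes>\<^bsub>T\<^esub> y' = \<one>\<^bsub>T\<^esub>"
        by (auto simp: Units_def)
      then have "z \<in> Units (RDirProd S T)"
        using xy by (auto simp: Units_def RDirProd_simps intro!: bexI[of _ "(x', y')"])
      then show False using P.unit_not_zero_divisor z by blast
    qed
    then have "x \<in> nilpotents S \<or> y \<in> nilpotents T"
      using S.indecomposable_unit_or_nilpotent[OF S(2) xy(2)] T.indecomposable_unit_or_nilpotent[OF T(2) xy(3)] by blast
    then show "z \<in> carrier S \<times> nilpotents T \<union> nilpotents S \<times> carrier T" using xy by blast
  next
    fix z assume "z \<in> carrier S \<times> nilpotents T \<union> nilpotents S \<times> carrier T"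
    then consider x y where "z = (x, y)" "x \<in> carrier S" "y \<in> nilpotents T"
      | x y where "z = (x, y)" "x \<in> nilpotents S" "y \<in> carrier T" by blast
    then show "z \<in> zero_divisors (RDirProd S T)"
    proof cases
      case 1
      obtain w where w: "w \<in> carrier T" "w \<noteq> \<zero>\<^bsub>T\<^esub>" "y \<otimes>\<^bsub>T\<^esub> w = \<zero>\<^bsub>T\<^esub>" using T.nilpotent_annihilator[OF 1(3)] .
      have "(\<zero>\<^bsub>S\<^esub>, w) \<in> carrier (RDirProd S T)" "(\<zero>\<^bsub>S\<^esub>, w) \<noteq> \<zero>\<^bsub>RDirProd S T\<^esub>"
        "z \<otimes>\<^bsub>RDirProd S T\<^esub> (\<zero>\<^bsub>S\<^esub>, w) = \<zero>\<^bsub>RDirProd S T\<^esub>" "z \<in> carrier (RDirProd S T)"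
        using 1 w T.nilpotents_carrier by (simp_all add: RDirProd_simps)
      then show ?thesis unfolding zero_divisors_def by blast
    next
      case 2
      obtain w where w: "w \<in> carrier S" "w \<noteq> \<zero>\<^bsub>S\<^esub>" "x \<otimes>\<^bsub>S\<^esub> w = \<zero>\<^bsub>S\<^esub>" using S.nilpotent_annihilator[OF 2(2)] .
      have "(w, \<zero>\<^bsub>T\<^esub>) \<in> carrier (RDirProd S T)" "(w, \<zero>\<^bsub>T\<^esub>) \<noteq> \<zero>\<^bsub>RDirProd S T\<^esub>"
        "z \<otimes>\<^bsub>RDirProd S T\<^esub> (w, \<zero>\<^bsub>T\<^esub>) = \<zero>\<^bsub>RDirProd S T\<^esub>" "z \<in> carrier (RDirProd S T)"
        using 2 w S.nilpotents_carrier by (simp_all add: RDirProd_simps)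
      then show ?thesis unfolding zero_divisors_def by blast
    qed
  qed
qed

text \<open>Both components of \<open>u v\<close> are nilpotent, the first because of
  \<open>v\<close> and the second because of \<open>u\<close>.\<close>
lemma product_edge:
  assumes S: "finite_cring S" "finite_cring.indecomposable S" and T: "finite_cring T" "finite_cring.indecomposable T"
    and u: "u \<in> carrier S \<times> nilpotents T - {(\<zero>\<^bsub>S\<^esub>, \<zero>\<^bsub>T\<^esub>)}" and v: "v \<in> nilpotents S \<times> Units T"
  shows "{u, v} \<in> snd (essential_graph (RDirProd S T))"
proof -
  interpret S: finite_cring S by fact
  interpret T: finite_cring T by fact
  interpret P: finite_cring "RDirProd S T" by (rule finite_cring_RDirProd) fact+
  obtain a b where ab: "u = (a, b)" "a \<in> carrier S" "b \<in> nilpotents T" using u by blast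
  obtain c d where cd: "v = (c, d)" "c \<in> nilpotents S" "d \<in> Units T" using v by blast
  have "u \<noteq> v" using ab cd T.unit_not_nilpotent by blast
  moreover have "d \<noteq> \<zero>\<^bsub>T\<^esub>" using T.unit_not_nilpotent[OF cd(3)] T.zero_nilpotent by blast
  moreover have "a \<otimes>\<^bsub>S\<^esub> c \<in> nilpotents S" "b \<otimes>\<^bsub>T\<^esub> d \<in> nilpotents T"
    using S.nilpotents_mult'[OF cd(2) ab(2)] T.nilpotents_mult[OF ab(3)] cd(3) by auto
  moreover have "nilpotents (RDirProd S T) = nilpotents S \<times> nilpotents T" by (rule nilpotents_RDirProd) fact+
  ultimately show ?thesis
    unfolding P.essential_graph_edge_iff product_zero_divisors[OF S T]
    using u ab cd by (auto simp: RDirProd_simps)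
qed

text \<open>By \<open>product_edge\<close> the graph contains a complete bipartite graph with
  classes of sizes \<open>|S| |nil T| - 1\<close> and \<open>|nil S| |units T|\<close>.\<close>
lemma product_K24:
  assumes S: "finite_cring S" "finite_cring.indecomposable S" and T: "finite_cring T" "finite_cring.indecomposable T"
    and big: "card (carrier S) * card (nilpotents T) \<ge> 5 \<and> card (nilpotents S) * card (Units T) \<ge> 2 \<or>
      card (carrier S) * card (nilpotents T) \<ge> 3 \<and> card (nilpotents S) * card (Units T) \<ge> 4"
  shows "\<not> projective (line_graph (essential_graph (RDirProd S T)))"
proof -
  interpret S: finite_cring S by fact
  interpret T: finite_cring T by fact
  interpret P: finite_cring "RDirProd S T" by (rule finite_cring_RDirProd) fact+
  let ?A = "carrier S \<times> nilpotents T - {(\<zero>\<^bsub>S\<^esub>, \<zero>\<^bsub>T\<^esub>)}" and ?B = "nilpotents S \<times> Units T"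
  note edge = product_edge[OF S T]
  have fin: "finite (carrier S \<times> nilpotents T)"
    using S.finite_carrier T.finite_nilpotents by simp
  have cA: "card ?A = card (carrier S) * card (nilpotents T) - 1"
    using fin T.zero_nilpotent by (simp add: card_cartesian_product)
  have cB: "card ?B = card (nilpotents S) * card (Units T)" by (simp add: card_cartesian_product)
  have K24: "\<not> projective (line_graph (essential_graph (RDirProd S T)))"
    if E: "\<And>u v. u \<in> X' \<Longrightarrow> v \<in> Y' \<Longrightarrow> {u, v} \<in> snd (essential_graph (RDirProd S T))" and c: "2 \<le> card X'" "4 \<le> card Y'" for X' Y'
  proof -
    obtain U where U: "U \<subseteq> X'" "card U = 2" using c(1) by (rule obtain_subset_with_card_n)
    obtain u v where uv: "U = {u, v}" "u \<noteq> v" using U(2) by (auto simp: card_2_iff)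
    obtain N where N: "N \<subseteq> Y'" "card N = 4" using c(2) by (rule obtain_subset_with_card_n)
    show ?thesis
      by (rule line_graph_K24[OF P.simple_essential_graph uv(2) _ _ N(2)]) (use E U(1) uv(1) N(1) in blast)+
  qed
  from big show ?thesis
  proof
    assume "card (carrier S) * card (nilpotents T) \<ge> 5 \<and> card (nilpotents S) * card (Units T) \<ge> 2"
    then have "2 \<le> card ?B" "4 \<le> card ?A" unfolding cA cB by linarith+
    moreover have "{u, v} \<in> snd (essential_graph (RDirProd S T))" if "u \<in> ?B" "v \<in> ?A" for u v
      using edge[OF that(2,1)] by (simp add: insert_commute)
    ultimately show ?thesis by (intro K24[of ?B ?A])
  next
    assume "card (carrier S) * card (nilpotents T) \<ge> 3 \<and> card (nilpotents S) * card (Units T) \<ge> 4"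
    then have "2 \<le> card ?A" "4 \<le> card ?B" unfolding cA cB by linarith+
    then show ?thesis using edge by (intro K24[of ?A ?B])
  qed
qed

text \<open>The vertex \<open>(1, 0)\<close> is adjacent to \<open>(0, t)\<close> for every unit
  \<open>t\<close>.\<close>
lemma product_star:
  assumes S: "finite_cring S" "finite_cring.indecomposable S" and T: "finite_cring T" "finite_cring.indecomposable T"
  shows "card (Units T) \<ge> 7 \<Longrightarrow> \<not> projective (line_graph (essential_graph (RDirProd S T)))"
    and "card (Units T) \<ge> 5 \<Longrightarrow> \<not> planar (line_graph (essential_graph (RDirProd S T)))"
proof -
  interpret S: finite_cring S by fact
  interpret T: finite_cring T by fact
  interpret P: finite_cring "RDirProd S T" by (rule finite_cring_RDirProd) fact+
  have star: "\<exists>N. card N = n \<and> (\<forall>w \<in> N. {(\<one>\<^bsub>S\<^esub>, \<zero>\<^bsub>T\<^esub>), w} \<in> snd (essential_graph (RDirProd S T)))"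
    if le: "n \<le> card (Units T)" for n
  proof -
    obtain U where U: "U \<subseteq> Units T" "card U = n" using le by (rule obtain_subset_with_card_n)
    have "card ({\<zero>\<^bsub>S\<^esub>} \<times> U) = n" using U(2) by (simp add: card_cartesian_product)
    moreover have "{(\<one>\<^bsub>S\<^esub>, \<zero>\<^bsub>T\<^esub>), w} \<in> snd (essential_graph (RDirProd S T))" if "w \<in> {\<zero>\<^bsub>S\<^esub>} \<times> U" for w
      using that U(1) S.zero_nilpotent T.zero_nilpotent S.nontrivial by (intro product_edge[OF S T]) auto
    ultimately show ?thesis by blast
  qed
  show "card (Units T) \<ge> 7 \<Longrightarrow> \<not> projective (line_graph (essential_graph (RDirProd S T)))"
    using star[of 7] line_graph_seven_star[OF P.simple_essential_graph] by blast
  show "card (Units T) \<ge> 5 \<Longrightarrow> \<not> planar (line_graph (essential_graph (RDirProd S T)))"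
    using star[of 5] line_graph_five_star[OF P.simple_essential_graph] by blast
qed

lemma finite_label:
  assumes "finite A" "card A \<le> n" obtains \<beta> :: "'a \<Rightarrow> nat" where "inj_on \<beta> A" "\<beta> ` A \<subseteq> {..<n}"
proof -
  obtain \<beta> :: "'a \<Rightarrow> nat" where \<beta>: "bij_betw \<beta> A {0..<card A}"
    using ex_bij_betw_finite_nat[OF assms(1)] by blast
  show ?thesis
  proof (rule that)
    show "inj_on \<beta> A" using \<beta> by (simp add: bij_betw_def)
    show "\<beta> ` A \<subseteq> {..<n}" using \<beta> assms(2) by (auto simp: bij_betw_def)
  qed
qed

lemma card_2_memberE:
  assumes "card K = 2" "a \<in> K" obtains b where "K = {a, b}" "b \<noteq> a"
proof -
  obtain x y where xy: "K = {x, y}" "x \<noteq> y" using assms(1) by (auto simp: card_2_iff)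
  show ?thesis
  proof (cases "a = x")
    case False
    then have "a = y" using assms(2) xy(1) by simp
    then show ?thesis using that[of x] xy by (simp add: insert_commute)
  qed (use that[of y] xy in simp)
qed

text \<open>The essential graph of a product of two fields is complete bipartite; numbering the
  classes from 0 and from \<open>m\<close> embeds it in \<open>hs\<close>.\<close>
lemma field_product_label:
  assumes S: "finite_cring S" "finite_cring.indecomposable S" "nilpotents S = {\<zero>\<^bsub>S\<^esub>}"
    and T: "finite_cring T" "finite_cring.indecomposable T" "nilpotents T = {\<zero>\<^bsub>T\<^esub>}"
    and card: "card (Units S) \<le> m" "card (Units T) \<le> n"
    and hs: "\<forall>i<m. \<forall>j<n. {i, m + j} \<in> edge_set hs"
  shows "\<exists>\<phi>. inj_on \<phi> (fst (essential_graph (RDirProd S T))) \<and>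
    (\<forall>e \<in> snd (essential_graph (RDirProd S T)). \<phi> ` e \<in> edge_set hs)"
proof -
  interpret S: finite_cring S by fact
  interpret T: finite_cring T by fact
  interpret P: finite_cring "RDirProd S T" by (rule finite_cring_RDirProd) fact+
  obtain \<beta> where \<beta>: "inj_on \<beta> (Units S)" "\<beta> ` Units S \<subseteq> {..<m}" using finite_label[OF S.finite_Units card(1)] .
  obtain \<gamma> where \<gamma>: "inj_on \<gamma> (Units T)" "\<gamma> ` Units T \<subseteq> {..<n}" using finite_label[OF T.finite_Units card(2)] .
  define \<phi> where "\<phi> = (\<lambda>(x, y). if y = \<zero>\<^bsub>T\<^esub> then \<beta> x else m + \<gamma> y)"
  have US: "x \<in> Units S" if "x \<in> carrier S" "x \<noteq> \<zero>\<^bsub>S\<^esub>" for x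
    using S.indecomposable_unit_or_nilpotent[OF S(2) that(1)] that(2) S(3) by blast
  have UT: "y \<in> Units T" if "y \<in> carrier T" "y \<noteq> \<zero>\<^bsub>T\<^esub>" for y
    using T.indecomposable_unit_or_nilpotent[OF T(2) that(1)] that(2) T(3) by blast
  have V: "(\<exists>x \<in> Units S. u = (x, \<zero>\<^bsub>T\<^esub>)) \<or> (\<exists>y \<in> Units T. y \<noteq> \<zero>\<^bsub>T\<^esub> \<and> u = (\<zero>\<^bsub>S\<^esub>, y))"
    if "u \<in> zero_divisors (RDirProd S T) - {\<zero>\<^bsub>RDirProd S T\<^esub>}" for u
    using that US UT unfolding product_zero_divisors[OF S(1,2) T(1,2)] S(3) T(3) by (auto simp: RDirProd_simps)
  have lt: "\<beta> x < m" if "x \<in> Units S" for x using \<beta>(2) that by auto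
  have lt': "\<gamma> x < n" if "x \<in> Units T" for x using \<gamma>(2) that by auto
  have inj: "inj_on \<phi> (fst (essential_graph (RDirProd S T)))"
    unfolding P.essential_graph_vertices
  proof (rule inj_onI)
    fix u v assume u: "u \<in> zero_divisors (RDirProd S T) - {\<zero>\<^bsub>RDirProd S T\<^esub>}"
      and v: "v \<in> zero_divisors (RDirProd S T) - {\<zero>\<^bsub>RDirProd S T\<^esub>}" and eq: "\<phi> u = \<phi> v"
    from V[OF u] V[OF v] show "u = v"
    proof (elim disjE bexE conjE)
      fix x x' assume "x \<in> Units S" "x' \<in> Units S" "u = (x, \<zero>\<^bsub>T\<^esub>)" "v = (x', \<zero>\<^bsub>T\<^esub>)"
      then show ?thesis using eq inj_onD[OF \<beta>(1), of x x'] by (simp add: \<phi>_def)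
    next
      fix x y assume "x \<in> Units S" "u = (x, \<zero>\<^bsub>T\<^esub>)" "y \<noteq> \<zero>\<^bsub>T\<^esub>" "v = (\<zero>\<^bsub>S\<^esub>, y)"
      then show ?thesis using eq lt[of x] by (simp add: \<phi>_def)
    next
      fix x y assume "x \<in> Units S" "v = (x, \<zero>\<^bsub>T\<^esub>)" "y \<noteq> \<zero>\<^bsub>T\<^esub>" "u = (\<zero>\<^bsub>S\<^esub>, y)"
      then show ?thesis using eq lt[of x] by (simp add: \<phi>_def)
    next
      fix y y' assume "y \<in> Units T" "y' \<in> Units T" "y \<noteq> \<zero>\<^bsub>T\<^esub>" "y' \<noteq> \<zero>\<^bsub>T\<^esub>"
        "u = (\<zero>\<^bsub>S\<^esub>, y)" "v = (\<zero>\<^bsub>S\<^esub>, y')"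
      then show ?thesis using eq inj_onD[OF \<gamma>(1), of y y'] by (simp add: \<phi>_def)
    qed
  qed
  have "\<phi> ` e \<in> edge_set hs" if e: "e \<in> snd (essential_graph (RDirProd S T))" for e
  proof -
    obtain u v where uv: "e = {u, v}" "u \<in> zero_divisors (RDirProd S T) - {\<zero>\<^bsub>RDirProd S T\<^esub>}"
      "v \<in> zero_divisors (RDirProd S T) - {\<zero>\<^bsub>RDirProd S T\<^esub>}" "u \<otimes>\<^bsub>RDirProd S T\<^esub> v \<in> nilpotents (RDirProd S T)"
      using P.essential_graph_edgeE[OF e] by metis
    have nil: "nilpotents (RDirProd S T) = {\<zero>\<^bsub>S\<^esub>} \<times> {\<zero>\<^bsub>T\<^esub>}"
      using nilpotents_RDirProd[OF S(1) T(1)] S(3) T(3) by simp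
    have nS: "x \<otimes>\<^bsub>S\<^esub> x' \<noteq> \<zero>\<^bsub>S\<^esub>" if "x \<in> Units S" "x' \<in> Units S" for x x'
      using S.unit_not_nilpotent[OF S.Units_m_closed[OF that]] S(3) by blast
    have nT: "x \<otimes>\<^bsub>T\<^esub> x' \<noteq> \<zero>\<^bsub>T\<^esub>" if "x \<in> Units T" "x' \<in> Units T" for x x'
      using T.unit_not_nilpotent[OF T.Units_m_closed[OF that]] T(3) by blast
    from V[OF uv(2)] V[OF uv(3)] uv(4) consider
      x y where "x \<in> Units S" "y \<in> Units T" "y \<noteq> \<zero>\<^bsub>T\<^esub>" "e = {(x, \<zero>\<^bsub>T\<^esub>), (\<zero>\<^bsub>S\<^esub>, y)}"
      using nS nT unfolding nil uv(1) by (auto simp: RDirProd_simps insert_commute)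
    then show ?thesis using hs lt lt' by cases (simp add: \<phi>_def)
  qed
  then show ?thesis using inj by blast
qed

text \<open>The hub is \<open>(0, n)\<close> with the nilpotent \<open>n\<close>, and the rim runs
  through \<open>(1, 0)\<close>, \<open>(0, 1)\<close>, \<open>(1, n)\<close>, \<open>(0,
  w)\<close>, where \<open>w\<close> is the other unit of \<open>T\<close>.\<close>
lemma wheel_product:
  assumes S: "finite_cring S" and T: "finite_cring T" "finite_cring.indecomposable T"
    and card: "card (carrier S) = 2" "card (carrier T) = 4" "card (nilpotents T) = 2"
  shows "projective (line_graph (essential_graph (RDirProd S T)))"
    and "\<not> planar (line_graph (essential_graph (RDirProd S T)))"
proof -
  interpret S: finite_cring S by fact
  interpret T: finite_cring T by fact
  let ?P = "RDirProd S T"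
  interpret P: finite_cring ?P by (rule finite_cring_RDirProd) fact+
  have Si: "finite_cring.indecomposable S" by (rule S.card_2_indecomposable[OF card(1)])
  have Sc: "carrier S = {\<zero>\<^bsub>S\<^esub>, \<one>\<^bsub>S\<^esub>}" and Sn: "nilpotents S = {\<zero>\<^bsub>S\<^esub>}"
    using S.card_2_carrier S.card_2_nilpotents card(1) by blast+
  obtain n where n: "nilpotents T = {\<zero>\<^bsub>T\<^esub>, n}" "n \<noteq> \<zero>\<^bsub>T\<^esub>"
    by (rule card_2_memberE[OF card(3) T.zero_nilpotent])
  have "card (Units T) = 2" using T.card_carrier_split[OF T(2)] card by simp
  then obtain w where w: "Units T = {\<one>\<^bsub>T\<^esub>, w}" "w \<noteq> \<one>\<^bsub>T\<^esub>"
    using card_2_memberE[OF _ T.Units_one_closed] by metis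
  have Tc: "carrier T = {\<zero>\<^bsub>T\<^esub>, n, \<one>\<^bsub>T\<^esub>, w}"
    using T.indecomposable_unit_or_nilpotent[OF T(2)] T.Units_closed T.nilpotents_carrier n w by blast
  have ne: "\<one>\<^bsub>T\<^esub> \<noteq> \<zero>\<^bsub>T\<^esub>" "w \<noteq> \<zero>\<^bsub>T\<^esub>" "\<one>\<^bsub>T\<^esub> \<noteq> n" "w \<noteq> n"
    using T.unit_not_nilpotent[of "\<one>\<^bsub>T\<^esub>"] T.unit_not_nilpotent[of w] n(1) w(1) by auto
  let ?h = "(\<zero>\<^bsub>S\<^esub>, n)" and ?a = "(\<one>\<^bsub>S\<^esub>, \<zero>\<^bsub>T\<^esub>)" and ?b = "(\<zero>\<^bsub>S\<^esub>, \<one>\<^bsub>T\<^esub>)" and ?c = "(\<one>\<^bsub>S\<^esub>, n)" and ?d = "(\<zero>\<^bsub>S\<^esub>, w)"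
  have dist: "distinct [?h, ?a, ?b, ?c, ?d]" using n(2) w(2) ne S.nontrivial by auto
  have V: "zero_divisors ?P - {\<zero>\<^bsub>?P\<^esub>} = {?h, ?a, ?b, ?c, ?d}"
    unfolding product_zero_divisors[OF S Si T] Sc Sn Tc n(1) using n(2) ne S.nontrivial
    by (auto simp: RDirProd_simps)
  have nilP: "nilpotents ?P = {\<zero>\<^bsub>S\<^esub>} \<times> {\<zero>\<^bsub>T\<^esub>, n}"
    using nilpotents_RDirProd[OF S T(1)] Sn n(1) by simp
  define \<phi> where "\<phi> u = (if u = ?h then 0 else if u = ?a then 1 else if u = ?b then 2 else if u = ?c then 3 else 4 :: nat)" for u
  have \<phi>: "\<phi> ?h = 0" "\<phi> ?a = 1" "\<phi> ?b = 2" "\<phi> ?c = 3" "\<phi> ?d = 4" using dist by (auto simp: \<phi>_def)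
  have inj: "inj_on \<phi> (fst (essential_graph ?P))"
    unfolding P.essential_graph_vertices V using \<phi> by (auto simp: inj_on_def)
  have nac: "\<not> ?a \<otimes>\<^bsub>?P\<^esub> ?c \<in> nilpotents ?P" "\<not> ?c \<otimes>\<^bsub>?P\<^esub> ?a \<in> nilpotents ?P"
    using S.nontrivial by (simp_all add: nilP RDirProd_simps)
  have wc: "w \<in> carrier T" using Tc by simp
  have nbd: "\<not> ?b \<otimes>\<^bsub>?P\<^esub> ?d \<in> nilpotents ?P" "\<not> ?d \<otimes>\<^bsub>?P\<^esub> ?b \<in> nilpotents ?P"
    using ne wc by (simp_all add: nilP RDirProd_simps)
  show "projective (line_graph (essential_graph ?P))" unfolding projective_def
  proof (rule line_graph_projective[OF wheel_drawing_valid P.simple_essential_graph inj])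
    fix e assume "e \<in> snd (essential_graph ?P)"
    then obtain u v where e1: "e = {u, v}" "u \<in> zero_divisors ?P - {\<zero>\<^bsub>?P\<^esub>}"
      "v \<in> zero_divisors ?P - {\<zero>\<^bsub>?P\<^esub>}" "u \<noteq> v" "u \<otimes>\<^bsub>?P\<^esub> v \<in> nilpotents ?P"
      by (rule P.essential_graph_edgeE)
    note e = e1[unfolded V]
    have "{\<phi> u, \<phi> v} \<in> edge_set wheel_edges"
      using e(2-5) nac nbd
      by (elim insertE emptyE; simp only: \<phi>; simp add: edge_set_def wheel_edges_def doubleton_eq_iff)
    then show "\<phi> ` e \<in> edge_set wheel_edges" by (simp add: e(1))
  qed
  show "\<not> planar (line_graph (essential_graph ?P))"
  proof (rule line_graph_wheel_not_planar[OF P.simple_essential_graph dist])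
    have nn: "n \<in> carrier T" using Tc by simp
    have E: "{u, v} \<in> snd (essential_graph ?P)"
      if "u \<in> carrier S \<times> nilpotents T - {(\<zero>\<^bsub>S\<^esub>, \<zero>\<^bsub>T\<^esub>)}" "v \<in> nilpotents S \<times> Units T" for u v
      by (rule product_edge[OF S Si T that])
    have ab: "{?a, ?b} \<in> snd (essential_graph ?P)" and cb: "{?c, ?b} \<in> snd (essential_graph ?P)"
      and cd: "{?c, ?d} \<in> snd (essential_graph ?P)" and ad: "{?a, ?d} \<in> snd (essential_graph ?P)"
      and hb: "{?h, ?b} \<in> snd (essential_graph ?P)" and hd: "{?h, ?d} \<in> snd (essential_graph ?P)"
      by (rule E; use n w Sn Sc S.nontrivial in simp)+
    have ha: "{?h, ?a} \<in> snd (essential_graph ?P)"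
      unfolding P.essential_graph_edge_iff V using dist nn by (simp add: nilP RDirProd_simps)
    have "n \<otimes>\<^bsub>T\<^esub> n \<in> {\<zero>\<^bsub>T\<^esub>, n}" using T.nilpotents_mult[of n n] n nn by simp
    then have hc: "{?h, ?c} \<in> snd (essential_graph ?P)"
      unfolding P.essential_graph_edge_iff V using dist nn by (simp add: nilP RDirProd_simps)
    show "{?h, v} \<in> snd (essential_graph ?P)" if "v \<in> {?a, ?b, ?c, ?d}" for v
      using that ha hb hc hd by blast
    show "{?a, ?b} \<in> snd (essential_graph ?P)" by (rule ab)
    show "{?b, ?c} \<in> snd (essential_graph ?P)" "{?d, ?a} \<in> snd (essential_graph ?P)"
      using cb ad by (simp_all add: insert_commute)
    show "{?c, ?d} \<in> snd (essential_graph ?P)" by (rule cd)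
  qed
qed

section \<open>Rings of small order\<close>

context finite_cring
begin

abbreviation num :: "nat \<Rightarrow> 'a" where
  "num k \<equiv> add_pow R k \<one>"

lemma char_dvd:
  "\<exists>c. \<forall>k::nat. num k = \<zero> \<longleftrightarrow> c dvd k"
proof -
  have "num k = \<zero> \<longleftrightarrow> group.ord (add_monoid R) \<one> dvd k" for k :: nat
    using group.pow_eq_id[OF a_group, of \<one> k] by (simp add: add_pow_def)
  then show ?thesis by blast
qed

lemma card_add_pow: "num (card (carrier R)) = \<zero>"
  using group.pow_order_eq_1[OF a_group, of \<one>] by (simp add: add_pow_def order_def)

lemma one_add_pow_mult: "num a \<otimes> num b = num (a * b)"
proof -
  have "num a \<otimes> num b = add_pow R a (num b)" by (simp add: add_pow_ldistr)
  then show ?thesis by (simp add: add.nat_pow_pow mult.commute)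
qed

lemma residue_ring_hom:
  assumes n: "n > 1" "num (nat n) = \<zero>"
  shows "(\<lambda>k. num (nat k)) \<in> ring_hom (residue_ring n) R"
proof -
  have red: "num (m mod nat n) = num m" for m :: nat
  proof -
    have "num m = num (m div nat n * nat n + m mod nat n)" by simp
    also have "\<dots> = num (m div nat n * nat n) \<oplus> num (m mod nat n)" by (rule add.nat_pow_mult[symmetric]) simp
    also have "num (m div nat n * nat n) = num (m div nat n) \<otimes> num (nat n)" by (simp add: one_add_pow_mult)
    finally show ?thesis using n(2) by simp
  qed
  show ?thesis
  proof (rule ring_hom_memI)
    fix x y assume "x \<in> carrier (residue_ring n)" "y \<in> carrier (residue_ring n)"
    then have xy: "0 \<le> x" "0 \<le> y" by (auto simp: residue_ring_def)
    have "nat (x \<otimes>\<^bsub>residue_ring n\<^esub> y) = (nat x * nat y) mod nat n"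
      using xy n(1) by (simp add: residue_ring_def nat_mod_distrib nat_mult_distrib)
    then show "num (nat (x \<otimes>\<^bsub>residue_ring n\<^esub> y)) = num (nat x) \<otimes> num (nat y)"
      by (simp add: red one_add_pow_mult)
    have "nat (x \<oplus>\<^bsub>residue_ring n\<^esub> y) = (nat x + nat y) mod nat n"
      using xy n(1) by (simp add: residue_ring_def nat_mod_distrib nat_add_distrib)
    then show "num (nat (x \<oplus>\<^bsub>residue_ring n\<^esub> y)) = num (nat x) \<oplus> num (nat y)"
      by (simp add: red add.nat_pow_mult)
  qed (simp_all add: residue_ring_def)
qed

text \<open>The additive order of 1 is the number of elements, so the multiples of 1 exhaust
  \<open>R\<close>.\<close>
lemma iso_residue_ring:
  assumes card: "card (carrier R) = nat n" "n > 1"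
    and char: "\<And>k. 0 < k \<Longrightarrow> k < nat n \<Longrightarrow> num k \<noteq> \<zero>"
  shows "R \<simeq> residue_ring n"
proof -
  let ?g = "\<lambda>k. num (nat k)"
  have hom: "?g \<in> ring_hom (residue_ring n) R"
    by (rule residue_ring_hom) (use card card_add_pow in auto)
  have ne: "num a \<noteq> num b" if "a < b" "b < nat n" for a b :: nat
  proof
    assume eq: "num a = num b"
    have "num b = num a \<oplus> num (b - a)" using that(1) by (simp add: add.nat_pow_mult)
    then have "num (b - a) = \<zero>" using eq by (metis add.l_cancel_one' add.nat_pow_closed one_closed)
    then show False using char[of "b - a"] that by simp
  qed
  have inj: "inj_on ?g (carrier (residue_ring n))"
  proof (rule inj_onI)
    fix x y assume "x \<in> carrier (residue_ring n)" "y \<in> carrier (residue_ring n)" and eq: "?g x = ?g y"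
    then have xy: "0 \<le> x" "x < n" "0 \<le> y" "y < n" by (auto simp: residue_ring_def)
    have "nat x = nat y"
      using ne[of "nat x" "nat y"] ne[of "nat y" "nat x"] eq xy by (metis linorder_neqE_nat nat_less_eq_zless)
    then show "x = y" using xy by simp
  qed
  have "?g ` carrier (residue_ring n) = carrier R"
  proof (rule card_seteq[OF finite_carrier])
    show "card (carrier R) \<le> card (?g ` carrier (residue_ring n))"
      unfolding card_image[OF inj] using card by (simp add: residue_ring_def)
  qed auto
  then have "?g \<in> ring_iso (residue_ring n) R" using hom inj by (simp add: ring_iso_def bij_betw_def)
  moreover have "ring (residue_ring n)"
    using residues.cring[of n] card(2) by (simp add: residues_def cring_def)
  ultimately show ?thesis using ring_iso_sym[of "residue_ring n" R] by (auto simp: is_ring_iso_def)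
qed

lemma iso_residue_ring_prime:
  assumes "card (carrier R) = p" "Factorial_Ring.prime p"
  shows "R \<simeq> residue_ring (int p)"
proof (rule iso_residue_ring)
  show "int p > 1" using prime_gt_1_nat[OF assms(2)] by simp
  fix k assume k: "0 < k" "k < nat (int p)"
  obtain c where c: "\<And>k::nat. num k = \<zero> \<longleftrightarrow> c dvd k" using char_dvd by blast
  have "c dvd p" using c card_add_pow assms(1) by metis
  moreover have "c \<noteq> 1" using c[of 1] nontrivial by auto
  ultimately have "c = p" using assms(2) by (auto simp: prime_nat_iff)
  then show "num k \<noteq> \<zero>" unfolding c using k by (auto dest: dvd_imp_le)
qed (use assms in simp)

lemma iso_residue_ring_4:
  assumes "card (carrier R) = 4" "\<one> \<oplus> \<one> \<noteq> \<zero>"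
  shows "R \<simeq> residue_ring 4"
proof (rule iso_residue_ring)
  fix k assume k: "0 < k" "k < nat 4"
  obtain c where c: "\<And>k::nat. num k = \<zero> \<longleftrightarrow> c dvd k" using char_dvd by blast
  have "num (2::nat) = \<one> \<oplus> \<one>" by (simp add: numeral_2_eq_2)
  then have "\<not> c dvd 2" using c[of 2] assms(2) by simp
  moreover have "c dvd 4" using c[of 4] card_add_pow assms(1) by simp
  moreover have "c = 1 \<or> c = 2 \<or> c = 3 \<or> c = 4" using dvd_imp_le[OF \<open>c dvd 4\<close>] \<open>c dvd 4\<close> by (cases c) auto
  ultimately have "c = 4" by auto
  then show "num k \<noteq> \<zero>" unfolding c using k by (auto dest: dvd_imp_le)
qed (use assms in simp_all)

lemma char_2_double:
  assumes "\<one> \<oplus> \<one> = \<zero>" "x \<in> carrier R" shows "x \<oplus> x = \<zero>"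
proof -
  have "x \<oplus> x = (\<one> \<oplus> \<one>) \<otimes> x" using assms(2) by (simp add: l_distr)
  then show ?thesis using assms by simp
qed

lemma char_2_card_4:
  assumes two: "\<one> \<oplus> \<one> = \<zero>" and card: "card (carrier R) = 4" and a: "a \<in> carrier R" "a \<noteq> \<zero>" "a \<noteq> \<one>"
  shows "distinct [\<zero>, \<one>, a, \<one> \<oplus> a]" "carrier R = {\<zero>, \<one>, a, \<one> \<oplus> a}"
proof -
  have "\<one> \<oplus> a \<noteq> \<zero>"
  proof
    assume "\<one> \<oplus> a = \<zero>"
    then have "\<one> \<oplus> (\<one> \<oplus> a) = \<one>" by simp
    moreover have "\<one> \<oplus> (\<one> \<oplus> a) = (\<one> \<oplus> \<one>) \<oplus> a" using a(1) by (simp add: a_assoc)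
    ultimately show False using two a by simp
  qed
  moreover have "\<one> \<oplus> a \<noteq> \<one>" "\<one> \<oplus> a \<noteq> a" using a nontrivial by (simp_all add: add.l_cancel_one add.r_cancel_one)
  ultimately show d: "distinct [\<zero>, \<one>, a, \<one> \<oplus> a]" using a nontrivial by auto
  show "carrier R = {\<zero>, \<one>, a, \<one> \<oplus> a}"
    by (rule card_seteq[OF finite_carrier, symmetric]) (use a d card in auto)
qed

end

text \<open>The pair \<open>(a, b)\<close> stands for \<open>a + b \<epsilon>\<close> over the
  field of two elements, with \<open>\<epsilon>\<^sup>2 = 0\<close>.\<close>
definition dual_numbers :: "(bool \<times> bool) ring" where
  "dual_numbers = \<lparr>carrier = UNIV, monoid.mult = \<lambda>(a, b) (c, d). (a \<and> c, (a \<and> d) \<noteq> (b \<and> c)),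
     one = (True, False), ring.zero = (False, False), add = \<lambda>(a, b) (c, d). (a \<noteq> c, b \<noteq> d)\<rparr>"

lemma finite_cring_dual_numbers: "finite_cring dual_numbers"
proof -
  have "cring dual_numbers"
  proof (rule cringI)
    show "abelian_group dual_numbers"
      by (rule abelian_groupI) (auto simp: dual_numbers_def)
    show "comm_monoid dual_numbers"
      by (rule comm_monoidI) (auto simp: dual_numbers_def)
  qed (auto simp: dual_numbers_def)
  then show ?thesis by (simp add: finite_cring_def finite_cring_axioms_def dual_numbers_def)
qed

text \<open>The number 2 stands for a root \<open>a\<close> of \<open>x\<^sup>2 = x + 1\<close>
  over the field of two elements, and 3 for \<open>1 + a\<close>.\<close>
definition GF4 :: "nat ring" where
  "GF4 = \<lparr>carrier = {0, 1, 2, 3},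
 monoid.mult = \<lambda>x y. [[0, 0, 0, 0], [0, 1, 2, 3], [0, 2, 3, 1], [0, 3, 1, 2]] ! x ! y,
     one = 1, ring.zero = 0,
     add = \<lambda>x y. [[0, 1, 2, 3], [1, 0, 3, 2], [2, 3, 0, 1], [3, 2, 1, 0]] ! x ! y\<rparr>"

lemma field_GF4: "field GF4"
proof -
  have cr: "cring GF4"
  proof (rule cringI)
    show "abelian_group GF4"
      by (rule abelian_groupI) (auto simp: GF4_def numeral_2_eq_2 numeral_3_eq_3)
    show "comm_monoid GF4"
      by (rule comm_monoidI) (auto simp: GF4_def numeral_2_eq_2 numeral_3_eq_3)
  qed (auto simp: GF4_def numeral_2_eq_2 numeral_3_eq_3)
  have "Units GF4 = carrier GF4 - {\<zero>\<^bsub>GF4\<^esub>}"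
    by (auto simp: Units_def GF4_def numeral_2_eq_2 numeral_3_eq_3)
  then show ?thesis by (rule cring.cring_fieldI[OF cr])
qed

lemma card_GF4: "card (carrier GF4) = 4"
  by (simp add: GF4_def)

context finite_cring
begin

text \<open>For an element \<open>a\<close> other than 0 and 1, the only possible value of
  \<open>a\<^sup>2\<close> is \<open>1 + a\<close>, and this determines both tables.\<close>
lemma iso_GF4:
  assumes ind: "indecomposable" "nilpotents R = {\<zero>}" and card: "card (carrier R) = 4"
  shows "R \<simeq> GF4"
proof -
  have nzd: "x \<otimes> y \<noteq> \<zero>" if "x \<in> carrier R" "y \<in> carrier R" "x \<noteq> \<zero>" "y \<noteq> \<zero>" for x y
  proof
    assume "x \<otimes> y = \<zero>"
    then have "x \<in> zero_divisors R" using that by (auto simp: zero_divisors_def)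
    then show False using indecomposable_unit_or_nilpotent[OF ind(1) that(1)] unit_not_zero_divisor ind(2) that(3) by blast
  qed
  have two: "\<one> \<oplus> \<one> = \<zero>"
  proof (rule ccontr)
    assume ne: "\<one> \<oplus> \<one> \<noteq> \<zero>"
    have t: "num (2::nat) = \<one> \<oplus> \<one>" by (simp add: numeral_2_eq_2)
    have "num (2::nat) \<otimes> num (2::nat) = num (2 * 2 :: nat)" by (rule one_add_pow_mult)
    also have "\<dots> = \<zero>" using card_add_pow card by simp
    finally show False using nzd[of "\<one> \<oplus> \<one>" "\<one> \<oplus> \<one>"] ne t by simp
  qed
  obtain a where a: "a \<in> carrier R" "a \<noteq> \<zero>" "a \<noteq> \<one>"
  proof -
    have "\<not> carrier R \<subseteq> {\<zero>, \<one>}"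
    proof
      assume "carrier R \<subseteq> {\<zero>, \<one>}"
      then have "card (carrier R) \<le> card {\<zero>, \<one>}" by (rule card_mono[rotated]) simp
      then show False using card nontrivial by simp
    qed
    then show ?thesis using that by blast
  qed
  note d = char_2_card_4[OF two card a]
  let ?b = "\<one> \<oplus> a"
  have aa: "a \<oplus> a = \<zero>" by (rule char_2_double[OF two a(1)])
  have bb: "?b \<oplus> ?b = \<zero>" by (rule char_2_double[OF two]) (use a in simp)
  have ab: "a \<oplus> ?b = \<one>" using aa a(1) a_lcomm[of a \<one> a] by simp
  have bcar: "?b \<in> carrier R" using a by simp
  have ob: "\<one> \<oplus> ?b = a" using two a(1) by (metis a_assoc l_zero one_closed)
  have m: "a \<otimes> a = ?b"
  proof -
    have "a \<otimes> a \<in> {\<zero>, \<one>, a, ?b}" using d(2) a by blast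
    moreover have "a \<otimes> a \<noteq> \<zero>" using nzd[of a a] a by simp
    moreover have "a \<otimes> a \<noteq> \<one>"
    proof
      assume *: "a \<otimes> a = \<one>"
      have "?b \<otimes> ?b = (\<one> \<oplus> a) \<oplus> (a \<oplus> a \<otimes> a)" using a(1) by (simp add: l_distr r_distr)
      also have "\<dots> = \<zero>" using * bb a(1) by (simp add: a_comm)
      finally have "?b = \<zero>" using nzd[OF bcar bcar] by blast
      then show False using d(1) by simp
    qed
    moreover have "a \<otimes> a \<noteq> a"
    proof
      assume "a \<otimes> a = a"
      then show False using ind(1) a by (auto simp: indecomposable_def)
    qed
    ultimately show ?thesis by blast
  qed
  have mab: "a \<otimes> ?b = \<one>"
  proof -
    have "a \<otimes> ?b = a \<oplus> ?b" using a(1) by (simp add: r_distr m)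
    then show ?thesis using ab by simp
  qed
  have mbb: "?b \<otimes> ?b = a"
  proof -
    have "?b \<otimes> ?b = ?b \<oplus> a \<otimes> ?b" using a(1) by (simp add: l_distr)
    then show ?thesis using mab ob bcar by (simp add: a_comm)
  qed
  define h where "h = (\<lambda>k::nat. [\<zero>, \<one>, a, ?b] ! k)"
  have h: "h 0 = \<zero>" "h (Suc 0) = \<one>" "h 2 = a" "h 3 = ?b" by (simp_all add: h_def)
  have comm: "?b \<oplus> \<one> = a" "a \<oplus> \<one> = ?b" "?b \<oplus> a = \<one>" "?b \<otimes> a = \<one>"
    using ob ab mab a(1) bcar by (simp_all add: a_comm m_comm)
  have "h \<in> ring_iso GF4 R"
  proof (rule ring_iso_memI)
    show "bij_betw h (carrier GF4) (carrier R)"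
      unfolding bij_betw_def
    proof
      show "inj_on h (carrier GF4)" using d(1) h by (auto simp: inj_on_def GF4_def)
      show "h ` carrier GF4 = carrier R" unfolding d(2) GF4_def using h by auto
    qed
    fix x y assume xy: "x \<in> carrier GF4" "y \<in> carrier GF4"
    then have cs: "x = 0 \<or> x = 1 \<or> x = 2 \<or> x = 3" "y = 0 \<or> y = 1 \<or> y = 2 \<or> y = 3" by (auto simp: GF4_def)
    show "h (x \<otimes>\<^bsub>GF4\<^esub> y) = h x \<otimes> h y"
      using cs by (elim disjE; simp add: GF4_def h m mab mbb comm a bcar numeral_2_eq_2[symmetric])
    show "h (x \<oplus>\<^bsub>GF4\<^esub> y) = h x \<oplus> h y"
      using cs by (elim disjE; simp add: GF4_def h two aa bb ab ob comm a bcar)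
    show "h x \<in> carrier R" using cs h a by auto
  qed (simp add: GF4_def h)
  then have "GF4 \<simeq> R" by (auto simp: is_ring_iso_def)
  moreover have "ring GF4" using field_GF4 by (simp add: field_def domain_def cring_def)
  ultimately show ?thesis using ring_iso_sym by blast
qed

text \<open>The group of units would have order 5, so \<open>- 1\<close>, whose square is 1, would
  be 1. In characteristic 2 the elements 0, 1, \<open>a\<close>, \<open>1 + a\<close> form an
  additive subgroup, and its order 4 does not divide 6.\<close>
lemma no_field_of_order_6:
  assumes ind: "indecomposable" "nilpotents R = {\<zero>}" shows "card (carrier R) \<noteq> 6"
proof
  assume card: "card (carrier R) = 6"
  have five: "card (Units R) = 5" using card_carrier_split[OF ind(1)] card ind(2) by simp
  have m1: "\<ominus> \<one> \<in> Units R" by (rule Units_minus_one_closed)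
  have sq: "(\<ominus> \<one>) [^] (2::nat) = \<one>" by (simp add: numeral_2_eq_2 l_minus)
  have "(\<ominus> \<one>) [^] (5::nat) = \<one>"
  proof -
    have "(\<ominus> \<one>) [^]\<^bsub>units_of R\<^esub> (order (units_of R)) = \<one>\<^bsub>units_of R\<^esub>"
      by (rule group.pow_order_eq_1[OF units_group]) (simp add: units_of_carrier m1)
    then show ?thesis using five m1 by (simp add: order_def units_of_carrier units_of_pow units_of_one)
  qed
  moreover have "(\<ominus> \<one>) [^] (5::nat) = (\<ominus> \<one>) [^] (2::nat) \<otimes> (\<ominus> \<one>) [^] (2::nat) \<otimes> (\<ominus> \<one>)"
    by (simp add: numeral_eq_Suc m_assoc)
  ultimately have "\<ominus> \<one> = \<one>" unfolding sq by simp
  then have two: "\<one> \<oplus> \<one> = \<zero>" by (metis l_neg one_closed)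
  obtain a where a: "a \<in> carrier R" "a \<noteq> \<zero>" "a \<noteq> \<one>"
  proof -
    have "\<not> carrier R \<subseteq> {\<zero>, \<one>}"
    proof
      assume "carrier R \<subseteq> {\<zero>, \<one>}"
      then have "card (carrier R) \<le> card {\<zero>, \<one>}" by (rule card_mono[rotated]) simp
      then show False using card nontrivial by simp
    qed
    then show ?thesis using that by blast
  qed
  let ?H = "{\<zero>, \<one>, a, \<one> \<oplus> a}"
  have ob: "\<one> \<oplus> (\<one> \<oplus> a) = a" using two a(1) by (metis a_assoc l_zero one_closed)
  have aa: "a \<oplus> a = \<zero>" "(\<one> \<oplus> a) \<oplus> (\<one> \<oplus> a) = \<zero>" using char_2_double[OF two] a by auto
  have ab: "a \<oplus> (\<one> \<oplus> a) = \<one>" using aa(1) a(1) a_lcomm[of a \<one> a] by simp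
  have comm: "(\<one> \<oplus> a) \<oplus> \<one> = a" "a \<oplus> \<one> = \<one> \<oplus> a" "(\<one> \<oplus> a) \<oplus> a = \<one>"
    using ob ab a(1) by (simp_all add: a_comm)
  have neg: "\<ominus> x = x" if "x \<in> carrier R" for x
    using char_2_double[OF two that] that by (metis minus_equality)
  have "subgroup ?H (add_monoid R)"
  proof (rule group.subgroupI[OF a_group])
    show "inv\<^bsub>add_monoid R\<^esub> x \<in> ?H" if "x \<in> ?H" for x
      using that neg a by (fastforce simp flip: a_inv_def)
    show "x \<otimes>\<^bsub>add_monoid R\<^esub> y \<in> ?H" if "x \<in> ?H" "y \<in> ?H" for x y
      using that by (elim insertE emptyE; simp add: two ob aa ab comm a)
  qed (use a in auto)
  then have "card ?H dvd 6"
    using group.lagrange[OF a_group, of ?H] card by (metis dvd_triv_right order_def partial_object.select_convs(1))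
  moreover have "card ?H = 4"
  proof -
    have "\<one> \<oplus> a \<noteq> \<zero>" using ob a nontrivial by (metis r_zero one_closed)
    moreover have "\<one> \<oplus> a \<noteq> \<one>" "\<one> \<oplus> a \<noteq> a" using a nontrivial by (simp_all add: add.l_cancel_one add.r_cancel_one)
    ultimately show ?thesis using a nontrivial by auto
  qed
  ultimately show False by simp
qed

end

lemma field_finite_cring:
  assumes "field F" "finite (carrier F)"
  shows "finite_cring F" "finite_cring.indecomposable F" "nilpotents F = {\<zero>\<^bsub>F\<^esub>}"
proof -
  interpret F: field F by fact
  show fc: "finite_cring F"
    unfolding finite_cring_def finite_cring_axioms_def using assms(2) F.is_cring by simp
  interpret finite_cring F by (rule fc)
  have "e = \<zero>\<^bsub>F\<^esub> \<or> e = \<one>\<^bsub>F\<^esub>" if "e \<in> carrier F" "e \<otimes>\<^bsub>F\<^esub> e = e" for e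
  proof -
    have "e \<otimes>\<^bsub>F\<^esub> (e \<ominus>\<^bsub>F\<^esub> \<one>\<^bsub>F\<^esub>) = \<zero>\<^bsub>F\<^esub>" using that by algebra
    then show ?thesis using that(1) F.integral by (metis F.minus_closed F.one_closed F.r_right_minus_eq)
  qed
  then show "finite_cring.indecomposable F" by (simp add: indecomposable_def)
  show "nilpotents F = {\<zero>\<^bsub>F\<^esub>}"
    using F.field_Units unit_not_nilpotent nilpotents_carrier zero_nilpotent by blast
qed

section \<open>The polynomial ring modulo the square of the variable\<close>

lemma finite_cring_residue_ring:
  assumes "n > 1" shows "finite_cring (residue_ring n)"
proof -
  interpret residues n "residue_ring n" by unfold_locales (use assms in auto)
  show ?thesis
    unfolding finite_cring_def finite_cring_axioms_def using is_cring assms by (auto simp: residue_ring_def)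
qed

text \<open>Evaluation at \<open>n\<close> is onto \<open>R\<close>. Division by
  \<open>x\<^sup>2\<close> leaves a remainder \<open>r\<^sub>0 + r\<^sub>1 x\<close>, and its
  value \<open>r\<^sub>0 + r\<^sub>1 n\<close> is 0 only for \<open>r\<^sub>0 = r\<^sub>1 =
  0\<close>; hence the kernel is the ideal of \<open>x\<^sup>2\<close>.\<close>
lemma UP_quotient_iso:
  fixes R (structure)
  assumes R: "finite_cring R" and two: "\<one> \<oplus> \<one> = \<zero>" and n: "n \<in> carrier R" "n \<noteq> \<zero>" "n \<noteq> \<one>" "n \<otimes> n = \<zero>" and card: "card (carrier R) = 4"
  shows "UP (residue_ring 2) Quot
      (PIdl\<^bsub>UP (residue_ring 2)\<^esub> (monom (UP (residue_ring 2)) \<one>\<^bsub>residue_ring 2\<^esub> 2)) \<simeq> R"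
proof -
  interpret R: finite_cring R by (rule R)
  define Z where "Z = residue_ring 2"
  define h where "h = (\<lambda>k. add_pow R (nat k) \<one>)"
  have num2: "add_pow R (2::nat) \<one> = \<zero>" using two by (simp add: numeral_2_eq_2)
  have h: "h \<in> ring_hom Z R" unfolding Z_def h_def by (rule R.residue_ring_hom) (use num2 in simp_all)
  interpret Z: finite_cring Z unfolding Z_def by (rule finite_cring_residue_ring) simp
  have Zc: "carrier Z = {0, 1}" "\<zero>\<^bsub>Z\<^esub> = 0" "\<one>\<^bsub>Z\<^esub> = 1" by (auto simp: Z_def residue_ring_def)
  have h01: "h 0 = \<zero>" "h 1 = \<one>" by (simp_all add: h_def)
  interpret UPZ: UP_pre_univ_prop Z R h "UP Z"
    by (rule UP_pre_univ_propI[OF Z.is_cring R.is_cring h]) (simp_all)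
  let ?P = "UP Z" and ?ev = "eval Z R h n"
  let ?x2 = "monom ?P \<one>\<^bsub>Z\<^esub> 2"
  have ev: "?ev \<in> ring_hom ?P R" by (rule UPZ.eval_ring_hom[OF n(1)])
  interpret E: ring_hom_ring ?P R ?ev
    by (rule ring_hom_ringI2) (use UPZ.UP_ring R.ring_axioms ev in auto)
  have mon: "?ev (monom ?P r k) = h r \<otimes> n [^] k" if "r \<in> carrier Z" for r k
    by (rule UPZ.eval_monom[OF that n(1)])
  have linear: "?ev (monom ?P r 0 \<oplus>\<^bsub>?P\<^esub> monom ?P s 1) = h r \<oplus> h s \<otimes> n" if "r \<in> carrier Z" "s \<in> carrier Z" for r s
    using that mon n(1) by simp
  have x2: "?x2 \<in> carrier ?P" by simp
  have evx2: "?ev ?x2 = \<zero>" using mon[of 1 2] n h01 Zc by (simp add: numeral_2_eq_2)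
  note d = R.char_2_card_4[OF two card n(1-3)]
  have surj: "?ev ` carrier ?P = carrier R"
  proof
    show "?ev ` carrier ?P \<subseteq> carrier R" using E.hom_closed by blast
    have "h r \<oplus> h s \<otimes> n \<in> ?ev ` carrier ?P" if "r \<in> carrier Z" "s \<in> carrier Z" for r s
      using linear[OF that] that by (metis UPZ.P.a_closed UPZ.monom_closed image_eqI)
    from this[of 0 0] this[of 1 0] this[of 0 1] this[of 1 1]
    show "carrier R \<subseteq> ?ev ` carrier ?P" unfolding d(2) using Zc h01 n(1) by simp
  qed
  have ker: "a_kernel ?P R ?ev = PIdl\<^bsub>?P\<^esub> ?x2"
  proof
    show "PIdl\<^bsub>?P\<^esub> ?x2 \<subseteq> a_kernel ?P R ?ev"
    proof
      fix f assume "f \<in> PIdl\<^bsub>?P\<^esub> ?x2"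
      then obtain q where q: "q \<in> carrier ?P" "f = q \<otimes>\<^bsub>?P\<^esub> ?x2" by (auto simp: cgenideal_def)
      then have "f \<in> carrier ?P" using UPZ.P.m_closed[OF q(1) x2] by simp
      moreover have "?ev f = ?ev q \<otimes> ?ev ?x2" unfolding q(2) by (rule E.hom_mult[OF q(1) x2])
      moreover have "?ev q \<in> carrier R" by (rule E.hom_closed[OF q(1)])
      ultimately show "f \<in> a_kernel ?P R ?ev" unfolding a_kernel_def' evx2 by simp
    qed
    show "a_kernel ?P R ?ev \<subseteq> PIdl\<^bsub>?P\<^esub> ?x2"
    proof
      fix f assume "f \<in> a_kernel ?P R ?ev"
      then have f: "f \<in> carrier ?P" "?ev f = \<zero>" unfolding a_kernel_def' by blast+
      have c2: "coeff ?P ?x2 2 = \<one>\<^bsub>Z\<^esub>" using UPZ.coeff_monom[OF Z.one_closed, of 2 2] by simp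
      have "?x2 \<noteq> \<zero>\<^bsub>?P\<^esub>" using c2 Z.nontrivial by (metis UPZ.coeff_zero)
      moreover have deg: "deg Z ?x2 = 2" by (rule UPZ.deg_monom) (use Z.nontrivial Z.one_closed in blast)+
      ultimately obtain q r and k :: nat where qr: "q \<in> carrier ?P" "r \<in> carrier ?P"
        "coeff ?P ?x2 (deg Z ?x2) [^]\<^bsub>Z\<^esub> k \<odot>\<^bsub>?P\<^esub> f = ?x2 \<otimes>\<^bsub>?P\<^esub> q \<oplus>\<^bsub>?P\<^esub> r" "r = \<zero>\<^bsub>?P\<^esub> \<or> deg Z r < deg Z ?x2"
        using UPZ.long_div_theorem[OF x2 f(1)] by blast
      have f_eq: "f = ?x2 \<otimes>\<^bsub>?P\<^esub> q \<oplus>\<^bsub>?P\<^esub> r" using qr(3) UPZ.smult_one[OF f(1)] unfolding deg c2 Z.nat_pow_one by simp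
      have rdeg: "coeff ?P r i = \<zero>\<^bsub>Z\<^esub>" if "i \<ge> 2" for i
      proof (cases "r = \<zero>\<^bsub>?P\<^esub>")
        case False
        then have "deg Z r < i" using qr(4) that deg by simp
        then show ?thesis by (rule UPZ.deg_aboveD[OF _ qr(2)])
      qed (simp add: UPZ.coeff_zero)
      have r_eq: "r = monom ?P (coeff ?P r 0) 0 \<oplus>\<^bsub>?P\<^esub> monom ?P (coeff ?P r 1) 1"
      proof (rule UPZ.up_eqI)
        fix i :: nat
        have "i = 0 \<or> i = 1 \<or> i \<ge> 2" by arith
        then show "coeff ?P r i = coeff ?P (monom ?P (coeff ?P r 0) 0 \<oplus>\<^bsub>?P\<^esub> monom ?P (coeff ?P r 1) 1) i"
          using qr(2) rdeg[of i] by auto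
      qed (use qr(2) in auto)
      have co: "coeff ?P r 0 \<in> carrier Z" "coeff ?P r 1 \<in> carrier Z" using qr(2) by simp_all
      have "?ev f = ?ev ?x2 \<otimes> ?ev q \<oplus> ?ev r"
        unfolding f_eq using E.hom_add[OF UPZ.P.m_closed[OF x2 qr(1)] qr(2)] E.hom_mult[OF x2 qr(1)] by simp
      then have "?ev f = ?ev r" unfolding evx2 using E.hom_closed[OF qr(1)] E.hom_closed[OF qr(2)] by simp
      then have "h (coeff ?P r 0) \<oplus> h (coeff ?P r 1) \<otimes> n = \<zero>" using f(2) linear[OF co] r_eq by metis
      then have "coeff ?P r 0 = 0 \<and> coeff ?P r 1 = 0"
        using co d(1) n(1) h01 Zc R.nontrivial by auto
      then have "r = \<zero>\<^bsub>?P\<^esub>" using r_eq Zc by (metis UPZ.P.r_zero UPZ.P.zero_closed UPZ.monom_zero)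
      then have "f = q \<otimes>\<^bsub>?P\<^esub> ?x2" using f_eq qr(1) x2 by (simp add: UPZ.P.m_comm)
      then show "f \<in> PIdl\<^bsub>?P\<^esub> ?x2" using qr(1) by (auto simp: cgenideal_def)
    qed
  qed
  show ?thesis using E.FactRing_iso[OF surj, unfolded ker] unfolding Z_def .
qed

section \<open>The classification\<close>

lemma (in finite_cring) reduced_card:
  assumes "indecomposable" "nilpotents R = {\<zero>}" shows "card (carrier R) = Suc (card (Units R))"
  using card_carrier_split[OF assms(1)] assms(2) by simp

text \<open>The last nonzero power of the only nonzero nilpotent is a nonzero nilpotent, hence
  that element itself.\<close>
lemma (in finite_cring) nilpotent_square_zero:
  assumes "card (nilpotents R) = 2"
  obtains n where "n \<in> carrier R" "n \<noteq> \<zero>" "n \<otimes> n = \<zero>"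
proof -
  obtain n where n: "nilpotents R = {\<zero>, n}" "n \<noteq> \<zero>" by (rule card_2_memberE[OF assms zero_nilpotent])
  have nn: "n \<in> nilpotents R" using n(1) by simp
  have nc: "n \<in> carrier R" by (rule nilpotents_carrier[OF nn])
  obtain k :: nat where k: "n [^] k \<otimes> n \<noteq> \<zero>" "n \<otimes> (n [^] k \<otimes> n) = \<zero>" using nilpotent_kills[OF nn nc n(2)] .
  have "n [^] k \<otimes> n \<in> nilpotents R" using nilpotents_mult'[OF nn] nc by simp
  then have "n [^] k \<otimes> n = n" using k(1) n(1) by simp
  then show ?thesis using that nc n(2) k(2) by simp
qed

text \<open>The elements are 0, 1, \<open>n\<close>, \<open>1 + n\<close>, and the square of
  \<open>1 + n\<close> is \<open>1 + n + n\<close>.\<close>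
lemma (in finite_cring) card_4_nilpotent_indecomposable:
  assumes card: "card (carrier R) = 4" and n: "n \<in> carrier R" "n \<noteq> \<zero>" "n \<otimes> n = \<zero>"
  shows "indecomposable" "card (nilpotents R) = 2"
proof -
  have nn: "n \<in> nilpotents R" using n unfolding nilpotents_def by (auto intro!: exI[of _ "2::nat"] simp: numeral_2_eq_2)
  have u: "\<one> \<oplus> n \<notin> nilpotents R" by (rule one_plus_nilpotent[OF nn])
  have one: "\<one> \<notin> nilpotents R" using unit_not_nilpotent by blast
  have c: "\<one> \<oplus> n \<in> carrier R" "\<one> \<oplus> n \<noteq> \<one>" using n by (simp_all add: add.l_cancel_one)
  have d: "card {\<zero>, \<one>, n, \<one> \<oplus> n} = 4"
    using n(2) nontrivial one u c(2) nn zero_nilpotent by (auto simp: card_insert_if)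
  have car: "carrier R = {\<zero>, \<one>, n, \<one> \<oplus> n}"
    by (rule card_seteq[OF finite_carrier, symmetric]) (use n(1) d card in auto)
  have "nilpotents R = {\<zero>, n}" using car nilpotents_carrier nn zero_nilpotent one u by blast
  then show "card (nilpotents R) = 2" using n(2) by simp
  have "(\<one> \<oplus> n) \<otimes> (\<one> \<oplus> n) \<noteq> \<one> \<oplus> n"
  proof
    assume "(\<one> \<oplus> n) \<otimes> (\<one> \<oplus> n) = \<one> \<oplus> n"
    moreover have "(\<one> \<oplus> n) \<otimes> (\<one> \<oplus> n) = (\<one> \<oplus> n) \<oplus> n" using n by (simp add: l_distr r_distr)
    ultimately show False using n by (simp add: add.l_cancel_one)
  qed
  moreover have "n \<otimes> n \<noteq> n" using n by simp
  ultimately show "indecomposable" unfolding indecomposable_def car by blast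
qed

lemma RDirProd_iso_cong:
  assumes "S \<simeq> S'" "T \<simeq> T'" shows "RDirProd S T \<simeq> RDirProd S' T'"
  using RDirProd_iso6 assms unfolding is_ring_iso_def by blast

lemma iso_RDirProd_trans:
  assumes "A \<simeq> RDirProd S T" "S \<simeq> S'" "T \<simeq> T'" shows "A \<simeq> RDirProd S' T'"
  by (rule ring_iso_trans[OF assms(1) RDirProd_iso_cong[OF assms(2,3)]])

subsection \<open>Products of two fields\<close>

lemma small_fields_planar:
  assumes S: "finite_cring S" "finite_cring.indecomposable S" "nilpotents S = {\<zero>\<^bsub>S\<^esub>}"
    and T: "finite_cring T" "finite_cring.indecomposable T" "nilpotents T = {\<zero>\<^bsub>T\<^esub>}"
    and small: "card (Units S) \<le> 1 \<and> card (Units T) \<le> 4 \<or> card (Units S) \<le> 2 \<and> card (Units T) \<le> 3"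
  shows "planar (line_graph (essential_graph (RDirProd S T)))"
proof -
  interpret P: finite_cring "RDirProd S T" by (rule finite_cring_RDirProd[OF S(1) T(1)])
  from small show ?thesis
  proof
    assume *: "card (Units S) \<le> 1 \<and> card (Units T) \<le> 4"
    have hs: "\<forall>i<1. \<forall>j<4. {i, 1 + j} \<in> edge_set claw4_edges"
    proof (intro allI impI)
      fix i j :: nat assume that: "i < 1" "j < 4"
      have "j = 0 \<or> j = 1 \<or> j = 2 \<or> j = 3" using that(2) by arith
      then show "{i, 1 + j} \<in> edge_set claw4_edges" using that(1) by (elim disjE) (simp_all add: edge_set_def claw4_edges_def eval_nat_numeral)
    qed
    obtain \<phi> where \<phi>: "inj_on \<phi> (fst (essential_graph (RDirProd S T)))"
      "\<forall>e \<in> snd (essential_graph (RDirProd S T)). \<phi> ` e \<in> edge_set claw4_edges"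
      using field_product_label[OF S T conjunct1[OF *] conjunct2[OF *]] hs by blast
    show ?thesis unfolding planar_def
      by (rule line_graph_spherical[OF claw4_drawing_valid _ P.simple_essential_graph \<phi>(1) bspec[OF \<phi>(2)]]) (simp add: claw4_drawing_def)
  next
    assume *: "card (Units S) \<le> 2 \<and> card (Units T) \<le> 3"
    have hs: "\<forall>i<2. \<forall>j<3. {i, 2 + j} \<in> edge_set K23_edges"
    proof (intro allI impI)
      fix i j :: nat assume that: "i < 2" "j < 3"
      have "i = 0 \<or> i = 1" "j = 0 \<or> j = 1 \<or> j = 2" using that by arith+
      then show "{i, 2 + j} \<in> edge_set K23_edges" by (elim disjE) (simp_all add: edge_set_def K23_edges_def)
    qed
    obtain \<phi> where \<phi>: "inj_on \<phi> (fst (essential_graph (RDirProd S T)))"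
      "\<forall>e \<in> snd (essential_graph (RDirProd S T)). \<phi> ` e \<in> edge_set K23_edges"
      using field_product_label[OF S T conjunct1[OF *] conjunct2[OF *]] hs by blast
    show ?thesis unfolding planar_def
      by (rule line_graph_spherical[OF K23_drawing_valid _ P.simple_essential_graph \<phi>(1) bspec[OF \<phi>(2)]]) (simp add: K23_drawing_def)
  qed
qed

lemma F2_F7_crosscap:
  assumes S: "finite_cring S" "finite_cring.indecomposable S" "nilpotents S = {\<zero>\<^bsub>S\<^esub>}"
    and T: "finite_cring T" "finite_cring.indecomposable T" "nilpotents T = {\<zero>\<^bsub>T\<^esub>}"
    and card: "card (Units S) = 1" "card (Units T) = 6"
  shows "crosscap_number (line_graph (essential_graph (RDirProd S T))) = 1"
proof -
  interpret P: finite_cring "RDirProd S T" by (rule finite_cring_RDirProd[OF S(1) T(1)])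
  have hs: "\<forall>i<1. \<forall>j<6. {i, 1 + j} \<in> edge_set claw6_edges"
  proof (intro allI impI)
    fix i j :: nat assume that: "i < 1" "j < 6"
    have "j = 0 \<or> j = 1 \<or> j = 2 \<or> j = 3 \<or> j = 4 \<or> j = 5" using that(2) by arith
    then show "{i, 1 + j} \<in> edge_set claw6_edges" using that(1) by (elim disjE) (simp_all add: edge_set_def claw6_edges_def eval_nat_numeral)
  qed
  obtain \<phi> where \<phi>: "inj_on \<phi> (fst (essential_graph (RDirProd S T)))"
      "\<forall>e \<in> snd (essential_graph (RDirProd S T)). \<phi> ` e \<in> edge_set claw6_edges"
      using field_product_label[OF S T eq_imp_le[OF card(1)] eq_imp_le[OF card(2)]] hs by blast
  have "projective (line_graph (essential_graph (RDirProd S T)))" unfolding projective_def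
    by (rule line_graph_projective[OF claw6_drawing_valid P.simple_essential_graph \<phi>(1) bspec[OF \<phi>(2)]])
  moreover have "\<not> planar (line_graph (essential_graph (RDirProd S T)))"
    by (rule product_star(2)[OF S(1,2) T(1,2)]) (simp add: card)
  ultimately show ?thesis by (simp add: crosscap_number_eq_1_iff)
qed

lemma F4_F4_crosscap:
  assumes S: "finite_cring S" "finite_cring.indecomposable S" "nilpotents S = {\<zero>\<^bsub>S\<^esub>}"
    and T: "finite_cring T" "finite_cring.indecomposable T" "nilpotents T = {\<zero>\<^bsub>T\<^esub>}"
    and card: "card (Units S) = 3" "card (Units T) = 3"
  shows "crosscap_number (line_graph (essential_graph (RDirProd S T))) = 1"
proof -
  interpret S: finite_cring S by (rule S(1))
  interpret T: finite_cring T by (rule T(1))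
  interpret P: finite_cring "RDirProd S T" by (rule finite_cring_RDirProd[OF S(1) T(1)])
  have hs: "\<forall>i<3. \<forall>j<3. {i, 3 + j} \<in> edge_set K33_edges"
  proof (intro allI impI)
    fix i j :: nat assume that: "i < 3" "j < 3"
    have "i = 0 \<or> i = 1 \<or> i = 2" "j = 0 \<or> j = 1 \<or> j = 2" using that by arith+
    then show "{i, 3 + j} \<in> edge_set K33_edges" by (elim disjE) (simp_all add: edge_set_def K33_edges_def)
  qed
  obtain \<phi> where \<phi>: "inj_on \<phi> (fst (essential_graph (RDirProd S T)))"
      "\<forall>e \<in> snd (essential_graph (RDirProd S T)). \<phi> ` e \<in> edge_set K33_edges"
      using field_product_label[OF S T eq_imp_le[OF card(1)] eq_imp_le[OF card(2)]] hs by blast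
  have "projective (line_graph (essential_graph (RDirProd S T)))" unfolding projective_def
    by (rule line_graph_projective[OF K33_drawing_valid P.simple_essential_graph \<phi>(1) bspec[OF \<phi>(2)]])
  moreover have "\<not> planar (line_graph (essential_graph (RDirProd S T)))"
  proof -
    obtain a b c where abc: "Units S = {a, b, c}" "distinct [a, b, c]"
      using card(1) by (auto simp: card_3_iff)
    obtain x y z where xyz: "Units T = {x, y, z}" "distinct [x, y, z]"
      using card(2) by (auto simp: card_3_iff)
    have nzS: "u \<noteq> \<zero>\<^bsub>S\<^esub>" if "u \<in> Units S" for u using S.unit_not_nilpotent[OF that] S.zero_nilpotent by blast
    have nzT: "u \<noteq> \<zero>\<^bsub>T\<^esub>" if "u \<in> Units T" for u using T.unit_not_nilpotent[OF that] T.zero_nilpotent by blast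
    have nz: "a \<noteq> \<zero>\<^bsub>S\<^esub>" "b \<noteq> \<zero>\<^bsub>S\<^esub>" "c \<noteq> \<zero>\<^bsub>S\<^esub>" using nzS abc(1) by auto
    have car: "a \<in> carrier S" "b \<in> carrier S" "c \<in> carrier S" using abc(1) S.Units_closed by auto
    show ?thesis
    proof (rule line_graph_K33_not_planar[OF P.simple_essential_graph])
      show "distinct [(a, \<zero>\<^bsub>T\<^esub>), (b, \<zero>\<^bsub>T\<^esub>), (c, \<zero>\<^bsub>T\<^esub>), (\<zero>\<^bsub>S\<^esub>, x), (\<zero>\<^bsub>S\<^esub>, y), (\<zero>\<^bsub>S\<^esub>, z)]"
        using abc(2) xyz(2) nz by auto
      show "{u, v} \<in> snd (essential_graph (RDirProd S T))"
        if "u \<in> {(a, \<zero>\<^bsub>T\<^esub>), (b, \<zero>\<^bsub>T\<^esub>), (c, \<zero>\<^bsub>T\<^esub>)}" "v \<in> {(\<zero>\<^bsub>S\<^esub>, x), (\<zero>\<^bsub>S\<^esub>, y), (\<zero>\<^bsub>S\<^esub>, z)}" for u v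
        by (rule product_edge[OF S(1,2) T(1,2)]) (use that nz car xyz(1) S(3) T(3) in auto)
    qed
  qed
  ultimately show ?thesis by (simp add: crosscap_number_eq_1_iff)
qed

subsection \<open>From crosscap number one to the list of rings\<close>

lemma wheel_crosscap:
  assumes S: "finite_cring S" and T: "finite_cring T"
    and card: "card (carrier S) = 2" "card (carrier T) = 4" and n: "n \<in> carrier T" "n \<noteq> \<zero>\<^bsub>T\<^esub>" "n \<otimes>\<^bsub>T\<^esub> n = \<zero>\<^bsub>T\<^esub>"
  shows "crosscap_number (line_graph (essential_graph (RDirProd S T))) = 1"
  using wheel_product[OF S T finite_cring.card_4_nilpotent_indecomposable(1)[OF T card(2) n] card
      finite_cring.card_4_nilpotent_indecomposable(2)[OF T card(2) n]]
  by (simp add: crosscap_number_eq_1_iff)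

lemma dual_numbers_n:
  "card (carrier dual_numbers) = 4" "(False, True) \<in> carrier dual_numbers"
  "(False, True) \<noteq> \<zero>\<^bsub>dual_numbers\<^esub>" "(False, True) \<otimes>\<^bsub>dual_numbers\<^esub> (False, True) = \<zero>\<^bsub>dual_numbers\<^esub>"
  "(False, True) \<noteq> \<one>\<^bsub>dual_numbers\<^esub>" "\<one>\<^bsub>dual_numbers\<^esub> \<oplus>\<^bsub>dual_numbers\<^esub> \<one>\<^bsub>dual_numbers\<^esub> = \<zero>\<^bsub>dual_numbers\<^esub>"
  by (simp_all add: dual_numbers_def card_UNIV_bool flip: UNIV_Times_UNIV)

abbreviation dual_quotient where
  "dual_quotient \<equiv> UP (residue_ring 2) Quot
      (PIdl\<^bsub>UP (residue_ring 2)\<^esub> (monom (UP (residue_ring 2)) \<one>\<^bsub>residue_ring 2\<^esub> 2))"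

lemma dual_quotient_iso: "dual_quotient \<simeq> dual_numbers"
  by (rule UP_quotient_iso[OF finite_cring_dual_numbers dual_numbers_n(6,2,3,5,4,1)])

lemma ring_dual_quotient: "ring dual_quotient"
proof -
  interpret Z: finite_cring "residue_ring 2" by (rule finite_cring_residue_ring) simp
  interpret UPZ: UP_cring "residue_ring 2" "UP (residue_ring 2)" by unfold_locales simp
  show ?thesis
    by (rule ideal.quotient_is_ring[OF UPZ.P.cgenideal_ideal]) simp
qed

lemma local_4_classification:
  assumes T: "finite_cring T" and card: "card (carrier T) = 4" "card (nilpotents T) = 2"
  shows "T \<simeq> residue_ring 4 \<or> T \<simeq> dual_quotient"
proof -
  interpret T: finite_cring T by (rule T)
  obtain n where n: "n \<in> carrier T" "n \<noteq> \<zero>\<^bsub>T\<^esub>" "n \<otimes>\<^bsub>T\<^esub> n = \<zero>\<^bsub>T\<^esub>"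
    using T.nilpotent_square_zero[OF card(2)] .
  show ?thesis
  proof (cases "\<one>\<^bsub>T\<^esub> \<oplus>\<^bsub>T\<^esub> \<one>\<^bsub>T\<^esub> = \<zero>\<^bsub>T\<^esub>")
    case True
    have "n \<noteq> \<one>\<^bsub>T\<^esub>" using n T.nontrivial by auto
    then have "dual_quotient \<simeq> T" using UP_quotient_iso[OF T True n(1,2) _ n(3) card(1)] by blast
    then show ?thesis using ring_iso_sym[OF ring_dual_quotient] by blast
  next
    case False
    then show ?thesis using T.iso_residue_ring_4[OF card(1)] by blast
  qed
qed

text \<open>A nonzero nilpotent of \<open>T\<close> gives at least two units of \<open>T\<close>.
  To avoid \<open>K\<^sub>2\<^sub>,\<^sub>4\<close>, \<open>|S| |nil T|\<close> is at most 4 and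
  both factors are 2. With the roles of \<open>S\<close> and \<open>T\<close> exchanged, the
  classes have sizes \<open>|T| - 1\<close> and 2, so \<open>|T|\<close> is at most 4.\<close>
lemma nonreduced_pair:
  assumes S: "finite_cring S" "finite_cring.indecomposable S" and T: "finite_cring T" "finite_cring.indecomposable T"
    and proj: "projective (line_graph (essential_graph (RDirProd S T)))" "projective (line_graph (essential_graph (RDirProd T S)))"
    and nil: "card (nilpotents T) \<ge> 2"
  shows "card (carrier S) = 2" "card (carrier T) = 4" "card (nilpotents T) = 2"
proof -
  interpret S: finite_cring S by (rule S(1))
  interpret T: finite_cring T by (rule T(1))
  have nS: "card (nilpotents S) \<ge> 1" using S.zero_nilpotent S.finite_nilpotents by (metis One_nat_def Suc_leI card_gt_0_iff empty_iff)
  have uT: "card (Units T) \<ge> 2" using T.card_nilpotents_le_units[OF T(2)] nil by simp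
  have 1: "card (nilpotents S) * card (Units T) \<ge> 2" using mult_le_mono[OF nS uT] by simp
  have "\<not> card (carrier S) * card (nilpotents T) \<ge> 5" using product_K24[OF S T] 1 proj(1) by blast
  moreover have "card (carrier S) * card (nilpotents T) \<ge> 5" if "card (carrier S) \<ge> 3 \<or> card (nilpotents T) \<ge> 3"
    using that mult_le_mono[of 3 "card (carrier S)" 2 "card (nilpotents T)"]
      mult_le_mono[of 2 "card (carrier S)" 3 "card (nilpotents T)"] S.card_carrier_ge_2 nil by auto
  ultimately have "\<not> (card (carrier S) \<ge> 3 \<or> card (nilpotents T) \<ge> 3)" by blast
  then have le: "card (carrier S) \<le> 2" "card (nilpotents T) \<le> 2" by simp_all
  then show c: "card (carrier S) = 2" "card (nilpotents T) = 2" using S.card_carrier_ge_2 nil by simp_all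
  have nil1: "card (nilpotents S) = 1" using S.card_2_nilpotents[OF c(1)] by simp
  then have "card (Units S) = 1" using S.card_carrier_split[OF S(2)] c(1) by simp
  then have "\<not> card (carrier T) \<ge> 5" using product_K24[OF T S] nil1 c(2) proj(2) by auto
  then show "card (carrier T) = 4" using T.card_carrier_split[OF T(2)] c(2) uT by simp
qed

text \<open>A third factor is excluded: with three factors of order 2 the line graph is planar,
  and otherwise it is not projective. For two factors without nontrivial idempotents the cases are
  a nonzero nilpotent in one of them, a factor with a single unit, and two fields with at least
  two units each.\<close>
lemma classification:
  assumes A: "finite_cring A" "\<not> finite_cring.indecomposable A"
    and one: "crosscap_number (line_graph (essential_graph A)) = 1"
  shows "A \<simeq> RDirProd (residue_ring 2) (residue_ring 4) \<or> A \<simeq> RDirProd (residue_ring 2) dual_quotient \<or>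
    A \<simeq> RDirProd (residue_ring 2) (residue_ring 7) \<or> A \<simeq> RDirProd GF4 GF4"
proof -
  interpret A: finite_cring A by (rule A(1))
  obtain S T :: "('a, 'b) ring_scheme" where S: "finite_cring S" and T: "finite_cring T" and AST: "A \<simeq> RDirProd S T"
    using A.decomposable_product[OF A(2)] by blast
  interpret S: finite_cring S by (rule S)
  interpret T: finite_cring T by (rule T)
  have three: False if "finite_cring B" "finite_cring C" "finite_cring D" "A \<simeq> RDirProd B (RDirProd C D)"
    for B :: "('a, 'b) ring_scheme" and C D :: "('a, 'b) ring_scheme"
  proof -
    have "crosscap_number (line_graph (essential_graph (RDirProd B (RDirProd C D)))) = 1"
      using crosscap_number_iso[OF A(1) _ that(4)] one finite_cring_RDirProd that(1-3) by metis
    then show False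
      using three_factors_planar[OF that(1-3)] three_factors_not_projective[OF that(1-3)]
      by (auto simp: crosscap_number_eq_1_iff)
  qed
  have S_ind: "S.indecomposable"
  proof (rule ccontr)
    assume "\<not> S.indecomposable"
    then obtain B C :: "('a, 'b) ring_scheme" where BC: "finite_cring B" "finite_cring C" "S \<simeq> RDirProd B C"
      using S.decomposable_product by blast
    have 1: "RDirProd S T \<simeq> RDirProd (RDirProd B C) T" by (rule RDirProd_iso_cong[OF BC(3) ring_iso_refl])
    have 2: "RDirProd (RDirProd B C) T \<simeq> RDirProd B (RDirProd C T)"
      using RDirProd_iso3 unfolding is_ring_iso_def by blast
    show False by (rule three[OF BC(1,2) T ring_iso_trans[OF ring_iso_trans[OF AST 1] 2]])
  qed
  have T_ind: "T.indecomposable"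
  proof (rule ccontr)
    assume "\<not> T.indecomposable"
    then obtain B C :: "('a, 'b) ring_scheme" where BC: "finite_cring B" "finite_cring C" "T \<simeq> RDirProd B C"
      using T.decomposable_product by blast
    have "RDirProd S T \<simeq> RDirProd S (RDirProd B C)" by (rule RDirProd_iso_cong[OF ring_iso_refl BC(3)])
    from three[OF S BC(1,2) ring_iso_trans[OF AST this]] show False .
  qed
  note S2 = S S_ind and T2 = T T_ind
  have ATS: "A \<simeq> RDirProd T S"
  proof -
    have "RDirProd S T \<simeq> RDirProd T S" using RDirProd_iso1[of S T] unfolding is_ring_iso_def by blast
    then show ?thesis by (rule ring_iso_trans[OF AST])
  qed
  have cST: "crosscap_number (line_graph (essential_graph (RDirProd S T))) = 1"
    and cTS: "crosscap_number (line_graph (essential_graph (RDirProd T S))) = 1"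
    using crosscap_number_iso[OF A(1) finite_cring_RDirProd AST] crosscap_number_iso[OF A(1) finite_cring_RDirProd ATS]
      one S T by simp_all
  have proj: "projective (line_graph (essential_graph (RDirProd S T)))" "projective (line_graph (essential_graph (RDirProd T S)))"
    and np: "\<not> planar (line_graph (essential_graph (RDirProd S T)))" "\<not> planar (line_graph (essential_graph (RDirProd T S)))"
    using cST cTS by (simp_all add: crosscap_number_eq_1_iff)
  have Z2: "B \<simeq> residue_ring 2" if "finite_cring B" "card (carrier B) = 2" for B :: "('a, 'b) ring_scheme"
    using finite_cring.iso_residue_ring_prime[OF that] by simp
  note prod = iso_RDirProd_trans
  have pos: "card (nilpotents S) \<ge> 1" "card (nilpotents T) \<ge> 1"
    using S.zero_nilpotent S.finite_nilpotents T.zero_nilpotent T.finite_nilpotents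
    by (metis One_nat_def Suc_leI card_gt_0_iff empty_iff)+
  consider "card (nilpotents T) \<ge> 2" | "card (nilpotents S) \<ge> 2" | "card (nilpotents S) = 1" "card (nilpotents T) = 1"
    using pos by linarith
  then show ?thesis
  proof cases
    case 1
    note c = nonreduced_pair[OF S2 T2 proj 1]
    from local_4_classification[OF T c(2,3)] show ?thesis
    proof
      assume "T \<simeq> residue_ring 4"
      from prod[OF AST Z2[OF S c(1)] this] show ?thesis by blast
    next
      assume "T \<simeq> dual_quotient"
      from prod[OF AST Z2[OF S c(1)] this] show ?thesis by blast
    qed
  next
    case 2
    note c = nonreduced_pair[OF T2 S2 proj(2,1) 2]
    from local_4_classification[OF S c(2,3)] show ?thesis
    proof
      assume "S \<simeq> residue_ring 4"
      from prod[OF ATS Z2[OF T c(1)] this] show ?thesis by blast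
    next
      assume "S \<simeq> dual_quotient"
      from prod[OF ATS Z2[OF T c(1)] this] show ?thesis by blast
    qed
  next
    case 3
    have nS: "nilpotents S = {\<zero>\<^bsub>S\<^esub>}" using 3(1) S.zero_nilpotent by (auto simp: card_1_singleton_iff)
    have nT: "nilpotents T = {\<zero>\<^bsub>T\<^esub>}" using 3(2) T.zero_nilpotent by (auto simp: card_1_singleton_iff)
    note cS = S.reduced_card[OF S_ind nS] and cT = T.reduced_card[OF T_ind nT]
    note K24 = product_K24[OF S2 T2] product_K24[OF T2 S2]
    have field_case: "A \<simeq> RDirProd (residue_ring 2) (residue_ring 7)"
      if B: "finite_cring B" "finite_cring.indecomposable B" "nilpotents B = {\<zero>\<^bsub>B\<^esub>}"
        and C: "finite_cring C" "finite_cring.indecomposable C" "nilpotents C = {\<zero>\<^bsub>C\<^esub>}"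
        and iso: "A \<simeq> RDirProd B C" and pr: "projective (line_graph (essential_graph (RDirProd B C)))"
        and npl: "\<not> planar (line_graph (essential_graph (RDirProd B C)))" and u: "card (Units B) = 1"
      for B C :: "('a, 'b) ring_scheme"
    proof -
      interpret B: finite_cring B by (rule B(1))
      interpret C: finite_cring C by (rule C(1))
      have "card (Units C) < 7" using product_star(1)[OF B(1,2) C(1,2)] pr by force
      moreover have "\<not> card (Units C) \<le> 4" using small_fields_planar[OF B C] npl u by auto
      moreover have "card (Units C) \<noteq> 5"
        using C.no_field_of_order_6[OF C(2,3)] C.reduced_card[OF C(2,3)] by simp
      ultimately have "card (carrier C) = 7" using C.reduced_card[OF C(2,3)] by simp
      then have "C \<simeq> residue_ring 7" using C.iso_residue_ring_prime[of 7] by simp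
      moreover have "B \<simeq> residue_ring 2" by (rule Z2[OF B(1)]) (use B.reduced_card[OF B(2,3)] u in simp)
      ultimately show ?thesis using prod[OF iso] by blast
    qed
    have uS: "card (Units S) \<ge> 1" and uT: "card (Units T) \<ge> 1"
      using S.card_carrier_ge_2 T.card_carrier_ge_2 cS cT by simp_all
    consider "card (Units S) = 1" | "card (Units T) = 1" | "card (Units S) \<ge> 2" "card (Units T) \<ge> 2"
      using uS uT by linarith
    then show ?thesis
    proof cases
      case 1
      then show ?thesis using field_case[OF S2 nS T2 nT AST proj(1) np(1)] by blast
    next
      case 2
      then show ?thesis using field_case[OF T2 nT S2 nS ATS proj(2) np(2)] by blast
    next
      case 3
      have "\<not> (4 \<le> card (Units S) \<or> 4 \<le> card (Units T))"
        using K24 proj 3 cS cT nS nT by auto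
      then have "card (Units S) \<le> 3" "card (Units T) \<le> 3" by linarith+
      moreover have "\<not> (card (Units S) \<le> 2 \<and> card (Units T) \<le> 3)" "\<not> (card (Units T) \<le> 2 \<and> card (Units S) \<le> 3)"
        using small_fields_planar[OF S2 nS T2 nT] small_fields_planar[OF T2 nT S2 nS] np by blast+
      ultimately have "card (carrier S) = 4" "card (carrier T) = 4" using cS cT by linarith+
      then have "S \<simeq> GF4" "T \<simeq> GF4" using S.iso_GF4[OF S_ind nS] T.iso_GF4[OF T_ind nT] by blast+
      then show ?thesis using prod[OF AST] by blast
    qed
  qed
qed

theorem theorem5p3:
  fixes A :: "('a, 'm) ring_scheme"
  assumes "cring A" and "\<one>\<^bsub>A\<^esub> \<noteq> \<zero>\<^bsub>A\<^esub>" and "finite (carrier A)" and "\<not> local_ring A"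
  shows "crosscap_number (line_graph (essential_graph A)) = 1 \<longleftrightarrow>
    A \<simeq> RDirProd (residue_ring 2) (residue_ring 4) \<or>
    A \<simeq> RDirProd (residue_ring 2)
          (UP (residue_ring 2) Quot
             (PIdl\<^bsub>UP (residue_ring 2)\<^esub> (monom (UP (residue_ring 2)) \<one>\<^bsub>residue_ring 2\<^esub> 2))) \<or>
    A \<simeq> RDirProd (residue_ring 2) (residue_ring 7) \<or>
    (\<exists>F :: nat ring. field F \<and> card (carrier F) = 4 \<and> A \<simeq> RDirProd F F)"
proof
  have A: "finite_cring A" using assms(1-3) by (simp add: finite_cring_def finite_cring_axioms_def)
  then have dec: "\<not> finite_cring.indecomposable A" using finite_cring.indecomposable_local assms(4) by blast
  {
    assume "crosscap_number (line_graph (essential_graph A)) = 1"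
    from classification[OF A dec this]
    show "A \<simeq> RDirProd (residue_ring 2) (residue_ring 4) \<or> A \<simeq> RDirProd (residue_ring 2) dual_quotient \<or>
      A \<simeq> RDirProd (residue_ring 2) (residue_ring 7) \<or>
      (\<exists>F :: nat ring. field F \<and> card (carrier F) = 4 \<and> A \<simeq> RDirProd F F)"
      using field_GF4 card_GF4 by blast
  }
  have Z: "finite_cring (residue_ring n)" "card (carrier (residue_ring n)) = nat n" if "n > 1" for n
    using finite_cring_residue_ring[OF that] by (simp_all add: residue_ring_def)
  note transfer = crosscap_number_iso[OF A]
  assume "A \<simeq> RDirProd (residue_ring 2) (residue_ring 4) \<or> A \<simeq> RDirProd (residue_ring 2) dual_quotient \<or>
      A \<simeq> RDirProd (residue_ring 2) (residue_ring 7) \<or>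
      (\<exists>F :: nat ring. field F \<and> card (carrier F) = 4 \<and> A \<simeq> RDirProd F F)"
  then consider (Z4) "A \<simeq> RDirProd (residue_ring 2) (residue_ring 4)"
    | (dual) "A \<simeq> RDirProd (residue_ring 2) dual_quotient"
    | (Z7) "A \<simeq> RDirProd (residue_ring 2) (residue_ring 7)"
    | (F4) F :: "nat ring" where "field F" "card (carrier F) = 4" "A \<simeq> RDirProd F F" by blast
  then show "crosscap_number (line_graph (essential_graph A)) = 1"
  proof cases
    case Z4
    have "crosscap_number (line_graph (essential_graph (RDirProd (residue_ring 2) (residue_ring 4)))) = 1"
    proof (rule wheel_crosscap[of _ _ 2])
      show "finite_cring (residue_ring 2)" "finite_cring (residue_ring 4)"
        "card (carrier (residue_ring 2)) = 2" "card (carrier (residue_ring 4)) = 4" using Z by simp_all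
    qed (simp_all add: residue_ring_def)
    then show ?thesis using transfer[OF finite_cring_RDirProd Z4] Z by simp
  next
    case dual
    have "RDirProd (residue_ring 2) dual_quotient \<simeq> RDirProd (residue_ring 2) dual_numbers"
      by (rule RDirProd_iso_cong[OF ring_iso_refl dual_quotient_iso])
    with dual have iso: "A \<simeq> RDirProd (residue_ring 2) dual_numbers" by (rule ring_iso_trans)
    have "crosscap_number (line_graph (essential_graph (RDirProd (residue_ring 2) dual_numbers))) = 1"
      by (rule wheel_crosscap[OF _ finite_cring_dual_numbers _ dual_numbers_n(1-4)]) (use Z in simp_all)
    then show ?thesis using transfer[OF finite_cring_RDirProd[OF Z(1) finite_cring_dual_numbers] iso] by simp
  next
    case Z7
    have fld: "field (residue_ring (int p))" if "Factorial_Ring.prime p" for p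
      using residues_prime.is_field[of p] that by (simp add: residues_prime_def)
    have fin: "finite (carrier (residue_ring n))" for n by (simp add: residue_ring_def)
    note Z2 = field_finite_cring[OF fld[of 2] fin, simplified] and Z7' = field_finite_cring[OF fld[of 7] fin, simplified]
    have "crosscap_number (line_graph (essential_graph (RDirProd (residue_ring 2) (residue_ring 7)))) = 1"
      by (rule F2_F7_crosscap[OF Z2 Z7'])
        (use finite_cring.reduced_card[OF Z2] finite_cring.reduced_card[OF Z7'] Z in simp_all)
    then show ?thesis using transfer[OF finite_cring_RDirProd Z7] Z by simp
  next
    case F4
    have "finite (carrier F)" using F4(2) by (metis card.infinite zero_neq_numeral)
    note F = field_finite_cring[OF F4(1) this]
    have "card (Units F) = 3" using finite_cring.reduced_card[OF F] F4(2) by simp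
    then have "crosscap_number (line_graph (essential_graph (RDirProd F F))) = 1"
      using F4_F4_crosscap[OF F F] by simp
    then show ?thesis using transfer[OF finite_cring_RDirProd F4(3)] F(1) by simp
  qed
qed

end
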